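(* Let $R$ be a unital commutative associative ring with $2\in R^\times$, $S$ a quadratic étale $R$-algebra with canonical involution $\overline{\phantom{x}}$, $(P,h)$ a nondegenerate $\overline{\phantom{x}}$-hermitian space of rank three over $S$ with trivial determinant, and $\alpha:\bigwedge^3(P,h)\to\langle1\rangle$ an isomorphism. Then $${\rm Der}({\rm Col}(S,P,h,\alpha))={\rm Der}_S({\rm Cay}(S,P,h,\alpha))={\rm Der}(W(S,P,h,\alpha)),$$ where derivations of ${\rm Col}(S,P,h,\alpha)$ and elements of ${\rm Der}_S({\rm Cay}(S,P,h,\alpha))$ are identified with derivations of $W(S,P,h,\alpha)$ by restriction to $P$ (a derivation of $W(S,P,h,\alpha)$ being extended by $0$ on $R$, respectively on $S$).
   Context: A nondegenerate hermitian space $(P,h)$ of rank three over $S$ is a finitely generated projective $S$-module $P$ of constant rank three with a biadditive map $h:P\times P\to S$ that is $S$-linear in the first and conjugate-linear in the second variable, satisfies $h(w,w')=\overline{h(w',w)}$, and is such that $w\mapsto h(\cdot,w)$ is a conjugate-linear bijection $P\to{\rm Hom}_S(P,S)$. $\bigwedge^3(P,h)$ is $\bigwedge^3_S P$ with the hermitian form determined by $(u_1\wedge u_2\wedge u_3,v_1\wedge v_2\wedge v_3)\mapsto\det(h(u_i,v_j))$; $\langle1\rangle$ is $S$ with the form $(a,b)\mapsto a\bar b$. The space has trivial determinant if there is an isomorphism of hermitian spaces $\alpha:\bigwedge^3(P,h)\to\langle1\rangle$. Given $\alpha$, the cross product $\times_\alpha:P\times P\to P$ is defined by $h(u,v\times_\alpha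 w)=\alpha(u\wedge v\wedge w)$ for all $u,v,w\in P$. The associated $R$-algebras are: - $W(S,P,h,\alpha)=(P,\times_\alpha)$ (vector algebra); - ${\rm Col}(S,P,h,\alpha)=R\oplus P$ with $(a,u)(b,v)=(ab-\frac12(h(u,v)+\overline{h(u,v)}),\,va+ub+u\times_\alpha v)$ for $a,b\in R$, $u,v\in P$ (colour algebra); - ${\rm Cay}(S,P,h,\alpha)=S\oplus P$ with $(a,u)(b,v)=(ab-h(u,v),\,va+u\bar b+u\times_\alpha v)$ for $a,b\in S$, $u,v\in P$ (octonion algebra). ${\rm Der}(A)$ is the Lie algebra of $R$-linear derivations of an $R$-algebra $A$, and for $A={\rm Cay}(S,P,h,\alpha)$, ${\rm Der}_S(A)=\{d\in{\rm Der}(A): d|_S=0\}$. *)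

theory Defs
  imports "HOL-Algebra.Ideal" "HOL-Algebra.Module"
begin

section \<open>Linear maps, free, projective and localized modules\<close>

definition linear_map ::
  "('r, 'd) ring_scheme \<Rightarrow> ('r, 'a, 'e) module_scheme \<Rightarrow> ('r, 'b, 'f) module_scheme \<Rightarrow> ('a \<Rightarrow> 'b) \<Rightarrow> bool"
  where "linear_map R M N f \<longleftrightarrow>
    f \<in> carrier M \<rightarrow> carrier N \<and>
    (\<forall>x\<in>carrier M. \<forall>y\<in>carrier M. f (x \<oplus>\<^bsub>M\<^esub> y) = f x \<oplus>\<^bsub>N\<^esub> f y) \<and>
    (\<forall>r\<in>carrier R. \<forall>x\<in>carrier M. f (r \<odot>\<^bsub>M\<^esub> x) = r \<odot>\<^bsub>N\<^esub> f x)"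

text \<open>Extensionality makes a function on the carrier the same thing as a HOL function, so that
  bijections onto Hom modules can be stated.\<close>

definition Hom_module ::
  "('r, 'd) ring_scheme \<Rightarrow> ('r, 'a, 'e) module_scheme \<Rightarrow> ('r, 'b, 'f) module_scheme \<Rightarrow> ('a \<Rightarrow> 'b) set"
  where "Hom_module R M N = {f. linear_map R M N f \<and> f \<in> extensional (carrier M)}"

definition regular_module :: "('r, 'd) ring_scheme \<Rightarrow> ('r, 'r) module"
  where "regular_module R =
    \<lparr>carrier = carrier R, mult = mult R, one = \<one>\<^bsub>R\<^esub>, zero = \<zero>\<^bsub>R\<^esub>, add = add R, smult = mult R\<rparr>"

definition free_of_rank :: "('r, 'd) ring_scheme \<Rightarrow> ('r, 'm, 'e) module_scheme \<Rightarrow> nat \<Rightarrow> bool"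
  where "free_of_rank R M n \<longleftrightarrow>
    (\<exists>b. b \<in> {..<n} \<rightarrow> carrier M \<and>
      (\<forall>x\<in>carrier M. \<exists>!c. c \<in> {..<n} \<rightarrow>\<^sub>E carrier R \<and>
         x = (\<Oplus>\<^bsub>M\<^esub>i\<in>{..<n}. c i \<odot>\<^bsub>M\<^esub> b i)))"

text \<open>The data of linear maps $R^n \to M$ (given by the images $x_i$ of the unit vectors) and
  $M \to R^n$ (given by its coordinates $\varphi_i$) whose composite $M \to R^n \to M$ is the
  identity.  Such data exist for some $n$ iff $M$ is a direct summand of some $R^n$.\<close>

definition dual_basis ::
  "('r, 'd) ring_scheme \<Rightarrow> ('r, 'm, 'e) module_scheme \<Rightarrow> nat \<Rightarrow> (nat \<Rightarrow> 'm) \<Rightarrow> (nat \<Rightarrow> 'm \<Rightarrow> 'r) \<Rightarrow> bool"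
  where "dual_basis R M n x \<phi> \<longleftrightarrow>
    x \<in> {..<n} \<rightarrow> carrier M \<and>
    (\<forall>i<n. linear_map R M (regular_module R) (\<phi> i)) \<and>
    (\<forall>y\<in>carrier M. y = (\<Oplus>\<^bsub>M\<^esub>i\<in>{..<n}. \<phi> i y \<odot>\<^bsub>M\<^esub> x i))"

definition fg_projective :: "('r, 'd) ring_scheme \<Rightarrow> ('r, 'm, 'e) module_scheme \<Rightarrow> bool"
  where "fg_projective R M \<longleftrightarrow> (\<exists>n x \<phi>. dual_basis R M n x \<phi>)"

text \<open>The fraction $x/s$ in the localization of $M$ at the complement of a prime $p$, as an
  equivalence class of pairs.  The operations below take unions over representatives, all of
  which contribute the same class.\<close>

definition fraction ::
  "('r, 'd) ring_scheme \<Rightarrow> ('r, 'm, 'e) module_scheme \<Rightarrow> 'r set \<Rightarrow> 'm \<Rightarrow> 'r \<Rightarrow> ('m \<times> 'r) set"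
  where "fraction R M p x s =
    {(y, t). y \<in> carrier M \<and> t \<in> carrier R - p \<and>
       (\<exists>u\<in>carrier R - p. u \<odot>\<^bsub>M\<^esub> (t \<odot>\<^bsub>M\<^esub> x) = u \<odot>\<^bsub>M\<^esub> (s \<odot>\<^bsub>M\<^esub> y))}"

definition localized_module ::
  "('r, 'd) ring_scheme \<Rightarrow> ('r, 'm, 'e) module_scheme \<Rightarrow> 'r set
     \<Rightarrow> (('r \<times> 'r) set, ('m \<times> 'r) set) module"
  where "localized_module R M p =
    \<lparr>carrier = {fraction R M p x s | x s. x \<in> carrier M \<and> s \<in> carrier R - p},
     mult = undefined,
     one = undefined,
     zero = fraction R M p \<zero>\<^bsub>M\<^esub> \<one>\<^bsub>R\<^esub>,
     add = (\<lambda>X Y. \<Union>(x, s)\<in>X. \<Union>(y, t)\<in>Y.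
              fraction R M p (t \<odot>\<^bsub>M\<^esub> x \<oplus>\<^bsub>M\<^esub> s \<odot>\<^bsub>M\<^esub> y) (s \<otimes>\<^bsub>R\<^esub> t)),
     smult = (\<lambda>A X. \<Union>(a, s)\<in>A. \<Union>(x, t)\<in>X. fraction R M p (a \<odot>\<^bsub>M\<^esub> x) (s \<otimes>\<^bsub>R\<^esub> t))\<rparr>"

definition localized_ring :: "('r, 'd) ring_scheme \<Rightarrow> 'r set \<Rightarrow> ('r \<times> 'r) set ring"
  where "localized_ring R p =
    (let L = localized_module R (regular_module R) p in
     \<lparr>carrier = carrier L,
      mult = smult L,
      one = fraction R (regular_module R) p \<one>\<^bsub>R\<^esub> \<one>\<^bsub>R\<^esub>,
      zero = zero L,
      add = add L\<rparr>)"

definition has_constant_rank :: "('r, 'd) ring_scheme \<Rightarrow> ('r, 'm, 'e) module_scheme \<Rightarrow> nat \<Rightarrow> bool"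
  where "has_constant_rank R M n \<longleftrightarrow>
    (\<forall>p. primeideal p R \<longrightarrow> free_of_rank (localized_ring R p) (localized_module R M p) n)"


section \<open>Quadratic etale algebras\<close>

text \<open>The trace of an endomorphism of a finitely generated projective module, computed with
  any dual basis.\<close>

definition module_trace ::
  "('r, 'd) ring_scheme \<Rightarrow> ('r, 'm, 'e) module_scheme \<Rightarrow> ('m \<Rightarrow> 'm) \<Rightarrow> 'r"
  where "module_trace R M f =
    (THE t. \<exists>n x \<phi>. dual_basis R M n x \<phi> \<and> t = (\<Oplus>\<^bsub>R\<^esub>i\<in>{..<n}. \<phi> i (f (x i))))"

definition algebra_trace :: "('r, 'd) ring_scheme \<Rightarrow> ('r, 's, 'e) module_scheme \<Rightarrow> 's \<Rightarrow> 'r"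
  where "algebra_trace R S a = module_trace R S (\<lambda>b. a \<otimes>\<^bsub>S\<^esub> b)"

text \<open>A commutative algebra that is finitely generated projective as a module is etale iff its
  trace form $(a,b) \mapsto {\rm tr}(ab)$ is nondegenerate.\<close>

definition quadratic_etale :: "('r, 'd) ring_scheme \<Rightarrow> ('r, 's, 'e) module_scheme \<Rightarrow> bool"
  where "quadratic_etale R S \<longleftrightarrow>
    algebra R S \<and> fg_projective R S \<and> has_constant_rank R S 2 \<and>
    bij_betw (\<lambda>a. \<lambda>b\<in>carrier S. algebra_trace R S (a \<otimes>\<^bsub>S\<^esub> b))
      (carrier S) (Hom_module R S (regular_module R))"

definition canonical_involution :: "('r, 'd) ring_scheme \<Rightarrow> ('r, 's, 'e) module_scheme \<Rightarrow> 's \<Rightarrow> 's"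
  where "canonical_involution R S a = (algebra_trace R S a \<odot>\<^bsub>S\<^esub> \<one>\<^bsub>S\<^esub>) \<ominus>\<^bsub>S\<^esub> a"


section \<open>Hermitian spaces of rank three and their third exterior power\<close>

definition nondegenerate_hermitian ::
  "('s, 'd) ring_scheme \<Rightarrow> ('s \<Rightarrow> 's) \<Rightarrow> ('s, 'p, 'e) module_scheme \<Rightarrow> ('p \<Rightarrow> 'p \<Rightarrow> 's) \<Rightarrow> bool"
  where "nondegenerate_hermitian S cnj P h \<longleftrightarrow>
    (\<forall>u\<in>carrier P. \<forall>v\<in>carrier P. h u v \<in> carrier S) \<and>
    (\<forall>u\<in>carrier P. \<forall>u'\<in>carrier P. \<forall>v\<in>carrier P.
       h (u \<oplus>\<^bsub>P\<^esub> u') v = h u v \<oplus>\<^bsub>S\<^esub> h u' v \<and> h v (u \<oplus>\<^bsub>P\<^esub> u') = h v u \<oplus>\<^bsub>S\<^esub> h v u') \<and>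
    (\<forall>a\<in>carrier S. \<forall>u\<in>carrier P. \<forall>v\<in>carrier P.
       h (a \<odot>\<^bsub>P\<^esub> u) v = a \<otimes>\<^bsub>S\<^esub> h u v \<and> h u (a \<odot>\<^bsub>P\<^esub> v) = h u v \<otimes>\<^bsub>S\<^esub> cnj a) \<and>
    (\<forall>u\<in>carrier P. \<forall>v\<in>carrier P. h u v = cnj (h v u)) \<and>
    bij_betw (\<lambda>w. \<lambda>u\<in>carrier P. h u w) (carrier P) (Hom_module S P (regular_module S))"

definition hermitian_space_rank3 ::
  "('s, 'd) ring_scheme \<Rightarrow> ('s \<Rightarrow> 's) \<Rightarrow> ('s, 'p, 'e) module_scheme \<Rightarrow> ('p \<Rightarrow> 'p \<Rightarrow> 's) \<Rightarrow> bool"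
  where "hermitian_space_rank3 S cnj P h \<longleftrightarrow>
    module S P \<and> fg_projective S P \<and> has_constant_rank S P 3 \<and> nondegenerate_hermitian S cnj P h"

text \<open>The third exterior power is the free module on triples modulo the submodule generated by
  the relations expressing that the wedge of three vectors is trilinear and alternating.\<close>

definition free_triples ::
  "('s, 'd) ring_scheme \<Rightarrow> ('s, 'p, 'e) module_scheme \<Rightarrow> ('s, 'p \<times> 'p \<times> 'p \<Rightarrow> 's) module"
  where "free_triples S P =
    \<lparr>carrier = {f. finite {t. f t \<noteq> \<zero>\<^bsub>S\<^esub>} \<and> (\<forall>t. f t \<in> carrier S) \<and>
                 {t. f t \<noteq> \<zero>\<^bsub>S\<^esub>} \<subseteq> carrier P \<times> carrier P \<times> carrier P},
     mult = undefined,
     one = undefined,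
     zero = (\<lambda>t. \<zero>\<^bsub>S\<^esub>),
     add = (\<lambda>f g t. f t \<oplus>\<^bsub>S\<^esub> g t),
     smult = (\<lambda>a f t. a \<otimes>\<^bsub>S\<^esub> f t)\<rparr>"

definition triple_gen :: "('s, 'd) ring_scheme \<Rightarrow> 'p \<Rightarrow> 'p \<Rightarrow> 'p \<Rightarrow> 'p \<times> 'p \<times> 'p \<Rightarrow> 's"
  where "triple_gen S u v w = (\<lambda>t. if t = (u, v, w) then \<one>\<^bsub>S\<^esub> else \<zero>\<^bsub>S\<^esub>)"

definition linearity_defect ::
  "('s, 'd) ring_scheme \<Rightarrow> ('s, 'p, 'e) module_scheme \<Rightarrow> ('s, 'm, 'f) module_scheme
     \<Rightarrow> ('p \<Rightarrow> 'm) \<Rightarrow> 's \<Rightarrow> 's \<Rightarrow> 'p \<Rightarrow> 'p \<Rightarrow> 'm"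
  where "linearity_defect S P M f a b u v =
    f (a \<odot>\<^bsub>P\<^esub> u \<oplus>\<^bsub>P\<^esub> b \<odot>\<^bsub>P\<^esub> v) \<ominus>\<^bsub>M\<^esub> (a \<odot>\<^bsub>M\<^esub> f u \<oplus>\<^bsub>M\<^esub> b \<odot>\<^bsub>M\<^esub> f v)"

definition wedge_relations ::
  "('s, 'd) ring_scheme \<Rightarrow> ('s, 'p, 'e) module_scheme \<Rightarrow> ('p \<times> 'p \<times> 'p \<Rightarrow> 's) set"
  where "wedge_relations S P =
    {linearity_defect S P (free_triples S P) (\<lambda>z. triple_gen S z x y) a b u v | a b u v x y.
       {a, b} \<subseteq> carrier S \<and> {u, v, x, y} \<subseteq> carrier P} \<union>
    {linearity_defect S P (free_triples S P) (\<lambda>z. triple_gen S x z y) a b u v | a b u v x y.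
       {a, b} \<subseteq> carrier S \<and> {u, v, x, y} \<subseteq> carrier P} \<union>
    {linearity_defect S P (free_triples S P) (\<lambda>z. triple_gen S x y z) a b u v | a b u v x y.
       {a, b} \<subseteq> carrier S \<and> {u, v, x, y} \<subseteq> carrier P} \<union>
    {triple_gen S u v w | u v w. {u, v, w} \<subseteq> carrier P \<and> (u = v \<or> v = w \<or> u = w)}"

definition wedge_submodule ::
  "('s, 'd) ring_scheme \<Rightarrow> ('s, 'p, 'e) module_scheme \<Rightarrow> ('p \<times> 'p \<times> 'p \<Rightarrow> 's) set"
  where "wedge_submodule S P =
    \<Inter>{N. submodule N S (free_triples S P) \<and> wedge_relations S P \<subseteq> N}"

definition exterior_cube ::
  "('s, 'd) ring_scheme \<Rightarrow> ('s, 'p, 'e) module_scheme \<Rightarrow> ('s, ('p \<times> 'p \<times> 'p \<Rightarrow> 's) set) module"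
  where "exterior_cube S P =
    (let F = free_triples S P; N = wedge_submodule S P in
     \<lparr>carrier = a_rcosets\<^bsub>F\<^esub> N,
      mult = undefined,
      one = undefined,
      zero = N,
      add = set_add F,
      smult = (\<lambda>a X. \<Union>f\<in>X. N +>\<^bsub>F\<^esub> (a \<odot>\<^bsub>F\<^esub> f))\<rparr>)"

definition wedge3 ::
  "('s, 'd) ring_scheme \<Rightarrow> ('s, 'p, 'e) module_scheme \<Rightarrow> 'p \<Rightarrow> 'p \<Rightarrow> 'p \<Rightarrow> ('p \<times> 'p \<times> 'p \<Rightarrow> 's) set"
  where "wedge3 S P u v w = wedge_submodule S P +>\<^bsub>free_triples S P\<^esub> triple_gen S u v w"

definition gram_det3 ::
  "('s, 'd) ring_scheme \<Rightarrow> ('p \<Rightarrow> 'p \<Rightarrow> 's) \<Rightarrow> 'p \<times> 'p \<times> 'p \<Rightarrow> 'p \<times> 'p \<times> 'p \<Rightarrow> 's"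
  where "gram_det3 S h = (\<lambda>(u1, u2, u3) (v1, v2, v3).
    (h u1 v1 \<otimes>\<^bsub>S\<^esub> (h u2 v2 \<otimes>\<^bsub>S\<^esub> h u3 v3 \<ominus>\<^bsub>S\<^esub> h u2 v3 \<otimes>\<^bsub>S\<^esub> h u3 v2))
    \<ominus>\<^bsub>S\<^esub> (h u1 v2 \<otimes>\<^bsub>S\<^esub> (h u2 v1 \<otimes>\<^bsub>S\<^esub> h u3 v3 \<ominus>\<^bsub>S\<^esub> h u2 v3 \<otimes>\<^bsub>S\<^esub> h u3 v1))
    \<oplus>\<^bsub>S\<^esub> (h u1 v3 \<otimes>\<^bsub>S\<^esub> (h u2 v1 \<otimes>\<^bsub>S\<^esub> h u3 v2 \<ominus>\<^bsub>S\<^esub> h u2 v2 \<otimes>\<^bsub>S\<^esub> h u3 v1)))"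

text \<open>The sesquilinear extension of the Gram determinant to the exterior cube, evaluated on
  representatives in the free module on triples.\<close>

definition exterior_cube_form ::
  "('s, 'd) ring_scheme \<Rightarrow> ('s \<Rightarrow> 's) \<Rightarrow> ('p \<Rightarrow> 'p \<Rightarrow> 's)
     \<Rightarrow> ('p \<times> 'p \<times> 'p \<Rightarrow> 's) set \<Rightarrow> ('p \<times> 'p \<times> 'p \<Rightarrow> 's) set \<Rightarrow> 's"
  where "exterior_cube_form S cnj h X Y =
    (THE c. \<exists>f\<in>X. \<exists>g\<in>Y. c =
      (\<Oplus>\<^bsub>S\<^esub>s\<in>{s. f s \<noteq> \<zero>\<^bsub>S\<^esub>}. \<Oplus>\<^bsub>S\<^esub>t\<in>{t. g t \<noteq> \<zero>\<^bsub>S\<^esub>}.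
         (f s \<otimes>\<^bsub>S\<^esub> cnj (g t)) \<otimes>\<^bsub>S\<^esub> gram_det3 S h s t))"

definition hermitian_iso ::
  "('s, 'd) ring_scheme \<Rightarrow> ('s, 'm, 'e) module_scheme \<Rightarrow> ('m \<Rightarrow> 'm \<Rightarrow> 's)
     \<Rightarrow> ('s, 'n, 'f) module_scheme \<Rightarrow> ('n \<Rightarrow> 'n \<Rightarrow> 's) \<Rightarrow> ('m \<Rightarrow> 'n) \<Rightarrow> bool"
  where "hermitian_iso S M h N k \<alpha> \<longleftrightarrow>
    linear_map S M N \<alpha> \<and> bij_betw \<alpha> (carrier M) (carrier N) \<and>
    (\<forall>x\<in>carrier M. \<forall>y\<in>carrier M. k (\<alpha> x) (\<alpha> y) = h x y)"

definition determinant_trivialization ::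
  "('s, 'd) ring_scheme \<Rightarrow> ('s \<Rightarrow> 's) \<Rightarrow> ('s, 'p, 'e) module_scheme \<Rightarrow> ('p \<Rightarrow> 'p \<Rightarrow> 's)
     \<Rightarrow> (('p \<times> 'p \<times> 'p \<Rightarrow> 's) set \<Rightarrow> 's) \<Rightarrow> bool"
  where "determinant_trivialization S cnj P h \<alpha> \<longleftrightarrow>
    hermitian_iso S (exterior_cube S P) (exterior_cube_form S cnj h)
      (regular_module S) (\<lambda>a b. a \<otimes>\<^bsub>S\<^esub> cnj b) \<alpha>"

definition cross_product ::
  "('s, 'd) ring_scheme \<Rightarrow> ('s, 'p, 'e) module_scheme \<Rightarrow> ('p \<Rightarrow> 'p \<Rightarrow> 's)
     \<Rightarrow> (('p \<times> 'p \<times> 'p \<Rightarrow> 's) set \<Rightarrow> 's) \<Rightarrow> 'p \<Rightarrow> 'p \<Rightarrow> 'p"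
  where "cross_product S P h \<alpha> v w =
    (THE x. x \<in> carrier P \<and> (\<forall>u\<in>carrier P. h u x = \<alpha> (wedge3 S P u v w)))"


section \<open>The vector, colour and octonion algebras\<close>

text \<open>Nonassociative algebras over \<open>R\<close> are represented by the record type of modules,
  with the product in the field \<open>mult\<close>; \<open>one\<close> is irrelevant where the algebra has no unit.
  An element \<open>r\<close> of \<open>R\<close> acts on \<open>P\<close> through its image \<open>r \<odot> \<one>\<close> in \<open>S\<close>.\<close>

definition base_smult ::
  "('r, 's, 'd) module_scheme \<Rightarrow> ('s, 'p, 'e) module_scheme \<Rightarrow> 'r \<Rightarrow> 'p \<Rightarrow> 'p"
  where "base_smult S P r u = (r \<odot>\<^bsub>S\<^esub> \<one>\<^bsub>S\<^esub>) \<odot>\<^bsub>P\<^esub> u"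

definition vector_algebra ::
  "('r, 's, 'd) module_scheme \<Rightarrow> ('s, 'p, 'e) module_scheme \<Rightarrow> ('p \<Rightarrow> 'p \<Rightarrow> 's)
     \<Rightarrow> (('p \<times> 'p \<times> 'p \<Rightarrow> 's) set \<Rightarrow> 's) \<Rightarrow> ('r, 'p) module"
  where "vector_algebra S P h \<alpha> =
    \<lparr>carrier = carrier P,
     mult = cross_product S P h \<alpha>,
     one = undefined,
     zero = \<zero>\<^bsub>P\<^esub>,
     add = add P,
     smult = base_smult S P\<rparr>"

text \<open>The element of \<open>R\<close> whose image in \<open>S\<close> is \<open>x\<close>, for \<open>x\<close> in the image of \<open>R\<close>.\<close>

definition base_preimage :: "('r, 'c) ring_scheme \<Rightarrow> ('r, 's, 'd) module_scheme \<Rightarrow> 's \<Rightarrow> 'r"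
  where "base_preimage R S x = (THE r. r \<in> carrier R \<and> r \<odot>\<^bsub>S\<^esub> \<one>\<^bsub>S\<^esub> = x)"

definition colour_algebra ::
  "('r, 'c) ring_scheme \<Rightarrow> ('r, 's, 'd) module_scheme \<Rightarrow> ('s, 'p, 'e) module_scheme
     \<Rightarrow> ('p \<Rightarrow> 'p \<Rightarrow> 's) \<Rightarrow> (('p \<times> 'p \<times> 'p \<Rightarrow> 's) set \<Rightarrow> 's) \<Rightarrow> ('r, 'r \<times> 'p) module"
  where "colour_algebra R S P h \<alpha> =
    (let cnj = canonical_involution R S; half = inv\<^bsub>R\<^esub> (\<one>\<^bsub>R\<^esub> \<oplus>\<^bsub>R\<^esub> \<one>\<^bsub>R\<^esub>) in
     \<lparr>carrier = carrier R \<times> carrier P,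
      mult = (\<lambda>(a, u) (b, v).
        ((a \<otimes>\<^bsub>R\<^esub> b) \<ominus>\<^bsub>R\<^esub> (half \<otimes>\<^bsub>R\<^esub> base_preimage R S (h u v \<oplus>\<^bsub>S\<^esub> cnj (h u v))),
         base_smult S P a v \<oplus>\<^bsub>P\<^esub> base_smult S P b u \<oplus>\<^bsub>P\<^esub> cross_product S P h \<alpha> u v)),
      one = (\<one>\<^bsub>R\<^esub>, \<zero>\<^bsub>P\<^esub>),
      zero = (\<zero>\<^bsub>R\<^esub>, \<zero>\<^bsub>P\<^esub>),
      add = (\<lambda>(a, u) (b, v). (a \<oplus>\<^bsub>R\<^esub> b, u \<oplus>\<^bsub>P\<^esub> v)),
      smult = (\<lambda>r (a, u). (r \<otimes>\<^bsub>R\<^esub> a, base_smult S P r u))\<rparr>)"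

definition octonion_algebra ::
  "('r, 'c) ring_scheme \<Rightarrow> ('r, 's, 'd) module_scheme \<Rightarrow> ('s, 'p, 'e) module_scheme
     \<Rightarrow> ('p \<Rightarrow> 'p \<Rightarrow> 's) \<Rightarrow> (('p \<times> 'p \<times> 'p \<Rightarrow> 's) set \<Rightarrow> 's) \<Rightarrow> ('r, 's \<times> 'p) module"
  where "octonion_algebra R S P h \<alpha> =
    (let cnj = canonical_involution R S in
     \<lparr>carrier = carrier S \<times> carrier P,
      mult = (\<lambda>(a, u) (b, v).
        ((a \<otimes>\<^bsub>S\<^esub> b) \<ominus>\<^bsub>S\<^esub> h u v,
         a \<odot>\<^bsub>P\<^esub> v \<oplus>\<^bsub>P\<^esub> cnj b \<odot>\<^bsub>P\<^esub> u \<oplus>\<^bsub>P\<^esub> cross_product S P h \<alpha> u v)),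
      one = (\<one>\<^bsub>S\<^esub>, \<zero>\<^bsub>P\<^esub>),
      zero = (\<zero>\<^bsub>S\<^esub>, \<zero>\<^bsub>P\<^esub>),
      add = (\<lambda>(a, u) (b, v). (a \<oplus>\<^bsub>S\<^esub> b, u \<oplus>\<^bsub>P\<^esub> v)),
      smult = (\<lambda>r (a, u). (r \<odot>\<^bsub>S\<^esub> a, base_smult S P r u))\<rparr>)"


section \<open>Derivations\<close>

definition derivations :: "('r, 'c) ring_scheme \<Rightarrow> ('r, 'a, 'd) module_scheme \<Rightarrow> ('a \<Rightarrow> 'a) set"
  where "derivations R A =
    {d \<in> Hom_module R A A. \<forall>x\<in>carrier A. \<forall>y\<in>carrier A.
       d (x \<otimes>\<^bsub>A\<^esub> y) = (d x \<otimes>\<^bsub>A\<^esub> y) \<oplus>\<^bsub>A\<^esub> (x \<otimes>\<^bsub>A\<^esub> d y)}"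

text \<open>A set of endomorphisms of \<open>A\<close> as a Lie algebra, with the commutator as its product.\<close>

definition lie_algebra_on :: "('r, 'a, 'd) module_scheme \<Rightarrow> ('a \<Rightarrow> 'a) set \<Rightarrow> ('r, 'a \<Rightarrow> 'a) module"
  where "lie_algebra_on A D =
    \<lparr>carrier = D,
     mult = (\<lambda>d e. \<lambda>x\<in>carrier A. d (e x) \<ominus>\<^bsub>A\<^esub> e (d x)),
     one = undefined,
     zero = (\<lambda>x\<in>carrier A. \<zero>\<^bsub>A\<^esub>),
     add = (\<lambda>d e. \<lambda>x\<in>carrier A. d x \<oplus>\<^bsub>A\<^esub> e x),
     smult = (\<lambda>r d. \<lambda>x\<in>carrier A. r \<odot>\<^bsub>A\<^esub> d x)\<rparr>"

definition Der :: "('r, 'c) ring_scheme \<Rightarrow> ('r, 'a, 'd) module_scheme \<Rightarrow> ('r, 'a \<Rightarrow> 'a) module"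
  where "Der R A = lie_algebra_on A (derivations R A)"

text \<open>\<open>Der_S\<close> is meant for the octonion algebra, in which \<open>S\<close> sits as \<open>S \<times> {\<zero>}\<close>.\<close>

definition Der_S ::
  "('r, 'c) ring_scheme \<Rightarrow> ('r, 's, 'd) module_scheme \<Rightarrow> ('s, 'p, 'e) module_scheme
     \<Rightarrow> ('r, 's \<times> 'p, 'f) module_scheme \<Rightarrow> ('r, 's \<times> 'p \<Rightarrow> 's \<times> 'p) module"
  where "Der_S R S P A =
    lie_algebra_on A {d \<in> derivations R A. \<forall>a\<in>carrier S. d (a, \<zero>\<^bsub>P\<^esub>) = \<zero>\<^bsub>A\<^esub>}"

definition lie_iso ::
  "('r, 'c) ring_scheme \<Rightarrow> ('r, 'a, 'd) module_scheme \<Rightarrow> ('r, 'b, 'e) module_scheme \<Rightarrow> ('a \<Rightarrow> 'b) \<Rightarrow> bool"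
  where "lie_iso R L L' f \<longleftrightarrow>
    linear_map R L L' f \<and> bij_betw f (carrier L) (carrier L') \<and>
    (\<forall>x\<in>carrier L. \<forall>y\<in>carrier L. f (x \<otimes>\<^bsub>L\<^esub> y) = f x \<otimes>\<^bsub>L'\<^esub> f y)"

text \<open>Restriction of an endomorphism of \<open>Z \<oplus> P\<close> to \<open>P\<close>, and extension of an endomorphism of
  \<open>P\<close> by zero on \<open>Z\<close>.  Restriction drops the \<open>Z\<close>-component of the values; this is restriction
  proper for the maps that are recovered from it by \<open>extend_by_zero\<close>.\<close>

definition restrict_to_P ::
  "('z, 'c) ring_scheme \<Rightarrow> ('s, 'p, 'e) module_scheme \<Rightarrow> ('z \<times> 'p \<Rightarrow> 'z \<times> 'p) \<Rightarrow> 'p \<Rightarrow> 'p"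
  where "restrict_to_P Z P d = (\<lambda>u\<in>carrier P. snd (d (\<zero>\<^bsub>Z\<^esub>, u)))"

definition extend_by_zero ::
  "('z, 'c) ring_scheme \<Rightarrow> ('s, 'p, 'e) module_scheme \<Rightarrow> ('p \<Rightarrow> 'p) \<Rightarrow> 'z \<times> 'p \<Rightarrow> 'z \<times> 'p"
  where "extend_by_zero Z P D = (\<lambda>x\<in>carrier Z \<times> carrier P. (\<zero>\<^bsub>Z\<^esub>, D (snd x)))"

end

theory Submission
  imports Defs
begin

text \<open>
  A derivation of the colour algebra, or a derivation of the octonion algebra that kills \<open>S\<close>, is
  given on \<open>P\<close> by a scalar component \<open>f\<close> and a vector component \<open>D\<close>.  Once \<open>f = 0\<close> is known, comparing
  vector components in the product rule says that \<open>D\<close> is a derivation of the vector algebra.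
  Conversely, the extension by zero of a derivation \<open>D\<close> of the vector algebra respects the products
  of the two bigger algebras as soon as \<open>D\<close> is \<open>S\<close>-linear and skew, that is
  \<open>h (D u) v + h u (D v) = 0\<close>.  So there are four things to prove: \<open>D_linear\<close>, \<open>D_skew\<close>,
  \<open>real_component_zero\<close> and \<open>extension_component_zero\<close>.

  They all rest on the algebra of the cross product.  Write \<open>vol u v w\<close> for the value of \<open>\<alpha>\<close> on the
  wedge of \<open>u, v, w\<close>.  Since \<open>\<alpha>\<close> is an isometry, \<open>vol u v w\<close> times the conjugate of \<open>vol x y z\<close> is the
  Gram determinant of the six vectors; since \<open>\<alpha>\<close> is onto, the values of \<open>vol\<close> generate the unit ideal
  of \<open>S\<close>.  These two facts and the nondegeneracy of \<open>h\<close> replace a choice of bases: they give Cramer's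
  rule multiplied by \<open>vol a b c\<close> (lemma \<open>cramer\<close>), so an identity that holds for \<open>a, b, c\<close> propagates
  to all of \<open>P\<close> up to a power of \<open>vol a b c\<close>, and such powers still generate the unit ideal.
  In this way one obtains the expansion of the triple product
  \<open>u \<times> (v \<times> w) = h w u v - h v u w\<close>, the fact that \<open>P\<close> is additively spanned by the cross products
  (\<open>cross_products_span\<close>), and the vanishing of every additive \<open>n\<close> with \<open>vol u v w n(u) = 0\<close>
  (\<open>vol_annihilates\<close>).

  For the linearity of \<open>D\<close>, put \<open>E a u = D (a u) - a (D u)\<close>.  The cross product is conjugate linear in
  both arguments, so \<open>(a u) \<times> v = u \<times> (a v)\<close>, whence \<open>E a u \<times> v = u \<times> E a v\<close>; with the triple product
  this forces \<open>E a\<close> to be multiplication by a scalar \<open>l a\<close>.  The map \<open>l\<close> is an \<open>R\<close>-linear derivation of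
  \<open>S\<close>, and the etale algebra \<open>S\<close> has none but zero.  Skewness follows by applying \<open>D\<close> to the expansion
  of the triple product.

  As to the scalar component \<open>f\<close>, the product rule expresses \<open>f (u \<times> v)\<close> through \<open>h (D u) v\<close> and
  \<open>h u (D v)\<close>.  For the colour algebra the expression is symmetric in \<open>u\<close> and \<open>v\<close> while the cross product
  is alternating, so \<open>2 f = 0\<close> on cross products.  For the octonion algebra exchanging \<open>u\<close> and \<open>v\<close>
  conjugates the expression, so \<open>f\<close> has trace zero; as \<open>f\<close> is also \<open>S\<close>-linear, nondegeneracy of the trace
  form gives \<open>f = 0\<close>.

  About \<open>S\<close> itself one needs that the trace is linear and nondegenerate, that \<open>R\<close> embeds into \<open>S\<close> (the
  rank is positive at every prime), and that no nonzero element of \<open>R\<close> kills all elements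
  \<open>2 a - tr a\<close>.  That the canonical involution is an automorphism of order two comes for free from
  the hermitian form: the rules for \<open>h (a u) v\<close>, \<open>h u (a v)\<close> and the hermitian symmetry force it on
  the values of \<open>h\<close>, which span \<open>S\<close>.
\<close>

section \<open>Prime ideals, localization and faithfulness\<close>

text \<open>Krull's theorem, by Zorn's lemma on the proper ideals that contain \<open>I\<close>.\<close>

lemma (in cring) prime_ideal_above:
  assumes I: "ideal I R" and proper: "\<one> \<notin> I"
  obtains p where "primeideal p R" and "I \<subseteq> p"
proof -
  let ?A = "{J. ideal J R \<and> I \<subseteq> J \<and> \<one> \<notin> J}"
  have "\<exists>M\<in>?A. \<forall>X\<in>?A. M \<subseteq> X \<longrightarrow> X = M"
  proof (rule subset_Zorn_nonempty)
    show "?A \<noteq> {}" using I proper by blast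
  next
    fix C assume ne: "C \<noteq> {}" and C: "subset.chain ?A C"
    have sub: "C \<subseteq> ?A" and tot: "\<And>X Y. X \<in> C \<Longrightarrow> Y \<in> C \<Longrightarrow> X \<subseteq> Y \<or> Y \<subseteq> X"
      using C unfolding subset.chain_def by auto
    have id: "ideal X R" if "X \<in> C" for X using sub that by blast
    have "ideal (\<Union>C) R"
    proof (rule idealI)
      show "ring R" by (rule ring_axioms)
      show "subgroup (\<Union>C) (add_monoid R)"
      proof (rule add.subgroupI)
        show "\<Union>C \<subseteq> carrier R" using id ideal.Icarr by fast
        obtain X where "X \<in> C" using ne by blast
        then show "\<Union>C \<noteq> {}"
          using additive_subgroup.zero_closed[OF ideal.axioms(1)[OF id]] by fast
      next
        fix a assume "a \<in> \<Union>C"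
        then obtain X where X: "X \<in> C" "a \<in> X" by blast
        show "\<ominus> a \<in> \<Union>C"
          using additive_subgroup.a_inv_closed[OF ideal.axioms(1)[OF id] X(2)] X(1) by auto
      next
        fix a b assume "a \<in> \<Union>C" "b \<in> \<Union>C"
        then obtain X Y where X: "X \<in> C" "a \<in> X" and Y: "Y \<in> C" "b \<in> Y" by blast
        then obtain Z where Z: "Z \<in> C" "a \<in> Z" "b \<in> Z" using tot[OF X(1) Y(1)] by blast
        show "a \<oplus> b \<in> \<Union>C"
          using additive_subgroup.a_closed[OF ideal.axioms(1)[OF id] Z(2,3)] Z(1) by auto
      qed
    next
      fix a x assume "a \<in> \<Union>C" and x: "x \<in> carrier R"
      then obtain X where X: "X \<in> C" "a \<in> X" by blast
      show "x \<otimes> a \<in> \<Union>C" using ideal.I_l_closed[OF id X(2) x] X(1) by auto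
      show "a \<otimes> x \<in> \<Union>C" using ideal.I_r_closed[OF id X(2) x] X(1) by auto
    qed
    then show "\<Union>C \<in> ?A" using ne sub by blast
  qed
  then obtain M where M: "ideal M R" "I \<subseteq> M" "\<one> \<notin> M"
    and max: "\<And>X. ideal X R \<Longrightarrow> M \<subseteq> X \<Longrightarrow> \<one> \<notin> X \<Longrightarrow> X = M"
    by (metis (mono_tags, lifting) mem_Collect_eq order_trans)
  have "maximalideal M R"
  proof (rule maximalidealI)
    show "ideal M R" by (fact M(1))
    show "carrier R \<noteq> M" using M(3) by blast
  next
    fix J assume "ideal J R" "M \<subseteq> J" "J \<subseteq> carrier R"
    then show "J = M \<or> J = carrier R" using max ideal.one_imp_carrier by blast
  qed
  then show thesis using maximalideal_prime M(2) that by blast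
qed

lemma module_regular:
  assumes "cring R" shows "module R (regular_module R)"
proof -
  interpret cring R by fact
  have "abelian_group (regular_module R)"
    by (rule abelian_groupI) (auto simp: regular_module_def a_ac intro: add.l_inv_ex)
  then show ?thesis
    by (intro moduleI) (auto simp: regular_module_def l_distr r_distr m_assoc cring_axioms)
qed

lemma (in primeideal) complement_one: "\<one> \<in> carrier R - I"
  using I_notcarr one_imp_carrier by blast

lemma (in primeideal) complement_mult:
  "s \<in> carrier R - I \<Longrightarrow> t \<in> carrier R - I \<Longrightarrow> s \<otimes> t \<in> carrier R - I"
  using I_prime by auto

lemma (in module) fraction_subset:
  assumes p: "primeideal p R"
    and x: "x \<in> carrier M" and s: "s \<in> carrier R - p"
    and yt: "(y, t) \<in> fraction R M p x s"
  shows "fraction R M p y t \<subseteq> fraction R M p x s"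
proof
  interpret p: primeideal p R by fact
  obtain u where y: "y \<in> carrier M" and t: "t \<in> carrier R - p" and u: "u \<in> carrier R - p"
    and eq: "u \<odot>\<^bsub>M\<^esub> (t \<odot>\<^bsub>M\<^esub> x) = u \<odot>\<^bsub>M\<^esub> (s \<odot>\<^bsub>M\<^esub> y)"
    using yt unfolding fraction_def by auto
  have c: "u \<in> carrier R" "s \<in> carrier R" "t \<in> carrier R" using s t u by auto
  have eq': "(w \<otimes> (u \<otimes> t)) \<odot>\<^bsub>M\<^esub> x = (w \<otimes> (u \<otimes> s)) \<odot>\<^bsub>M\<^esub> y" if "w \<in> carrier R" for w
    using eq that c x y by (simp add: smult_assoc1)
  fix zr assume "zr \<in> fraction R M p y t"
  then obtain z r v where zr: "zr = (z, r)" and z: "z \<in> carrier M" and r: "r \<in> carrier R - p"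
    and v: "v \<in> carrier R - p" and e: "v \<odot>\<^bsub>M\<^esub> (r \<odot>\<^bsub>M\<^esub> y) = v \<odot>\<^bsub>M\<^esub> (t \<odot>\<^bsub>M\<^esub> z)"
    unfolding fraction_def by auto
  have c': "r \<in> carrier R" "v \<in> carrier R" using r v by auto
  have e': "(w \<otimes> (v \<otimes> r)) \<odot>\<^bsub>M\<^esub> y = (w \<otimes> (v \<otimes> t)) \<odot>\<^bsub>M\<^esub> z" if "w \<in> carrier R" for w
    using e that c c' z y by (simp add: smult_assoc1)
  let ?w = "u \<otimes> v \<otimes> t"
  have "?w \<odot>\<^bsub>M\<^esub> (r \<odot>\<^bsub>M\<^esub> x) = (v \<otimes> r \<otimes> (u \<otimes> t)) \<odot>\<^bsub>M\<^esub> x"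
    using c c' x by (simp add: smult_assoc1[symmetric] m_ac)
  also have "\<dots> = (v \<otimes> r \<otimes> (u \<otimes> s)) \<odot>\<^bsub>M\<^esub> y"
    using eq' c c' by simp
  also have "\<dots> = (u \<otimes> s \<otimes> (v \<otimes> r)) \<odot>\<^bsub>M\<^esub> y"
    using c c' by (simp add: m_ac)
  also have "\<dots> = (u \<otimes> s \<otimes> (v \<otimes> t)) \<odot>\<^bsub>M\<^esub> z"
    using e' c c' by simp
  also have "\<dots> = ?w \<odot>\<^bsub>M\<^esub> (s \<odot>\<^bsub>M\<^esub> z)"
    using c c' z by (simp add: smult_assoc1[symmetric] m_ac)
  finally show "zr \<in> fraction R M p x s"
    unfolding fraction_def zr using z r u v t p.complement_mult by auto
qed

lemma (in module) fraction_eqI: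
  assumes p: "primeideal p R"
    and x: "x \<in> carrier M" and s: "s \<in> carrier R - p"
    and yt: "(y, t) \<in> fraction R M p x s"
  shows "fraction R M p y t = fraction R M p x s"
proof
  show "fraction R M p y t \<subseteq> fraction R M p x s" by (rule fraction_subset[OF assms])
  obtain u where u: "y \<in> carrier M" "t \<in> carrier R - p" "u \<in> carrier R - p"
    "u \<odot>\<^bsub>M\<^esub> (t \<odot>\<^bsub>M\<^esub> x) = u \<odot>\<^bsub>M\<^esub> (s \<odot>\<^bsub>M\<^esub> y)"
    using yt unfolding fraction_def by auto
  then have "(x, s) \<in> fraction R M p y t"
    using x s unfolding fraction_def by (auto intro!: bexI[of _ u])
  with u(1,2) show "fraction R M p x s \<subseteq> fraction R M p y t" by (rule fraction_subset[OF p])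
qed

lemma (in module) fraction_refl:
  assumes "primeideal p R" "x \<in> carrier M" "s \<in> carrier R - p"
  shows "(x, s) \<in> fraction R M p x s"
  using assms primeideal.complement_one[OF assms(1)] unfolding fraction_def by auto

text \<open>All representatives of the two fractions contribute the same class to the union that defines the product.\<close>

lemma (in module) localized_smult:
  assumes p: "primeideal p R"
    and a: "a \<in> carrier R" and s: "s \<in> carrier R - p"
    and x: "x \<in> carrier M" and t: "t \<in> carrier R - p"
  shows "smult (localized_module R M p)
           (fraction R (regular_module R) p a s) (fraction R M p x t)
         = fraction R M p (a \<odot>\<^bsub>M\<^esub> x) (s \<otimes> t)"
proof -
  interpret p: primeideal p R by fact
  interpret reg: module R "regular_module R" by (rule module_regular) (rule R.cring_axioms)
  let ?A = "fraction R (regular_module R) p a s" and ?X = "fraction R M p x t"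
  have eq: "fraction R M p (b \<odot>\<^bsub>M\<^esub> y) (s' \<otimes> t') = fraction R M p (a \<odot>\<^bsub>M\<^esub> x) (s \<otimes> t)"
    if bs: "(b, s') \<in> ?A" and yt: "(y, t') \<in> ?X" for b s' y t'
  proof (rule fraction_eqI[OF p])
    obtain u where b: "b \<in> carrier R" and s': "s' \<in> carrier R - p" and u: "u \<in> carrier R - p"
      and e1: "u \<otimes> (s' \<otimes> a) = u \<otimes> (s \<otimes> b)"
      using bs unfolding fraction_def regular_module_def by auto
    obtain v where y: "y \<in> carrier M" and t': "t' \<in> carrier R - p" and v: "v \<in> carrier R - p"
      and e2: "v \<odot>\<^bsub>M\<^esub> (t' \<odot>\<^bsub>M\<^esub> x) = v \<odot>\<^bsub>M\<^esub> (t \<odot>\<^bsub>M\<^esub> y)"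
      using yt unfolding fraction_def by auto
    have c: "u \<in> carrier R" "v \<in> carrier R" "s' \<in> carrier R" "t' \<in> carrier R"
      "s \<in> carrier R" "t \<in> carrier R" using u v s' t' s t by auto
    have "(u \<otimes> v) \<odot>\<^bsub>M\<^esub> ((s' \<otimes> t') \<odot>\<^bsub>M\<^esub> (a \<odot>\<^bsub>M\<^esub> x)) = (u \<otimes> (s' \<otimes> a)) \<odot>\<^bsub>M\<^esub> (v \<odot>\<^bsub>M\<^esub> (t' \<odot>\<^bsub>M\<^esub> x))"
      using c a x by (simp add: smult_assoc1[symmetric] m_ac)
    also have "\<dots> = (u \<otimes> (s \<otimes> b)) \<odot>\<^bsub>M\<^esub> (v \<odot>\<^bsub>M\<^esub> (t \<odot>\<^bsub>M\<^esub> y))"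
      by (simp only: e1 e2)
    also have "\<dots> = (u \<otimes> v) \<odot>\<^bsub>M\<^esub> ((s \<otimes> t) \<odot>\<^bsub>M\<^esub> (b \<odot>\<^bsub>M\<^esub> y))"
      using c b y by (simp add: smult_assoc1[symmetric] m_ac)
    finally show "(b \<odot>\<^bsub>M\<^esub> y, s' \<otimes> t') \<in> fraction R M p (a \<odot>\<^bsub>M\<^esub> x) (s \<otimes> t)"
      unfolding fraction_def
      using b y s' t' u v p.complement_mult by auto
  qed (use a x s t p.complement_mult in auto)
  have ne: "(a, s) \<in> ?A" "(x, t) \<in> ?X"
    using fraction_refl[OF p x t] reg.fraction_refl[OF p _ s] a by (auto simp: regular_module_def)
  have "smult (localized_module R M p) ?A ?X
      = (\<Union>z\<in>?A \<times> ?X. fraction R M p (fst (fst z) \<odot>\<^bsub>M\<^esub> fst (snd z)) (snd (fst z) \<otimes> snd (snd z)))"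
    unfolding localized_module_def by (force simp: split_beta)
  also have "\<dots> = (\<Union>z\<in>?A \<times> ?X. fraction R M p (a \<odot>\<^bsub>M\<^esub> x) (s \<otimes> t))"
    by (intro SUP_cong refl) (use eq in auto)
  also have "\<dots> = fraction R M p (a \<odot>\<^bsub>M\<^esub> x) (s \<otimes> t)" using ne by auto
  finally show ?thesis .
qed

text \<open>If \<open>r \<noteq> 0\<close>, its annihilator lies in a prime \<open>p\<close>, and \<open>r/1\<close> is then nonzero in the localization
  at \<open>p\<close> although it kills the localized module.  Adding it to one coordinate of a vector would give
  a second expansion of the same vector in the basis at \<open>p\<close>.\<close>

lemma (in module) faithful_of_constant_rank:
  assumes rank: "has_constant_rank R M n" and n: "0 < n"
    and r: "r \<in> carrier R" and ann: "\<And>x. x \<in> carrier M \<Longrightarrow> r \<odot>\<^bsub>M\<^esub> x = \<zero>\<^bsub>M\<^esub>"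
  shows "r = \<zero>"
proof (rule ccontr)
  assume "r \<noteq> \<zero>"
  let ?I = "{a \<in> carrier R. a \<otimes> r = \<zero>}"
  have "ideal ?I R"
  proof (rule idealI)
    show "subgroup ?I (add_monoid R)"
      by (rule subgroup.intro) (use r in \<open>auto simp: l_distr l_minus a_inv_def[symmetric]\<close>)
  next
    fix a x assume "a \<in> ?I" "x \<in> carrier R"
    then show "x \<otimes> a \<in> ?I" "a \<otimes> x \<in> ?I"
      using r by (simp_all add: m_assoc m_lcomm[of a x r])
  qed (rule ring_axioms)
  moreover have "\<one> \<notin> ?I" using \<open>r \<noteq> \<zero>\<close> r by simp
  ultimately obtain p where p: "primeideal p R" and Ip: "?I \<subseteq> p" by (rule prime_ideal_above)
  interpret p: primeideal p R by fact
  interpret reg: module R "regular_module R" by (rule module_regular) (rule R.cring_axioms)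
  let ?L = "localized_module R M p" and ?Q = "localized_ring R p"
  let ?fr = "fraction R (regular_module R) p"
  obtain b where b: "b \<in> {..<n} \<rightarrow> carrier ?L"
    and uniq: "\<And>x. x \<in> carrier ?L \<Longrightarrow> \<exists>!c. c \<in> {..<n} \<rightarrow>\<^sub>E carrier ?Q \<and>
         x = (\<Oplus>\<^bsub>?L\<^esub>i\<in>{..<n}. c i \<odot>\<^bsub>?L\<^esub> b i)"
    using rank p unfolding has_constant_rank_def free_of_rank_def by meson
  have "\<zero>\<^bsub>?L\<^esub> \<in> carrier ?L"
    using p.complement_one unfolding localized_module_def by auto
  from uniq[OF this] obtain c
    where "c \<in> {..<n} \<rightarrow>\<^sub>E carrier ?Q \<and> \<zero>\<^bsub>?L\<^esub> = (\<Oplus>\<^bsub>?L\<^esub>i\<in>{..<n}. c i \<odot>\<^bsub>?L\<^esub> b i)"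
      and "\<forall>d. d \<in> {..<n} \<rightarrow>\<^sub>E carrier ?Q \<and> \<zero>\<^bsub>?L\<^esub> = (\<Oplus>\<^bsub>?L\<^esub>i\<in>{..<n}. d i \<odot>\<^bsub>?L\<^esub> b i) \<longrightarrow> d = c"
    by (elim ex1E) blast
  then have c: "c \<in> {..<n} \<rightarrow>\<^sub>E carrier ?Q"
    and z: "\<zero>\<^bsub>?L\<^esub> = (\<Oplus>\<^bsub>?L\<^esub>i\<in>{..<n}. c i \<odot>\<^bsub>?L\<^esub> b i)"
    and only: "\<And>d. d \<in> {..<n} \<rightarrow>\<^sub>E carrier ?Q \<Longrightarrow>
         \<zero>\<^bsub>?L\<^esub> = (\<Oplus>\<^bsub>?L\<^esub>i\<in>{..<n}. d i \<odot>\<^bsub>?L\<^esub> b i) \<Longrightarrow> d = c" by blast+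
  have carQ: "carrier ?Q = {?fr a s | a s. a \<in> carrier R \<and> s \<in> carrier R - p}"
    unfolding localized_ring_def localized_module_def Let_def by (simp add: regular_module_def)
  have "c 0 \<in> carrier ?Q" using c n by (auto simp: PiE_iff)
  then obtain a s where c0: "c 0 = ?fr a s" and a: "a \<in> carrier R" and s: "s \<in> carrier R - p"
    unfolding carQ by blast
  have "b 0 \<in> carrier ?L" using b n by auto
  then obtain x t where b0: "b 0 = fraction R M p x t" and x: "x \<in> carrier M"
    and t: "t \<in> carrier R - p"
    unfolding localized_module_def by auto
  have sc: "s \<in> carrier R" using s by simp
  have c2: "a \<oplus> s \<otimes> r \<in> carrier R" using a sc r by simp
  \<comment> \<open>\<open>(a + s r)/s\<close> is \<open>a/s + r/1\<close>, written over the denominator of the first coordinate.\<close>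
  have "?fr (a \<oplus> s \<otimes> r) s \<odot>\<^bsub>?L\<^esub> b 0 = c 0 \<odot>\<^bsub>?L\<^esub> b 0"
    using localized_smult[OF p c2 s x t] localized_smult[OF p a s x t] ann x a sc r
    by (simp add: b0 c0 smult_l_distr smult_assoc1)
  then have "(\<lambda>i. (c(0 := ?fr (a \<oplus> s \<otimes> r) s)) i \<odot>\<^bsub>?L\<^esub> b i) = (\<lambda>i. c i \<odot>\<^bsub>?L\<^esub> b i)"
    by (auto simp: fun_eq_iff)
  then have "c(0 := ?fr (a \<oplus> s \<otimes> r) s) = c"
    using z c n carQ c2 s by (intro only) (auto simp: PiE_iff extensional_def)
  then have "?fr (a \<oplus> s \<otimes> r) s = ?fr a s" using c0 by (metis fun_upd_same)
  then have "(a \<oplus> s \<otimes> r, s) \<in> ?fr a s"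
    using reg.fraction_refl[OF p _ s, of "a \<oplus> s \<otimes> r"] c2 by (simp add: regular_module_def)
  then obtain u where u: "u \<in> carrier R - p" and eq: "u \<otimes> (s \<otimes> a) = u \<otimes> (s \<otimes> (a \<oplus> s \<otimes> r))"
    unfolding fraction_def regular_module_def by auto
  have uc: "u \<in> carrier R" using u by simp
  have "u \<otimes> (s \<otimes> a) \<oplus> u \<otimes> s \<otimes> s \<otimes> r = u \<otimes> (s \<otimes> a)"
    using eq a sc r uc by (simp add: r_distr m_assoc)
  then have "u \<otimes> s \<otimes> s \<otimes> r = \<zero>"
    using a sc r uc by (simp add: add.r_cancel_one)
  then have "u \<otimes> s \<otimes> s \<in> p" using Ip uc sc by auto
  then show False using u s p.complement_mult by (meson DiffD2)
qed

section \<open>Traces\<close>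

lemma linear_map_finsum:
  assumes "module R M" "module R N" and f: "linear_map R M N f"
    and "finite A" "g \<in> A \<rightarrow> carrier M"
  shows "f (\<Oplus>\<^bsub>M\<^esub>i\<in>A. g i) = (\<Oplus>\<^bsub>N\<^esub>i\<in>A. f (g i))"
proof -
  interpret M: module R M by fact
  interpret N: module R N by fact
  have f0: "f \<zero>\<^bsub>M\<^esub> = \<zero>\<^bsub>N\<^esub>"
  proof -
    have R0: "\<zero>\<^bsub>R\<^esub> \<in> carrier R" by simp
    have "f (\<zero>\<^bsub>R\<^esub> \<odot>\<^bsub>M\<^esub> \<zero>\<^bsub>M\<^esub>) = \<zero>\<^bsub>R\<^esub> \<odot>\<^bsub>N\<^esub> f \<zero>\<^bsub>M\<^esub>" and "f \<zero>\<^bsub>M\<^esub> \<in> carrier N"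
      using f M.zero_closed R0 unfolding linear_map_def by blast+
    then show ?thesis using R0 by simp
  qed
  from assms(4,5) show ?thesis
  proof (induction A)
    case empty then show ?case by (simp add: f0)
  next
    case (insert x A)
    then have "g \<in> A \<rightarrow> carrier M" "g x \<in> carrier M" by auto
    moreover have "(\<lambda>i. f (g i)) \<in> A \<rightarrow> carrier N" "f (g x) \<in> carrier N"
      using f insert.prems unfolding linear_map_def by auto
    ultimately show ?case
      using insert f unfolding linear_map_def by simp
  qed
qed

lemma (in abelian_monoid) finsum_swap:
  assumes "finite A" "finite B" "\<And>i j. i \<in> A \<Longrightarrow> j \<in> B \<Longrightarrow> f i j \<in> carrier G"
  shows "(\<Oplus>i\<in>A. \<Oplus>j\<in>B. f i j) = (\<Oplus>j\<in>B. \<Oplus>i\<in>A. f i j)"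
  using assms(1,3)
proof (induction A)
  case empty then show ?case by simp
next
  case (insert x A)
  then have "(\<Oplus>j\<in>B. \<Oplus>i\<in>insert x A. f i j) = (\<Oplus>j\<in>B. f x j \<oplus> (\<Oplus>i\<in>A. f i j))"
    by (intro finsum_cong') auto
  also have "\<dots> = (\<Oplus>j\<in>B. f x j) \<oplus> (\<Oplus>j\<in>B. \<Oplus>i\<in>A. f i j)"
    using insert.prems by (intro finsum_addf) auto
  finally show ?case using insert by (simp add: Pi_def)
qed

lemma finsum_regular [simp]: "finsum (regular_module R) g A = finsum R g A"
  unfolding finsum_def finprod_def foldD_def by (simp add: regular_module_def)

text \<open>Independence of the dual basis: expanding \<open>x i\<close> in the \<open>y j\<close>, or \<open>f (y j)\<close> in the \<open>x i\<close>, turns either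
  trace into the double sum of \<open>\<psi> j (x i) \<phi> i (f (y j))\<close>.\<close>

lemma (in module) module_trace_eq:
  assumes db: "dual_basis R M n x \<phi>" and f: "linear_map R M M f"
  shows "module_trace R M f = (\<Oplus>i\<in>{..<n}. \<phi> i (f (x i)))"
proof -
  have regm: "module R (regular_module R)" by (rule module_regular) (rule R.cring_axioms)
  have self: "module R M" by (rule module_axioms)
  have trace_le: "(\<Oplus>i\<in>{..<n}. \<phi> i (f (x i))) = (\<Oplus>j\<in>{..<m}. \<psi> j (f (y j)))"
    if db1: "dual_basis R M n x \<phi>" and db2: "dual_basis R M m y \<psi>" for n x \<phi> m y \<psi>
  proof -
    have x: "\<And>i. i < n \<Longrightarrow> x i \<in> carrier M" and y: "\<And>i. i < m \<Longrightarrow> y i \<in> carrier M"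
      and l\<phi>: "\<And>i. i < n \<Longrightarrow> linear_map R M (regular_module R) (\<phi> i)"
      and l\<psi>: "\<And>i. i < m \<Longrightarrow> linear_map R M (regular_module R) (\<psi> i)"
      and ex: "\<And>z. z \<in> carrier M \<Longrightarrow> z = (\<Oplus>\<^bsub>M\<^esub>i\<in>{..<n}. \<phi> i z \<odot>\<^bsub>M\<^esub> x i)"
      and ey: "\<And>z. z \<in> carrier M \<Longrightarrow> z = (\<Oplus>\<^bsub>M\<^esub>i\<in>{..<m}. \<psi> i z \<odot>\<^bsub>M\<^esub> y i)"
      using db1 db2 unfolding dual_basis_def by auto
    have fc: "\<And>z. z \<in> carrier M \<Longrightarrow> f z \<in> carrier M"
      and fs: "\<And>a z. a \<in> carrier R \<Longrightarrow> z \<in> carrier M \<Longrightarrow> f (a \<odot>\<^bsub>M\<^esub> z) = a \<odot>\<^bsub>M\<^esub> f z"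
      using f unfolding linear_map_def by auto
    have \<phi>c: "\<And>i z. i < n \<Longrightarrow> z \<in> carrier M \<Longrightarrow> \<phi> i z \<in> carrier R"
      and \<phi>s: "\<And>i a z. i < n \<Longrightarrow> a \<in> carrier R \<Longrightarrow> z \<in> carrier M \<Longrightarrow> \<phi> i (a \<odot>\<^bsub>M\<^esub> z) = a \<otimes> \<phi> i z"
      using l\<phi> unfolding linear_map_def by (simp_all add: regular_module_def Pi_iff)
    have \<psi>c: "\<And>i z. i < m \<Longrightarrow> z \<in> carrier M \<Longrightarrow> \<psi> i z \<in> carrier R"
      and \<psi>s: "\<And>i a z. i < m \<Longrightarrow> a \<in> carrier R \<Longrightarrow> z \<in> carrier M \<Longrightarrow> \<psi> i (a \<odot>\<^bsub>M\<^esub> z) = a \<otimes> \<psi> i z"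
      using l\<psi> unfolding linear_map_def by (simp_all add: regular_module_def Pi_iff)
    have left: "\<phi> i (f (x i)) = (\<Oplus>j\<in>{..<m}. \<psi> j (x i) \<otimes> \<phi> i (f (y j)))" if i: "i < n" for i
    proof -
      have "f (x i) = f (\<Oplus>\<^bsub>M\<^esub>j\<in>{..<m}. \<psi> j (x i) \<odot>\<^bsub>M\<^esub> y j)" using ey[OF x[OF i]] by simp
      also have "\<dots> = (\<Oplus>\<^bsub>M\<^esub>j\<in>{..<m}. f (\<psi> j (x i) \<odot>\<^bsub>M\<^esub> y j))"
        using x[OF i] y \<psi>c by (intro linear_map_finsum[OF self self f]) auto
      also have "\<dots> = (\<Oplus>\<^bsub>M\<^esub>j\<in>{..<m}. \<psi> j (x i) \<odot>\<^bsub>M\<^esub> f (y j))"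
        using x[OF i] y \<psi>c fc fs by (intro M.finsum_cong') auto
      finally have "\<phi> i (f (x i)) = \<phi> i (\<Oplus>\<^bsub>M\<^esub>j\<in>{..<m}. \<psi> j (x i) \<odot>\<^bsub>M\<^esub> f (y j))" by simp
      also have "\<dots> = (\<Oplus>j\<in>{..<m}. \<phi> i (\<psi> j (x i) \<odot>\<^bsub>M\<^esub> f (y j)))"
        using linear_map_finsum[OF self regm l\<phi>[OF i], of "{..<m}" "\<lambda>j. \<psi> j (x i) \<odot>\<^bsub>M\<^esub> f (y j)"]
          x[OF i] y \<psi>c fc by auto
      also have "\<dots> = (\<Oplus>j\<in>{..<m}. \<psi> j (x i) \<otimes> \<phi> i (f (y j)))"
        using x[OF i] y \<psi>c fc \<phi>s \<phi>c i by (intro R.finsum_cong') auto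
      finally show ?thesis .
    qed
    have right: "\<psi> j (f (y j)) = (\<Oplus>i\<in>{..<n}. \<psi> j (x i) \<otimes> \<phi> i (f (y j)))" if j: "j < m" for j
    proof -
      have fy: "f (y j) \<in> carrier M" using fc y j by simp
      have "\<psi> j (f (y j)) = \<psi> j (\<Oplus>\<^bsub>M\<^esub>i\<in>{..<n}. \<phi> i (f (y j)) \<odot>\<^bsub>M\<^esub> x i)" using ex[OF fy] by simp
      also have "\<dots> = (\<Oplus>i\<in>{..<n}. \<psi> j (\<phi> i (f (y j)) \<odot>\<^bsub>M\<^esub> x i))"
        using linear_map_finsum[OF self regm l\<psi>[OF j], of "{..<n}" "\<lambda>i. \<phi> i (f (y j)) \<odot>\<^bsub>M\<^esub> x i"]
          x \<phi>c fy by auto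
      also have "\<dots> = (\<Oplus>i\<in>{..<n}. \<psi> j (x i) \<otimes> \<phi> i (f (y j)))"
        using x \<psi>c \<psi>s \<phi>c j fy by (intro R.finsum_cong') (auto simp: m_comm)
      finally show ?thesis .
    qed
    have "(\<Oplus>i\<in>{..<n}. \<phi> i (f (x i))) = (\<Oplus>i\<in>{..<n}. \<Oplus>j\<in>{..<m}. \<psi> j (x i) \<otimes> \<phi> i (f (y j)))"
      using left \<psi>c \<phi>c x y fc by (intro R.finsum_cong') auto
    also have "\<dots> = (\<Oplus>j\<in>{..<m}. \<Oplus>i\<in>{..<n}. \<psi> j (x i) \<otimes> \<phi> i (f (y j)))"
      using \<psi>c \<phi>c x y fc by (intro R.finsum_swap) auto
    also have "\<dots> = (\<Oplus>j\<in>{..<m}. \<psi> j (f (y j)))"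
      using right \<psi>c \<phi>c x y fc by (intro R.finsum_cong') auto
    finally show ?thesis .
  qed
  show ?thesis
    unfolding module_trace_def
  proof (rule the_equality)
    show "\<exists>n' x' \<phi>'. dual_basis R M n' x' \<phi>' \<and>
        (\<Oplus>i\<in>{..<n}. \<phi> i (f (x i))) = (\<Oplus>i\<in>{..<n'}. \<phi>' i (f (x' i)))"
      using db by blast
  next
    fix t assume "\<exists>n' x' \<phi>'. dual_basis R M n' x' \<phi>' \<and> t = (\<Oplus>i\<in>{..<n'}. \<phi>' i (f (x' i)))"
    then show "t = (\<Oplus>i\<in>{..<n}. \<phi> i (f (x i)))" using trace_le[OF _ db] by blast
  qed
qed

section \<open>Quadratic algebras with a nondegenerate trace\<close>

lemmas (in cring) ring_normalize = minus_eq l_distr r_distr l_minus r_minus minus_add a_ac m_ac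

lemma (in abelian_group) eq_if_minus_zero:
  assumes "x \<in> carrier G" "y \<in> carrier G" "x \<ominus> y = \<zero>"
  shows "x = y"
proof -
  have "x = (x \<ominus> y) \<oplus> y" using assms(1,2) by (simp add: minus_eq a_assoc l_neg)
  then show ?thesis using assms by simp
qed

lemma (in module) double_eq_zero:
  assumes two: "\<one> \<oplus> \<one> \<in> Units R" and x: "x \<in> carrier M" and "x \<oplus>\<^bsub>M\<^esub> x = \<zero>\<^bsub>M\<^esub>"
  shows "x = \<zero>\<^bsub>M\<^esub>"
proof -
  have "x = (inv (\<one> \<oplus> \<one>) \<otimes> (\<one> \<oplus> \<one>)) \<odot>\<^bsub>M\<^esub> x" using two x by simp
  also have "\<dots> = inv (\<one> \<oplus> \<one>) \<odot>\<^bsub>M\<^esub> (x \<oplus>\<^bsub>M\<^esub> x)"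
    using two x by (subst smult_assoc1) (simp_all add: smult_l_distr)
  finally show ?thesis using assms by simp
qed

text \<open>What is used of a quadratic etale algebra.  As \<open>2 a - tr a = a - cnj a\<close>, the axiom
  \<open>skew_faithful\<close> says that the elements with \<open>cnj x = -x\<close> are jointly faithful over \<open>R\<close>.\<close>

locale quadratic_trace_algebra = R: cring R + S: cring S + module R S
  for R :: "('r, 'c) ring_scheme" and S :: "('r, 's, 'd) module_scheme" (structure) +
  fixes tr :: "'s \<Rightarrow> 'r" and cnj :: "'s \<Rightarrow> 's"
  assumes smult_assoc2: "r \<in> carrier R \<Longrightarrow> a \<in> carrier S \<Longrightarrow> b \<in> carrier S \<Longrightarrow>
      (r \<odot>\<^bsub>S\<^esub> a) \<otimes> b = r \<odot>\<^bsub>S\<^esub> (a \<otimes> b)"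
    and two_unit: "\<one>\<^bsub>R\<^esub> \<oplus>\<^bsub>R\<^esub> \<one>\<^bsub>R\<^esub> \<in> Units R"
    and tr_closed [simp]: "a \<in> carrier S \<Longrightarrow> tr a \<in> carrier R"
    and tr_add: "a \<in> carrier S \<Longrightarrow> b \<in> carrier S \<Longrightarrow> tr (a \<oplus> b) = tr a \<oplus>\<^bsub>R\<^esub> tr b"
    and tr_smult: "r \<in> carrier R \<Longrightarrow> a \<in> carrier S \<Longrightarrow> tr (r \<odot>\<^bsub>S\<^esub> a) = r \<otimes>\<^bsub>R\<^esub> tr a"
    and cnj_closed [simp]: "a \<in> carrier S \<Longrightarrow> cnj a \<in> carrier S"
    and add_cnj: "a \<in> carrier S \<Longrightarrow> a \<oplus> cnj a = tr a \<odot>\<^bsub>S\<^esub> \<one>"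
    and cnj_add: "a \<in> carrier S \<Longrightarrow> b \<in> carrier S \<Longrightarrow> cnj (a \<oplus> b) = cnj a \<oplus> cnj b"
    and cnj_mult: "a \<in> carrier S \<Longrightarrow> b \<in> carrier S \<Longrightarrow> cnj (a \<otimes> b) = cnj a \<otimes> cnj b"
    and cnj_cnj [simp]: "a \<in> carrier S \<Longrightarrow> cnj (cnj a) = a"
    and base_faithful: "r \<in> carrier R \<Longrightarrow> r \<odot>\<^bsub>S\<^esub> \<one> = \<zero> \<Longrightarrow> r = \<zero>\<^bsub>R\<^esub>"
    and trace_nondegenerate:
      "a \<in> carrier S \<Longrightarrow> (\<And>b. b \<in> carrier S \<Longrightarrow> tr (a \<otimes> b) = \<zero>\<^bsub>R\<^esub>) \<Longrightarrow> a = \<zero>"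
    and skew_faithful:
      "r \<in> carrier R \<Longrightarrow>
       (\<And>a. a \<in> carrier S \<Longrightarrow> r \<odot>\<^bsub>S\<^esub> (a \<oplus> a) = (r \<otimes>\<^bsub>R\<^esub> tr a) \<odot>\<^bsub>S\<^esub> \<one>) \<Longrightarrow> r = \<zero>\<^bsub>R\<^esub>"
begin

lemma double_S: "x \<in> carrier S \<Longrightarrow> x \<oplus> x = \<zero> \<Longrightarrow> x = \<zero>"
  by (rule double_eq_zero[OF two_unit])

lemma double_R: "x \<in> carrier R \<Longrightarrow> x \<oplus>\<^bsub>R\<^esub> x = \<zero>\<^bsub>R\<^esub> \<Longrightarrow> x = \<zero>\<^bsub>R\<^esub>"
  using module.double_eq_zero[OF module_regular[OF R.cring_axioms] two_unit, of x]
  by (simp add: regular_module_def)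

lemma tr_zero [simp]: "tr \<zero> = \<zero>\<^bsub>R\<^esub>"
  using tr_smult[of "\<zero>\<^bsub>R\<^esub>" "\<zero>"] by simp

lemma cnj_zero [simp]: "cnj \<zero> = \<zero>"
  using cnj_add[of "\<zero>" "\<zero>"] by (simp add: S.add.l_cancel_one')

lemma cnj_minus: "a \<in> carrier S \<Longrightarrow> cnj (\<ominus> a) = \<ominus> cnj a"
  by (rule S.minus_equality[symmetric]) (simp_all add: cnj_add[symmetric] S.l_neg)

lemma base_smult_eq: "r \<in> carrier R \<Longrightarrow> a \<in> carrier S \<Longrightarrow> (r \<odot>\<^bsub>S\<^esub> \<one>) \<otimes> a = r \<odot>\<^bsub>S\<^esub> a"
  by (simp add: smult_assoc2)

lemma tr_eq_zero_iff: "a \<in> carrier S \<Longrightarrow> tr a = \<zero>\<^bsub>R\<^esub> \<longleftrightarrow> cnj a = \<ominus> a"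
  by (metis S.minus_equality S.add.m_comm S.r_neg add_cnj base_faithful cnj_closed smult_l_null
      S.one_closed tr_closed)

lemma base_inj:
  assumes "r \<in> carrier R" "r' \<in> carrier R" "r \<odot>\<^bsub>S\<^esub> \<one> = r' \<odot>\<^bsub>S\<^esub> \<one>"
  shows "r = r'"
proof -
  have "(r \<ominus>\<^bsub>R\<^esub> r') \<odot>\<^bsub>S\<^esub> \<one> = \<zero>"
    using assms by (simp add: R.minus_eq smult_l_distr smult_l_minus S.r_neg)
  then have "r \<ominus>\<^bsub>R\<^esub> r' = \<zero>\<^bsub>R\<^esub>" using assms base_faithful by blast
  then show ?thesis using assms R.eq_if_minus_zero by blast
qed

lemma skew_part: "a \<in> carrier S \<Longrightarrow> cnj (a \<ominus> cnj a) = \<ominus> (a \<ominus> cnj a)"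
  by (simp add: S.minus_eq cnj_add cnj_minus S.minus_add S.a_comm)

lemma double_decompose:
  "a \<in> carrier S \<Longrightarrow> a \<oplus> a = tr a \<odot>\<^bsub>S\<^esub> \<one> \<oplus> (a \<ominus> cnj a)"
  by (simp add: add_cnj[symmetric] S.minus_eq S.a_ac S.r_neg2 S.r_neg1 S.r_neg)

text \<open>Both \<open>n\<close> and its conjugate are killed by the skew elements, hence so is \<open>tr n\<close>, and \<open>tr n = 0\<close>.
  Since \<open>2 a\<close> is the sum of \<open>tr a\<close> and a skew element, the trace of every \<open>n a\<close> vanishes too.\<close>

lemma skew_annihilator:
  assumes n: "n \<in> carrier S"
    and ann: "\<And>x. x \<in> carrier S \<Longrightarrow> cnj x = \<ominus> x \<Longrightarrow> x \<otimes> n = \<zero>"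
  shows "n = \<zero>"
proof -
  have conj0: "x \<otimes> cnj n = \<zero>" if x: "x \<in> carrier S" "cnj x = \<ominus> x" for x
  proof -
    have "cnj (x \<otimes> n) = \<zero>" using ann[OF x] by simp
    then have "\<ominus> (x \<otimes> cnj n) = \<zero>" using x n by (simp add: cnj_mult S.l_minus)
    then show ?thesis using x n S.minus_minus[of "x \<otimes> cnj n"] by simp
  qed
  have tr0: "tr n = \<zero>\<^bsub>R\<^esub>"
  proof (rule skew_faithful)
    fix a assume a: "a \<in> carrier S"
    have "tr n \<odot>\<^bsub>S\<^esub> (a \<ominus> cnj a) = (tr n \<odot>\<^bsub>S\<^esub> \<one>) \<otimes> (a \<ominus> cnj a)"
      using a n by (simp add: base_smult_eq)
    also have "\<dots> = (a \<ominus> cnj a) \<otimes> (n \<oplus> cnj n)"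
      using a n by (simp add: add_cnj S.m_comm)
    also have "\<dots> = \<zero>"
      using a n ann[OF _ skew_part[OF a]] conj0[OF _ skew_part[OF a]] by (simp add: S.r_distr)
    finally have 0: "tr n \<odot>\<^bsub>S\<^esub> (a \<ominus> cnj a) = \<zero>" .
    have "tr n \<odot>\<^bsub>S\<^esub> (a \<oplus> a) = tr n \<odot>\<^bsub>S\<^esub> (tr a \<odot>\<^bsub>S\<^esub> \<one>)"
      using a n 0 by (simp add: double_decompose smult_r_distr)
    then show "tr n \<odot>\<^bsub>S\<^esub> (a \<oplus> a) = (tr n \<otimes>\<^bsub>R\<^esub> tr a) \<odot>\<^bsub>S\<^esub> \<one>"
      using a n by (simp add: smult_assoc1)
  qed (use n in simp)
  show ?thesis
  proof (rule trace_nondegenerate[OF n])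
    fix a assume a: "a \<in> carrier S"
    have "n \<otimes> a \<oplus> n \<otimes> a = (a \<oplus> a) \<otimes> n"
      using a n by (simp add: S.l_distr S.m_comm[of n a])
    also have "\<dots> = tr a \<odot>\<^bsub>S\<^esub> n \<oplus> (a \<ominus> cnj a) \<otimes> n"
      using a n by (simp add: double_decompose S.l_distr base_smult_eq)
    also have "\<dots> = tr a \<odot>\<^bsub>S\<^esub> n"
      using a n ann[OF _ skew_part[OF a]] by simp
    finally have "tr (n \<otimes> a \<oplus> n \<otimes> a) = tr a \<otimes>\<^bsub>R\<^esub> tr n"
      using a n by (simp add: tr_smult)
    then have "tr (n \<otimes> a) \<oplus>\<^bsub>R\<^esub> tr (n \<otimes> a) = \<zero>\<^bsub>R\<^esub>"
      using a n tr0 by (simp add: tr_add)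
    then show "tr (n \<otimes> a) = \<zero>\<^bsub>R\<^esub>" using double_R[of "tr (n \<otimes> a)"] a n by simp
  qed
qed

text \<open>A product of two skew elements is fixed by the involution, hence in the image of \<open>R\<close> up to the
  factor two, and is killed by \<open>\<delta>\<close>.  For skew \<open>x, y, z\<close> this gives both \<open>x y \<delta> z = z y \<delta> x\<close> and
  \<open>z \<delta> x = - x \<delta> z\<close>, so \<open>2 x y \<delta> z = 0\<close>; now \<open>skew_annihilator\<close> removes \<open>x\<close> and then \<open>y\<close>.\<close>

lemma derivation_zero:
  assumes closed: "\<And>a. a \<in> carrier S \<Longrightarrow> \<delta> a \<in> carrier S"
    and add: "\<And>a b. a \<in> carrier S \<Longrightarrow> b \<in> carrier S \<Longrightarrow> \<delta> (a \<oplus> b) = \<delta> a \<oplus> \<delta> b"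
    and Leibniz: "\<And>a b. a \<in> carrier S \<Longrightarrow> b \<in> carrier S \<Longrightarrow>
       \<delta> (a \<otimes> b) = a \<otimes> \<delta> b \<oplus> b \<otimes> \<delta> a"
    and base: "\<And>r. r \<in> carrier R \<Longrightarrow> \<delta> (r \<odot>\<^bsub>S\<^esub> \<one>) = \<zero>"
    and a: "a \<in> carrier S"
  shows "\<delta> a = \<zero>"
proof -
  let ?sk = "\<lambda>x. x \<in> carrier S \<and> cnj x = \<ominus> x"
  have fixed: "\<delta> b = \<zero>" if b: "b \<in> carrier S" "cnj b = b" for b
  proof -
    have "\<delta> b \<oplus> \<delta> b = \<delta> (b \<oplus> b)" by (rule add[OF b(1) b(1), symmetric])
    also have "b \<oplus> b = tr b \<odot>\<^bsub>S\<^esub> \<one>" using add_cnj[OF b(1)] unfolding b(2) .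
    also have "\<delta> (tr b \<odot>\<^bsub>S\<^esub> \<one>) = \<zero>" using base tr_closed[OF b(1)] by blast
    finally show ?thesis using closed[OF b(1)] double_S by blast
  qed
  have prod: "\<delta> (x \<otimes> y) = \<zero>" if "?sk x" "?sk y" for x y
    using that by (intro fixed) (simp_all add: cnj_mult S.l_minus S.r_minus)
  have prod3: "\<delta> (x \<otimes> y \<otimes> z) = x \<otimes> y \<otimes> \<delta> z" if "?sk x" "?sk y" "?sk z" for x y z
    using that prod[of x y] closed by (simp add: Leibniz[of "x \<otimes> y" z])
  have skew: "\<delta> z = \<zero>" if z: "?sk z" for z
  proof (rule skew_annihilator)
    show "\<delta> z \<in> carrier S" using z closed by simp
  next
    fix y assume y: "y \<in> carrier S" "cnj y = \<ominus> y"
    show "y \<otimes> \<delta> z = \<zero>"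
    proof (rule skew_annihilator)
      show "y \<otimes> \<delta> z \<in> carrier S" using y z closed by simp
    next
      fix x assume x: "x \<in> carrier S" "cnj x = \<ominus> x"
      have c: "x \<in> carrier S" "y \<in> carrier S" "z \<in> carrier S" "\<delta> x \<in> carrier S" "\<delta> z \<in> carrier S"
        using x y z closed by auto
      have "x \<otimes> y \<otimes> \<delta> z = z \<otimes> y \<otimes> \<delta> x"
      proof -
        have "x \<otimes> y \<otimes> z = z \<otimes> y \<otimes> x" using c by (simp add: S.m_ac)
        then show ?thesis using prod3[of x y z] prod3[of z y x] x y z by simp
      qed
      moreover have "z \<otimes> \<delta> x \<oplus> x \<otimes> \<delta> z = \<zero>"
        using prod[of z x] x z by (simp add: Leibniz)
      then have "y \<otimes> (z \<otimes> \<delta> x) \<oplus> y \<otimes> (x \<otimes> \<delta> z) = \<zero>"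
        using c by (simp add: S.r_distr[symmetric])
      ultimately have "x \<otimes> y \<otimes> \<delta> z \<oplus> x \<otimes> y \<otimes> \<delta> z = \<zero>"
        using c by (simp add: S.m_ac)
      then have "x \<otimes> y \<otimes> \<delta> z = \<zero>" using double_S[of "x \<otimes> y \<otimes> \<delta> z"] c by simp
      then show "x \<otimes> (y \<otimes> \<delta> z) = \<zero>" using c by (simp add: S.m_assoc)
    qed
  qed
  have "\<delta> a \<oplus> \<delta> a = \<delta> (a \<oplus> a)" by (rule add[OF a a, symmetric])
  also have "\<dots> = \<delta> (tr a \<odot>\<^bsub>S\<^esub> \<one>) \<oplus> \<delta> (a \<ominus> cnj a)"
    unfolding double_decompose[OF a] using a by (intro add) auto
  also have "\<dots> = \<zero>" using a base skew[of "a \<ominus> cnj a"] skew_part by simp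
  finally show ?thesis using closed[OF a] double_S by blast
qed

end

section \<open>The trace of a quadratic etale algebra\<close>

context
  fixes R :: "('r, 'c) ring_scheme" and S :: "('r, 's, 'd) module_scheme" (structure)
  assumes cringR: "cring R" and etale: "quadratic_etale R S"
begin

interpretation R: cring R by (rule cringR)
interpretation S: cring S using etale unfolding quadratic_etale_def using algebra.M_cring by blast
interpretation algebra R S using etale unfolding quadratic_etale_def by simp

lemma mult_linear: "a \<in> carrier S \<Longrightarrow> linear_map R S S (\<lambda>b. a \<otimes> b)"
  unfolding linear_map_def by (auto simp: S.r_distr smult_assoc2 S.m_comm[of a])

lemma algebra_trace_dual_basis:
  assumes "dual_basis R S n x \<phi>" "a \<in> carrier S"
  shows "algebra_trace R S a = (\<Oplus>\<^bsub>R\<^esub>i\<in>{..<n}. \<phi> i (a \<otimes> x i))"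
  unfolding algebra_trace_def using module_trace_eq[OF assms(1) mult_linear[OF assms(2)]] .

lemma dual_basisE:
  obtains n x \<phi> where "dual_basis R S n x \<phi>"
    and "\<And>i. i < n \<Longrightarrow> x i \<in> carrier S"
    and "\<And>i a. i < n \<Longrightarrow> a \<in> carrier S \<Longrightarrow> \<phi> i a \<in> carrier R"
    and "\<And>i a b. i < n \<Longrightarrow> a \<in> carrier S \<Longrightarrow> b \<in> carrier S \<Longrightarrow> \<phi> i (a \<oplus> b) = \<phi> i a \<oplus>\<^bsub>R\<^esub> \<phi> i b"
    and "\<And>i r a. i < n \<Longrightarrow> r \<in> carrier R \<Longrightarrow> a \<in> carrier S \<Longrightarrow> \<phi> i (r \<odot>\<^bsub>S\<^esub> a) = r \<otimes>\<^bsub>R\<^esub> \<phi> i a"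
    and "\<And>a. a \<in> carrier S \<Longrightarrow> a = (\<Oplus>i\<in>{..<n}. \<phi> i a \<odot>\<^bsub>S\<^esub> x i)"
proof -
  obtain n x \<phi> where db: "dual_basis R S n x \<phi>"
    using etale unfolding quadratic_etale_def fg_projective_def by blast
  show thesis
    by (rule that[OF db])
      (use db in \<open>auto simp: dual_basis_def linear_map_def regular_module_def Pi_iff\<close>)
qed

lemma algebra_trace_closed: "a \<in> carrier S \<Longrightarrow> algebra_trace R S a \<in> carrier R"
  by (rule dual_basisE) (auto simp: algebra_trace_dual_basis intro!: R.finsum_closed)

lemma algebra_trace_add:
  assumes "a \<in> carrier S" "b \<in> carrier S"
  shows "algebra_trace R S (a \<oplus> b) = algebra_trace R S a \<oplus>\<^bsub>R\<^esub> algebra_trace R S b"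
proof (rule dual_basisE)
  fix n x \<phi>
  assume db: "dual_basis R S n x \<phi>" and x: "\<And>i. i < n \<Longrightarrow> x i \<in> carrier S"
    and \<phi>: "\<And>i a. i < n \<Longrightarrow> a \<in> carrier S \<Longrightarrow> \<phi> i a \<in> carrier R"
    and \<phi>a: "\<And>i a b. i < n \<Longrightarrow> a \<in> carrier S \<Longrightarrow> b \<in> carrier S \<Longrightarrow> \<phi> i (a \<oplus> b) = \<phi> i a \<oplus>\<^bsub>R\<^esub> \<phi> i b"
  have "(\<Oplus>\<^bsub>R\<^esub>i\<in>{..<n}. \<phi> i ((a \<oplus> b) \<otimes> x i))
      = (\<Oplus>\<^bsub>R\<^esub>i\<in>{..<n}. \<phi> i (a \<otimes> x i) \<oplus>\<^bsub>R\<^esub> \<phi> i (b \<otimes> x i))"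
    using x \<phi> \<phi>a assms by (intro R.finsum_cong') (auto simp: S.l_distr)
  also have "\<dots> = (\<Oplus>\<^bsub>R\<^esub>i\<in>{..<n}. \<phi> i (a \<otimes> x i)) \<oplus>\<^bsub>R\<^esub> (\<Oplus>\<^bsub>R\<^esub>i\<in>{..<n}. \<phi> i (b \<otimes> x i))"
    using x \<phi> assms by (intro R.finsum_addf) auto
  finally show ?thesis using assms by (simp add: algebra_trace_dual_basis[OF db])
qed

lemma algebra_trace_smult:
  assumes "r \<in> carrier R" "a \<in> carrier S"
  shows "algebra_trace R S (r \<odot>\<^bsub>S\<^esub> a) = r \<otimes>\<^bsub>R\<^esub> algebra_trace R S a"
proof (rule dual_basisE)
  fix n x \<phi>
  assume db: "dual_basis R S n x \<phi>" and x: "\<And>i. i < n \<Longrightarrow> x i \<in> carrier S"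
    and \<phi>: "\<And>i a. i < n \<Longrightarrow> a \<in> carrier S \<Longrightarrow> \<phi> i a \<in> carrier R"
    and \<phi>s: "\<And>i r a. i < n \<Longrightarrow> r \<in> carrier R \<Longrightarrow> a \<in> carrier S \<Longrightarrow> \<phi> i (r \<odot>\<^bsub>S\<^esub> a) = r \<otimes>\<^bsub>R\<^esub> \<phi> i a"
  have "(\<Oplus>\<^bsub>R\<^esub>i\<in>{..<n}. \<phi> i ((r \<odot>\<^bsub>S\<^esub> a) \<otimes> x i))
      = (\<Oplus>\<^bsub>R\<^esub>i\<in>{..<n}. r \<otimes>\<^bsub>R\<^esub> \<phi> i (a \<otimes> x i))"
    using x \<phi> \<phi>s assms by (intro R.finsum_cong') (auto simp: smult_assoc2)
  also have "\<dots> = r \<otimes>\<^bsub>R\<^esub> (\<Oplus>\<^bsub>R\<^esub>i\<in>{..<n}. \<phi> i (a \<otimes> x i))"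
    using x \<phi> assms by (intro R.finsum_rdistr[symmetric]) auto
  finally show ?thesis using assms by (simp add: algebra_trace_dual_basis[OF db])
qed

lemma etale_base_faithful:
  assumes r: "r \<in> carrier R" and "r \<odot>\<^bsub>S\<^esub> \<one> = \<zero>"
  shows "r = \<zero>\<^bsub>R\<^esub>"
proof (rule faithful_of_constant_rank)
  show "has_constant_rank R S 2" using etale unfolding quadratic_etale_def by simp
next
  fix x assume "x \<in> carrier S"
  then show "r \<odot>\<^bsub>S\<^esub> x = \<zero>" using assms smult_assoc2[of r "\<one>" x] by simp
qed (use r in auto)

lemma etale_trace_nondegenerate:
  assumes a: "a \<in> carrier S" and 0: "\<And>b. b \<in> carrier S \<Longrightarrow> algebra_trace R S (a \<otimes> b) = \<zero>\<^bsub>R\<^esub>"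
  shows "a = \<zero>"
proof -
  have "inj_on (\<lambda>a. \<lambda>b\<in>carrier S. algebra_trace R S (a \<otimes> b)) (carrier S)"
    using etale unfolding quadratic_etale_def bij_betw_def by simp
  moreover have "algebra_trace R S (\<zero> \<otimes> b) = \<zero>\<^bsub>R\<^esub>" if "b \<in> carrier S" for b
    using algebra_trace_smult[of "\<zero>\<^bsub>R\<^esub>" b] algebra_trace_closed that by simp
  ultimately show ?thesis
    using a 0 by (elim inj_onD[of _ _ a "\<zero>"]) (auto simp: restrict_def fun_eq_iff)
qed

text \<open>The hypothesis equates two \<open>R\<close>-linear endomorphisms of \<open>S\<close>: multiplication by \<open>2 r\<close>, whose trace is
  \<open>2 r tr 1\<close>, and \<open>a \<mapsto> r tr a\<close>, whose trace is \<open>r tr 1\<close>.  Hence \<open>r tr 1 = 0\<close>, where \<open>tr 1 = 2\<close>.\<close>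

lemma etale_skew_faithful:
  assumes two: "\<one>\<^bsub>R\<^esub> \<oplus>\<^bsub>R\<^esub> \<one>\<^bsub>R\<^esub> \<in> Units R"
    and tr1: "algebra_trace R S \<one> \<odot>\<^bsub>S\<^esub> \<one> = \<one> \<oplus> \<one>"
    and r: "r \<in> carrier R"
    and skew: "\<And>a. a \<in> carrier S \<Longrightarrow>
      r \<odot>\<^bsub>S\<^esub> (a \<oplus> a) = (r \<otimes>\<^bsub>R\<^esub> algebra_trace R S a) \<odot>\<^bsub>S\<^esub> \<one>"
  shows "r = \<zero>\<^bsub>R\<^esub>"
proof (rule dual_basisE)
  fix n x \<phi>
  assume db: "dual_basis R S n x \<phi>" and x: "\<And>i. i < n \<Longrightarrow> x i \<in> carrier S"
    and \<phi>: "\<And>i a. i < n \<Longrightarrow> a \<in> carrier S \<Longrightarrow> \<phi> i a \<in> carrier R"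
    and \<phi>a: "\<And>i a b. i < n \<Longrightarrow> a \<in> carrier S \<Longrightarrow> b \<in> carrier S \<Longrightarrow> \<phi> i (a \<oplus> b) = \<phi> i a \<oplus>\<^bsub>R\<^esub> \<phi> i b"
    and \<phi>s: "\<And>i r a. i < n \<Longrightarrow> r \<in> carrier R \<Longrightarrow> a \<in> carrier S \<Longrightarrow> \<phi> i (r \<odot>\<^bsub>S\<^esub> a) = r \<otimes>\<^bsub>R\<^esub> \<phi> i a"
    and ex: "\<And>a. a \<in> carrier S \<Longrightarrow> a = (\<Oplus>i\<in>{..<n}. \<phi> i a \<odot>\<^bsub>S\<^esub> x i)"
  let ?tr = "algebra_trace R S"
  have t1: "?tr \<one> \<in> carrier R" by (simp add: algebra_trace_closed)
  have "r \<otimes>\<^bsub>R\<^esub> (?tr \<one> \<oplus>\<^bsub>R\<^esub> ?tr \<one>) = r \<otimes>\<^bsub>R\<^esub> (\<Oplus>\<^bsub>R\<^esub>i\<in>{..<n}. \<phi> i (x i) \<oplus>\<^bsub>R\<^esub> \<phi> i (x i))"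
  proof -
    have "?tr \<one> = (\<Oplus>\<^bsub>R\<^esub>i\<in>{..<n}. \<phi> i (x i))"
      unfolding algebra_trace_dual_basis[OF db S.one_closed]
      using x \<phi> by (intro R.finsum_cong') auto
    then show ?thesis using x \<phi> by (simp add: R.finsum_addf Pi_iff)
  qed
  also have "\<dots> = (\<Oplus>\<^bsub>R\<^esub>i\<in>{..<n}. r \<otimes>\<^bsub>R\<^esub> (\<phi> i (x i) \<oplus>\<^bsub>R\<^esub> \<phi> i (x i)))"
    using x \<phi> r by (intro R.finsum_rdistr) auto
  also have "\<dots> = (\<Oplus>\<^bsub>R\<^esub>i\<in>{..<n}. r \<otimes>\<^bsub>R\<^esub> (\<phi> i \<one> \<otimes>\<^bsub>R\<^esub> ?tr (x i)))"
  proof (intro R.finsum_cong' refl)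
    show "(\<lambda>i. r \<otimes>\<^bsub>R\<^esub> (\<phi> i \<one> \<otimes>\<^bsub>R\<^esub> ?tr (x i))) \<in> {..<n} \<rightarrow> carrier R"
      using r x \<phi> algebra_trace_closed by auto
  next
    fix i assume "i \<in> {..<n}"
    then have i: "i < n" by simp
    note c = x[OF i] \<phi>[OF i x[OF i]] \<phi>[OF i S.one_closed] algebra_trace_closed[OF x[OF i]]
    have "r \<otimes>\<^bsub>R\<^esub> (\<phi> i (x i) \<oplus>\<^bsub>R\<^esub> \<phi> i (x i)) = \<phi> i (r \<odot>\<^bsub>S\<^esub> (x i \<oplus> x i))"
      using c r i by (simp add: \<phi>s \<phi>a)
    also have "\<dots> = \<phi> i ((r \<otimes>\<^bsub>R\<^esub> ?tr (x i)) \<odot>\<^bsub>S\<^esub> \<one>)" using skew c by simp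
    also have "\<dots> = r \<otimes>\<^bsub>R\<^esub> (\<phi> i \<one> \<otimes>\<^bsub>R\<^esub> ?tr (x i))"
      using c r i by (simp add: \<phi>s R.m_ac)
    finally show "r \<otimes>\<^bsub>R\<^esub> (\<phi> i (x i) \<oplus>\<^bsub>R\<^esub> \<phi> i (x i)) = r \<otimes>\<^bsub>R\<^esub> (\<phi> i \<one> \<otimes>\<^bsub>R\<^esub> ?tr (x i))" .
  qed
  also have "\<dots> = r \<otimes>\<^bsub>R\<^esub> (\<Oplus>\<^bsub>R\<^esub>i\<in>{..<n}. \<phi> i \<one> \<otimes>\<^bsub>R\<^esub> ?tr (x i))"
    using x \<phi> r algebra_trace_closed by (intro R.finsum_rdistr[symmetric]) auto
  also have "(\<Oplus>\<^bsub>R\<^esub>i\<in>{..<n}. \<phi> i \<one> \<otimes>\<^bsub>R\<^esub> ?tr (x i)) = ?tr \<one>"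
  proof -
    have lin: "linear_map R S (regular_module R) ?tr"
      unfolding linear_map_def regular_module_def
      by (auto simp: algebra_trace_closed algebra_trace_add algebra_trace_smult)
    have "?tr \<one> = ?tr (\<Oplus>i\<in>{..<n}. \<phi> i \<one> \<odot>\<^bsub>S\<^esub> x i)" using ex[OF S.one_closed] by simp
    also have "\<dots> = (\<Oplus>\<^bsub>R\<^esub>i\<in>{..<n}. ?tr (\<phi> i \<one> \<odot>\<^bsub>S\<^esub> x i))"
      using linear_map_finsum[OF module_axioms module_regular[OF cringR] lin,
          of "{..<n}" "\<lambda>i. \<phi> i \<one> \<odot>\<^bsub>S\<^esub> x i"] x \<phi> by auto
    also have "\<dots> = (\<Oplus>\<^bsub>R\<^esub>i\<in>{..<n}. \<phi> i \<one> \<otimes>\<^bsub>R\<^esub> ?tr (x i))"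
      using x \<phi> by (intro R.finsum_cong') (auto simp: algebra_trace_smult algebra_trace_closed)
    finally show ?thesis by simp
  qed
  finally have "r \<otimes>\<^bsub>R\<^esub> ?tr \<one> = \<zero>\<^bsub>R\<^esub>"
    using r t1 by (simp add: R.r_distr)
  then have "r \<odot>\<^bsub>S\<^esub> (\<one> \<oplus> \<one>) = \<zero>"
    unfolding tr1[symmetric] using r t1 by (simp add: smult_assoc1[symmetric])
  then have "r \<odot>\<^bsub>S\<^esub> \<one> \<oplus> r \<odot>\<^bsub>S\<^esub> \<one> = \<zero>" using r by (simp add: smult_r_distr)
  then have "r \<odot>\<^bsub>S\<^esub> \<one> = \<zero>" using double_eq_zero[OF two, of "r \<odot>\<^bsub>S\<^esub> \<one>"] r by simp
  then show ?thesis using etale_base_faithful r by simp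
qed

end

section \<open>The third exterior power\<close>

definition alternating_trilinear ::
  "('s, 'd) ring_scheme \<Rightarrow> ('s, 'p, 'e) module_scheme \<Rightarrow> ('p \<Rightarrow> 'p \<Rightarrow> 'p \<Rightarrow> 's) \<Rightarrow> bool"
  where "alternating_trilinear S P c \<longleftrightarrow>
    (\<forall>u\<in>carrier P. \<forall>v\<in>carrier P. \<forall>w\<in>carrier P. c u v w \<in> carrier S) \<and>
    (\<forall>a\<in>carrier S. \<forall>b\<in>carrier S. \<forall>u\<in>carrier P. \<forall>v\<in>carrier P. \<forall>x\<in>carrier P. \<forall>y\<in>carrier P.
       c (a \<odot>\<^bsub>P\<^esub> u \<oplus>\<^bsub>P\<^esub> b \<odot>\<^bsub>P\<^esub> v) x y = a \<otimes>\<^bsub>S\<^esub> c u x y \<oplus>\<^bsub>S\<^esub> b \<otimes>\<^bsub>S\<^esub> c v x y \<and>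
       c x (a \<odot>\<^bsub>P\<^esub> u \<oplus>\<^bsub>P\<^esub> b \<odot>\<^bsub>P\<^esub> v) y = a \<otimes>\<^bsub>S\<^esub> c x u y \<oplus>\<^bsub>S\<^esub> b \<otimes>\<^bsub>S\<^esub> c x v y \<and>
       c x y (a \<odot>\<^bsub>P\<^esub> u \<oplus>\<^bsub>P\<^esub> b \<odot>\<^bsub>P\<^esub> v) = a \<otimes>\<^bsub>S\<^esub> c x y u \<oplus>\<^bsub>S\<^esub> b \<otimes>\<^bsub>S\<^esub> c x y v) \<and>
    (\<forall>u\<in>carrier P. \<forall>v\<in>carrier P.
       c u u v = \<zero>\<^bsub>S\<^esub> \<and> c v u u = \<zero>\<^bsub>S\<^esub> \<and> c u v u = \<zero>\<^bsub>S\<^esub>)"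

lemma free_triples_carrier:
  "f \<in> carrier (free_triples S P) \<longleftrightarrow> finite {t. f t \<noteq> \<zero>\<^bsub>S\<^esub>} \<and> (\<forall>t. f t \<in> carrier S) \<and> {t. f t \<noteq> \<zero>\<^bsub>S\<^esub>} \<subseteq> carrier P \<times> carrier P \<times> carrier P"
  by (simp add: free_triples_def)

lemma free_triples_ops [simp]:
  "zero (free_triples S P) = (\<lambda>t. \<zero>\<^bsub>S\<^esub>)" "add (free_triples S P) f g = (\<lambda>t. f t \<oplus>\<^bsub>S\<^esub> g t)" "smult (free_triples S P) a f = (\<lambda>t. a \<otimes>\<^bsub>S\<^esub> f t)"
  by (simp_all add: free_triples_def)

text \<open>The linear functional on the free module on triples with prescribed values on the generators.\<close>

definition extend_linearly ::
  "('s, 'd) ring_scheme \<Rightarrow> ('p \<Rightarrow> 'p \<Rightarrow> 'p \<Rightarrow> 's) \<Rightarrow> ('p \<times> 'p \<times> 'p \<Rightarrow> 's) \<Rightarrow> 's"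
  where "extend_linearly S c f = (\<Oplus>\<^bsub>S\<^esub>t\<in>{t. f t \<noteq> \<zero>\<^bsub>S\<^esub>}. f t \<otimes>\<^bsub>S\<^esub> (case t of (u, v, w) \<Rightarrow> c u v w))"

context
  fixes S :: "('s, 'd) ring_scheme" (structure) and P :: "('s, 'p, 'e) module_scheme"
  assumes modP: "module S P"
begin

interpretation module S P by (rule modP)

abbreviation (input) "triples \<equiv> carrier P \<times> carrier P \<times> carrier P"
abbreviation (input) "F \<equiv> free_triples S P"
abbreviation (input) "supp f \<equiv> {t. f t \<noteq> \<zero>}"

lemma free_triples_module: "module S F"
proof (intro moduleI abelian_groupI)
  show "cring S" by (rule R.cring_axioms)
next
  fix f g assume f: "f \<in> carrier F" and g: "g \<in> carrier F"
  have sub: "supp (\<lambda>t. f t \<oplus> g t) \<subseteq> supp f \<union> supp g" by auto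
  moreover have "finite (supp f \<union> supp g)" using f g by (simp add: free_triples_carrier)
  ultimately have "finite (supp (\<lambda>t. f t \<oplus> g t))" by (rule finite_subset)
  moreover have "supp f \<union> supp g \<subseteq> triples" using f g by (simp add: free_triples_carrier)
  ultimately show "f \<oplus>\<^bsub>F\<^esub> g \<in> carrier F"
    using f g order_trans[OF sub] by (simp add: free_triples_carrier)
next
  fix a f assume a: "a \<in> carrier S" and f: "f \<in> carrier F"
  have sub: "supp (\<lambda>t. a \<otimes> f t) \<subseteq> supp f" using a by auto
  moreover have "finite (supp f)" using f by (simp add: free_triples_carrier)
  ultimately have "finite (supp (\<lambda>t. a \<otimes> f t))" by (rule finite_subset)
  then show "a \<odot>\<^bsub>F\<^esub> f \<in> carrier F"
    using a f order_trans[OF sub] by (simp add: free_triples_carrier)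
next
  fix f assume f: "f \<in> carrier F"
  have "supp (\<lambda>t. \<ominus> f t) \<subseteq> supp f" by auto
  moreover have "finite (supp f)" using f by (simp add: free_triples_carrier)
  ultimately have "finite (supp (\<lambda>t. \<ominus> f t))" by (rule finite_subset)
  then have "(\<lambda>t. \<ominus> f t) \<in> carrier F"
    using f by (auto simp: free_triples_carrier)
  then show "\<exists>g\<in>carrier F. g \<oplus>\<^bsub>F\<^esub> f = \<zero>\<^bsub>F\<^esub>"
    using f by (intro bexI[of _ "\<lambda>t. \<ominus> f t"]) (auto simp: free_triples_carrier R.l_neg)
qed (auto simp: free_triples_carrier R.a_ac R.m_assoc R.l_distr R.r_distr)

interpretation F: module S F by (rule free_triples_module)

lemma triple_gen_closed:
  "u \<in> carrier P \<Longrightarrow> v \<in> carrier P \<Longrightarrow> w \<in> carrier P \<Longrightarrow> triple_gen S u v w \<in> carrier F"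
  unfolding free_triples_carrier triple_gen_def by (auto intro: finite_subset[of _ "{(u, v, w)}"])

lemma extend_linearly_superset:
  assumes c: "\<And>u v w. u \<in> carrier P \<Longrightarrow> v \<in> carrier P \<Longrightarrow> w \<in> carrier P \<Longrightarrow> c u v w \<in> carrier S"
    and f: "f \<in> carrier F" and A: "finite A" "supp f \<subseteq> A" "A \<subseteq> triples"
  shows "extend_linearly S c f = (\<Oplus>t\<in>A. f t \<otimes> (case t of (u, v, w) \<Rightarrow> c u v w))"
  unfolding extend_linearly_def
  by (rule R.add.finprod_mono_neutral_cong_left)
    (use A c f in \<open>auto simp: free_triples_carrier Pi_def split: prod.splits\<close>)

lemma extend_linearly_linear:
  assumes c: "\<And>u v w. u \<in> carrier P \<Longrightarrow> v \<in> carrier P \<Longrightarrow> w \<in> carrier P \<Longrightarrow> c u v w \<in> carrier S"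
  shows "linear_map S F (regular_module S) (extend_linearly S c)"
proof -
  let ?c = "\<lambda>t. case t of (u, v, w) \<Rightarrow> c u v w"
  have cl: "?c t \<in> carrier S" if "t \<in> triples" for t using that c by auto
  have "extend_linearly S c f \<in> carrier S" if "f \<in> carrier F" for f
    unfolding extend_linearly_def
    by (rule R.finsum_closed) (use that c in \<open>auto simp: free_triples_carrier\<close>)
  moreover have "extend_linearly S c (f \<oplus>\<^bsub>F\<^esub> g) = extend_linearly S c f \<oplus> extend_linearly S c g"
    if f: "f \<in> carrier F" and g: "g \<in> carrier F" for f g
  proof -
    let ?A = "supp f \<union> supp g"
    have A: "finite ?A" "?A \<subseteq> triples" using f g unfolding free_triples_carrier by auto
    have fg: "f \<oplus>\<^bsub>F\<^esub> g \<in> carrier F" using f g by (rule F.M.add.m_closed)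
    have "extend_linearly S c (f \<oplus>\<^bsub>F\<^esub> g) = (\<Oplus>t\<in>?A. (f \<oplus>\<^bsub>F\<^esub> g) t \<otimes> ?c t)"
      by (rule extend_linearly_superset[OF c fg A(1) _ A(2)]) auto
    also have "\<dots> = (\<Oplus>t\<in>?A. f t \<otimes> ?c t \<oplus> g t \<otimes> ?c t)"
      by (rule R.finsum_cong')
        (use f g A cl in \<open>auto simp: free_triples_carrier R.l_distr Pi_iff subset_iff\<close>)
    also have "\<dots> = (\<Oplus>t\<in>?A. f t \<otimes> ?c t) \<oplus> (\<Oplus>t\<in>?A. g t \<otimes> ?c t)"
      by (rule R.finsum_addf) (use f g A cl in \<open>auto simp: free_triples_carrier Pi_iff subset_iff\<close>)
    also have "\<dots> = extend_linearly S c f \<oplus> extend_linearly S c g"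
      using extend_linearly_superset[OF c f A(1) _ A(2)] extend_linearly_superset[OF c g A(1) _ A(2)]
      by auto
    finally show ?thesis .
  qed
  moreover have "extend_linearly S c (a \<odot>\<^bsub>F\<^esub> f) = a \<otimes> extend_linearly S c f"
    if a: "a \<in> carrier S" and f: "f \<in> carrier F" for a f
  proof -
    have A: "finite (supp f)" "supp f \<subseteq> triples" using f unfolding free_triples_carrier by auto
    have af: "a \<odot>\<^bsub>F\<^esub> f \<in> carrier F" using a f by (rule F.smult_closed)
    have "extend_linearly S c (a \<odot>\<^bsub>F\<^esub> f) = (\<Oplus>t\<in>supp f. (a \<odot>\<^bsub>F\<^esub> f) t \<otimes> ?c t)"
      by (rule extend_linearly_superset[OF c af A(1) _ A(2)]) (use a in auto)
    also have "\<dots> = (\<Oplus>t\<in>supp f. a \<otimes> (f t \<otimes> ?c t))"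
      by (rule R.finsum_cong')
        (use f a A cl in \<open>auto simp: free_triples_carrier R.m_assoc Pi_iff subset_iff\<close>)
    also have "\<dots> = a \<otimes> extend_linearly S c f"
      unfolding extend_linearly_def
      by (rule R.finsum_rdistr[symmetric])
        (use f a A cl in \<open>auto simp: free_triples_carrier Pi_iff subset_iff\<close>)
    finally show ?thesis .
  qed
  ultimately show ?thesis
    unfolding linear_map_def by (auto simp: regular_module_def)
qed

lemma extend_linearly_gen:
  assumes c: "\<And>u v w. u \<in> carrier P \<Longrightarrow> v \<in> carrier P \<Longrightarrow> w \<in> carrier P \<Longrightarrow> c u v w \<in> carrier S"
    and uvw: "u \<in> carrier P" "v \<in> carrier P" "w \<in> carrier P"
  shows "extend_linearly S c (triple_gen S u v w) = c u v w"
proof -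
  have "extend_linearly S c (triple_gen S u v w)
      = (\<Oplus>t\<in>{(u, v, w)}. triple_gen S u v w t \<otimes> (case t of (u, v, w) \<Rightarrow> c u v w))"
    by (rule extend_linearly_superset[OF c triple_gen_closed[OF uvw]])
      (use uvw in \<open>auto simp: triple_gen_def\<close>)
  then show ?thesis using c[OF uvw] by (simp add: triple_gen_def)
qed

lemma linear_functional_zero:
  assumes "module S N" and L: "linear_map S N (regular_module S) L"
  shows "L \<zero>\<^bsub>N\<^esub> = \<zero>"
proof -
  interpret N: module S N by fact
  have "L (\<zero> \<odot>\<^bsub>N\<^esub> \<zero>\<^bsub>N\<^esub>) = \<zero> \<otimes> L \<zero>\<^bsub>N\<^esub>" "L \<zero>\<^bsub>N\<^esub> \<in> carrier S"
    using L R.zero_closed N.M.zero_closed unfolding linear_map_def regular_module_def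
    by (simp_all add: Pi_iff del: N.smult_r_null N.smult_l_null R.l_null)
  then show ?thesis by simp
qed

lemma linear_functional_uminus:
  assumes "module S N" and L: "linear_map S N (regular_module S) L" and f: "f \<in> carrier N"
  shows "L (\<ominus>\<^bsub>N\<^esub> f) = \<ominus> L f"
proof -
  interpret N: module S N by fact
  have Lc: "\<And>f. f \<in> carrier N \<Longrightarrow> L f \<in> carrier S"
    and La: "\<And>f g. f \<in> carrier N \<Longrightarrow> g \<in> carrier N \<Longrightarrow> L (f \<oplus>\<^bsub>N\<^esub> g) = L f \<oplus> L g"
    using L unfolding linear_map_def regular_module_def by (simp_all add: Pi_iff)
  have "L (\<ominus>\<^bsub>N\<^esub> f) \<oplus> L f = L (\<ominus>\<^bsub>N\<^esub> f \<oplus>\<^bsub>N\<^esub> f)" using f by (simp add: La)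
  also have "\<dots> = \<zero>" using f linear_functional_zero[OF assms(1) L] by (simp add: N.M.l_neg)
  finally show ?thesis using f Lc by (simp add: R.minus_equality)
qed

lemma linear_functional_minus:
  assumes "module S N" and L: "linear_map S N (regular_module S) L"
    and f: "f \<in> carrier N" and g: "g \<in> carrier N"
  shows "L (f \<ominus>\<^bsub>N\<^esub> g) = L f \<ominus> L g"
proof -
  interpret N: module S N by fact
  have "L (f \<oplus>\<^bsub>N\<^esub> \<ominus>\<^bsub>N\<^esub> g) = L f \<oplus> L (\<ominus>\<^bsub>N\<^esub> g)"
    using L f g unfolding linear_map_def regular_module_def by simp
  then show ?thesis
    using linear_functional_uminus[OF assms(1) L g] by (simp add: N.M.minus_eq R.minus_eq)
qed

lemma wedge_submodule: "submodule (wedge_submodule S P) S F"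
  and wedge_submodule_least:
    "submodule N S F \<Longrightarrow> wedge_relations S P \<subseteq> N \<Longrightarrow> wedge_submodule S P \<subseteq> N"
  and wedge_relations_subset: "wedge_relations S P \<subseteq> wedge_submodule S P"
proof -
  have gens: "wedge_relations S P \<subseteq> carrier F"
    unfolding wedge_relations_def linearity_defect_def
    by (auto simp del: free_triples_ops intro!: triple_gen_closed F.M.minus_closed F.M.a_closed F.smult_closed)
  let ?\<N> = "{N. submodule N S F \<and> wedge_relations S P \<subseteq> N}"
  have car: "carrier F \<in> ?\<N>" using F.carrier_is_submodule gens by simp
  show "submodule (wedge_submodule S P) S F"
    unfolding wedge_submodule_def
  proof (rule F.submoduleI)
    show "\<Inter>?\<N> \<subseteq> carrier F" using car by (rule Inter_lower)
  next
    have "\<zero>\<^bsub>F\<^esub> \<in> N" if "submodule N S F" for N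
      using submodule.axioms(1)[OF that] subgroup.one_closed by fastforce
    then show "\<zero>\<^bsub>F\<^esub> \<in> \<Inter>?\<N>" by blast
  next
    fix a assume "a \<in> \<Inter>?\<N>"
    then show "\<ominus>\<^bsub>F\<^esub> a \<in> \<Inter>?\<N>" using F.submoduleE(3) by blast
  next
    fix a b assume "a \<in> \<Inter>?\<N>" "b \<in> \<Inter>?\<N>"
    then show "a \<oplus>\<^bsub>F\<^esub> b \<in> \<Inter>?\<N>" using F.submoduleE(5) by blast
  next
    fix a x assume "a \<in> carrier S" "x \<in> \<Inter>?\<N>"
    then show "a \<odot>\<^bsub>F\<^esub> x \<in> \<Inter>?\<N>" using F.submoduleE(4) by blast
  qed
  show "submodule N S F \<Longrightarrow> wedge_relations S P \<subseteq> N \<Longrightarrow> wedge_submodule S P \<subseteq> N"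
    unfolding wedge_submodule_def by blast
  show "wedge_relations S P \<subseteq> wedge_submodule S P"
    unfolding wedge_submodule_def by blast
qed

lemma kernel_submodule:
  assumes L: "linear_map S F (regular_module S) L"
  shows "submodule {f \<in> carrier F. L f = \<zero>} S F"
proof (rule F.submoduleI)
  show "\<zero>\<^bsub>F\<^esub> \<in> {f \<in> carrier F. L f = \<zero>}"
    using linear_functional_zero[OF free_triples_module L] F.M.zero_closed by simp
next
  fix f assume "f \<in> {f \<in> carrier F. L f = \<zero>}"
  then show "\<ominus>\<^bsub>F\<^esub> f \<in> {f \<in> carrier F. L f = \<zero>}"
    using linear_functional_uminus[OF free_triples_module L] by simp
next
  fix f g assume "f \<in> {f \<in> carrier F. L f = \<zero>}" "g \<in> {f \<in> carrier F. L f = \<zero>}"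
  then show "f \<oplus>\<^bsub>F\<^esub> g \<in> {f \<in> carrier F. L f = \<zero>}"
    using L F.M.a_closed[of f g] unfolding linear_map_def by (auto simp: regular_module_def)
next
  fix a f assume "a \<in> carrier S" "f \<in> {f \<in> carrier F. L f = \<zero>}"
  then show "a \<odot>\<^bsub>F\<^esub> f \<in> {f \<in> carrier F. L f = \<zero>}"
    using L F.smult_closed[of a f] unfolding linear_map_def by (auto simp: regular_module_def)
qed auto

text \<open>The universal property of the exterior cube for scalar valued forms: the kernel of the functional
  is a submodule that contains the defining relations.\<close>

lemma extend_linearly_wedge_submodule:
  assumes c: "alternating_trilinear S P c" and f: "f \<in> wedge_submodule S P"
  shows "extend_linearly S c f = \<zero>"
proof -
  let ?L = "extend_linearly S c"
  have cc: "\<And>u v w. u \<in> carrier P \<Longrightarrow> v \<in> carrier P \<Longrightarrow> w \<in> carrier P \<Longrightarrow> c u v w \<in> carrier S"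
    using c unfolding alternating_trilinear_def by blast
  have L: "linear_map S F (regular_module S) ?L" by (rule extend_linearly_linear[OF cc])
  note Lgen = extend_linearly_gen[OF cc]
  have La: "?L (f \<oplus>\<^bsub>F\<^esub> g) = ?L f \<oplus> ?L g" if "f \<in> carrier F" "g \<in> carrier F" for f g
    using L that unfolding linear_map_def regular_module_def by simp
  have Ls: "?L (a \<odot>\<^bsub>F\<^esub> f) = a \<otimes> ?L f" if "a \<in> carrier S" "f \<in> carrier F" for a f
    using L that unfolding linear_map_def regular_module_def by simp
  have combi: "?L ((a \<odot>\<^bsub>F\<^esub> f) \<oplus>\<^bsub>F\<^esub> (b \<odot>\<^bsub>F\<^esub> g)) = a \<otimes> ?L f \<oplus> b \<otimes> ?L g"
    and closed: "(a \<odot>\<^bsub>F\<^esub> f) \<oplus>\<^bsub>F\<^esub> (b \<odot>\<^bsub>F\<^esub> g) \<in> carrier F"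
    if "a \<in> carrier S" "b \<in> carrier S" "f \<in> carrier F" "g \<in> carrier F" for a b f g
    using that by (simp_all only: La Ls F.smult_closed F.M.a_closed)
  have defect: "linearity_defect S P F \<phi> a b u v \<in> {f \<in> carrier F. ?L f = \<zero>}"
    if "a \<in> carrier S" "b \<in> carrier S" "u \<in> carrier P" "v \<in> carrier P"
      and \<phi>: "\<And>z. z \<in> carrier P \<Longrightarrow> \<phi> z \<in> carrier F"
      and e: "?L (\<phi> (a \<odot>\<^bsub>P\<^esub> u \<oplus>\<^bsub>P\<^esub> b \<odot>\<^bsub>P\<^esub> v)) = a \<otimes> ?L (\<phi> u) \<oplus> b \<otimes> ?L (\<phi> v)"
    for \<phi> a b u v
  proof -
    have z: "\<phi> (a \<odot>\<^bsub>P\<^esub> u \<oplus>\<^bsub>P\<^esub> b \<odot>\<^bsub>P\<^esub> v) \<in> carrier F" using that by simp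
    have k: "(a \<odot>\<^bsub>F\<^esub> \<phi> u) \<oplus>\<^bsub>F\<^esub> (b \<odot>\<^bsub>F\<^esub> \<phi> v) \<in> carrier F" using that by (intro closed)
    have Lk: "?L ((a \<odot>\<^bsub>F\<^esub> \<phi> u) \<oplus>\<^bsub>F\<^esub> (b \<odot>\<^bsub>F\<^esub> \<phi> v)) = ?L (\<phi> (a \<odot>\<^bsub>P\<^esub> u \<oplus>\<^bsub>P\<^esub> b \<odot>\<^bsub>P\<^esub> v))"
      using that by (simp only: combi e)
    let ?k = "?L (\<phi> (a \<odot>\<^bsub>P\<^esub> u \<oplus>\<^bsub>P\<^esub> b \<odot>\<^bsub>P\<^esub> v))"
    have "?k \<in> carrier S"
      using L z unfolding linear_map_def regular_module_def by auto
    then have "?k \<ominus> ?k = \<zero>" by (simp only: R.minus_eq R.r_neg)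
    then have "?L (linearity_defect S P F \<phi> a b u v) = \<zero>"
      unfolding linearity_defect_def linear_functional_minus[OF free_triples_module L z k] Lk .
    then show ?thesis unfolding linearity_defect_def using F.M.minus_closed[OF z k] by simp
  qed
  let ?K = "{f \<in> carrier F. ?L f = \<zero>}"
  have r1: "linearity_defect S P F (\<lambda>z. triple_gen S z x y) a b u v \<in> ?K"
    if "{a, b} \<subseteq> carrier S" "{u, v, x, y} \<subseteq> carrier P" for a b u v x y
    using that c by (intro defect triple_gen_closed) (simp_all add: Lgen alternating_trilinear_def)
  have r2: "linearity_defect S P F (\<lambda>z. triple_gen S x z y) a b u v \<in> ?K"
    if "{a, b} \<subseteq> carrier S" "{u, v, x, y} \<subseteq> carrier P" for a b u v x y
    using that c by (intro defect triple_gen_closed) (simp_all add: Lgen alternating_trilinear_def)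
  have r3: "linearity_defect S P F (\<lambda>z. triple_gen S x y z) a b u v \<in> ?K"
    if "{a, b} \<subseteq> carrier S" "{u, v, x, y} \<subseteq> carrier P" for a b u v x y
    using that c by (intro defect triple_gen_closed) (simp_all add: Lgen alternating_trilinear_def)
  have r4: "triple_gen S u v w \<in> ?K"
    if "{u, v, w} \<subseteq> carrier P" "u = v \<or> v = w \<or> u = w" for u v w
    using that c by (auto simp: triple_gen_closed Lgen alternating_trilinear_def)
  have "wedge_relations S P \<subseteq> ?K"
    unfolding wedge_relations_def
    by (intro Un_least subsetI; elim CollectE exE conjE; hypsubst; (rule r1 r2 r3 r4; assumption))
  then have "wedge_submodule S P \<subseteq> {f \<in> carrier F. ?L f = \<zero>}"
    by (rule wedge_submodule_least[OF kernel_submodule[OF L]])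
  then show ?thesis using f by blast
qed

end

lemma (in cring) ideal_if_closed:
  assumes "I \<subseteq> carrier R" "\<zero> \<in> I" and "\<And>a b. a \<in> I \<Longrightarrow> b \<in> I \<Longrightarrow> a \<oplus> b \<in> I"
    and l: "\<And>x a. x \<in> carrier R \<Longrightarrow> a \<in> I \<Longrightarrow> x \<otimes> a \<in> I"
  shows "ideal I R"
proof (rule idealI)
  show "subgroup I (add_monoid R)"
  proof (rule add.subgroupI)
    fix a assume a: "a \<in> I"
    then have "(\<ominus> \<one>) \<otimes> a \<in> I" by (intro l) auto
    moreover have "(\<ominus> \<one>) \<otimes> a = \<ominus> a" using a assms(1) by (subst l_minus) auto
    ultimately show "\<ominus> a \<in> I" by simp
  qed (use assms in auto)
next
  fix a x assume a: "a \<in> I" and x: "x \<in> carrier R"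
  show "x \<otimes> a \<in> I" using l[OF x a] .
  moreover have "x \<otimes> a = a \<otimes> x" using a x assms(1) by (intro m_comm) auto
  ultimately show "a \<otimes> x \<in> I" by simp
qed (rule ring_axioms)

context
  fixes S :: "('s, 'd) ring_scheme" (structure) and P :: "('s, 'p, 'e) module_scheme"
  assumes modP: "module S P"
begin

interpretation module S P by (rule modP)
interpretation F: module S "free_triples S P" by (rule free_triples_module[OF modP])

lemma wedge_abelian_subgroup: "abelian_subgroup (wedge_submodule S P) (free_triples S P)"
proof (rule abelian_subgroupI3)
  show "additive_subgroup (wedge_submodule S P) (free_triples S P)"
    by (rule additive_subgroup.intro) (rule submodule.axioms(1)[OF wedge_submodule[OF modP]])
qed (rule F.M.abelian_group_axioms)

lemma exterior_cube_smult_coset: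
  assumes a: "a \<in> carrier S" and f: "f \<in> carrier (free_triples S P)"
  shows "smult (exterior_cube S P) a (wedge_submodule S P +>\<^bsub>free_triples S P\<^esub> f)
    = wedge_submodule S P +>\<^bsub>free_triples S P\<^esub> (a \<odot>\<^bsub>free_triples S P\<^esub> f)"
proof -
  let ?F = "free_triples S P" and ?N = "wedge_submodule S P"
  note N = submodule.axioms(1)[OF wedge_submodule[OF modP]]
  have NF: "?N \<subseteq> carrier ?F" using F.submoduleE(1)[OF wedge_submodule[OF modP]] .
  have af: "a \<odot>\<^bsub>?F\<^esub> f \<in> carrier ?F" using a f by (rule F.smult_closed)
  have eq: "?N +>\<^bsub>?F\<^esub> (a \<odot>\<^bsub>?F\<^esub> g) = ?N +>\<^bsub>?F\<^esub> (a \<odot>\<^bsub>?F\<^esub> f)" if g: "g \<in> ?N +>\<^bsub>?F\<^esub> f" for g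
  proof -
    obtain k where k: "k \<in> ?N" and g: "g = k \<oplus>\<^bsub>?F\<^esub> f" using g unfolding a_r_coset_def' by blast
    have "a \<odot>\<^bsub>?F\<^esub> g = (a \<odot>\<^bsub>?F\<^esub> k) \<oplus>\<^bsub>?F\<^esub> (a \<odot>\<^bsub>?F\<^esub> f)"
      unfolding g using a k NF f by (intro F.smult_r_distr) auto
    moreover have "a \<odot>\<^bsub>?F\<^esub> k \<in> ?N" using F.submoduleE(4)[OF wedge_submodule[OF modP] a k] .
    ultimately have "a \<odot>\<^bsub>?F\<^esub> g \<in> ?N +>\<^bsub>?F\<^esub> (a \<odot>\<^bsub>?F\<^esub> f)" unfolding a_r_coset_def' by blast
    from F.M.a_repr_independence[OF this af N] show ?thesis by simp
  qed
  have ne: "f \<in> ?N +>\<^bsub>?F\<^esub> f"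
    using abelian_subgroup.a_rcos_self[OF wedge_abelian_subgroup f] .
  have "smult (exterior_cube S P) a (?N +>\<^bsub>?F\<^esub> f)
      = (\<Union>g\<in>?N +>\<^bsub>?F\<^esub> f. ?N +>\<^bsub>?F\<^esub> (a \<odot>\<^bsub>?F\<^esub> g))"
    by (simp add: exterior_cube_def Let_def)
  also have "\<dots> = (\<Union>g\<in>?N +>\<^bsub>?F\<^esub> f. ?N +>\<^bsub>?F\<^esub> (a \<odot>\<^bsub>?F\<^esub> f))"
    by (intro SUP_cong refl eq)
  also have "\<dots> = ?N +>\<^bsub>?F\<^esub> (a \<odot>\<^bsub>?F\<^esub> f)" using ne by blast
  finally show ?thesis .
qed

lemma wedge3_closed:
  assumes "u \<in> carrier P" "v \<in> carrier P" "w \<in> carrier P"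
  shows "wedge3 S P u v w \<in> carrier (exterior_cube S P)"
  using F.M.a_rcosetsI[OF F.submoduleE(1)[OF wedge_submodule[OF modP]] triple_gen_closed[OF modP assms]]
  by (simp add: exterior_cube_def Let_def wedge3_def)

lemma exterior_cube_functional:
  assumes \<alpha>: "linear_map S (exterior_cube S P) (regular_module S) \<alpha>"
  shows "linear_map S (free_triples S P) (regular_module S)
    (\<lambda>f. \<alpha> (wedge_submodule S P +>\<^bsub>free_triples S P\<^esub> f))"
proof -
  let ?F = "free_triples S P" and ?N = "wedge_submodule S P" and ?E = "exterior_cube S P"
  have NF: "?N \<subseteq> carrier ?F" using F.submoduleE(1)[OF wedge_submodule[OF modP]] .
  have car: "?N +>\<^bsub>?F\<^esub> f \<in> carrier ?E" if "f \<in> carrier ?F" for f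
    using F.M.a_rcosetsI[OF NF that] by (simp add: exterior_cube_def Let_def)
  have add: "?N +>\<^bsub>?F\<^esub> (f \<oplus>\<^bsub>?F\<^esub> g) = (?N +>\<^bsub>?F\<^esub> f) \<oplus>\<^bsub>?E\<^esub> (?N +>\<^bsub>?F\<^esub> g)"
    if "f \<in> carrier ?F" "g \<in> carrier ?F" for f g
    using abelian_subgroup.a_rcos_sum[OF wedge_abelian_subgroup that]
    by (simp add: exterior_cube_def Let_def)
  show ?thesis
    using \<alpha> car unfolding linear_map_def
    by (simp add: add exterior_cube_smult_coset[symmetric] Pi_iff del: free_triples_ops)
qed

lemma exterior_cube_volume_alternating:
  assumes \<alpha>: "linear_map S (exterior_cube S P) (regular_module S) \<alpha>"
  shows "alternating_trilinear S P (\<lambda>u v w. \<alpha> (wedge3 S P u v w))"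
proof -
  let ?F = "free_triples S P" and ?N = "wedge_submodule S P"
  define L where "L = (\<lambda>f. \<alpha> (?N +>\<^bsub>?F\<^esub> f))"
  have L: "linear_map S ?F (regular_module S) L"
    unfolding L_def by (rule exterior_cube_functional[OF \<alpha>])
  note N = submodule.axioms(1)[OF wedge_submodule[OF modP]]
  have NF: "?N \<subseteq> carrier ?F" using F.submoduleE(1)[OF wedge_submodule[OF modP]] .
  have zN: "\<zero>\<^bsub>?F\<^esub> \<in> ?N" using subgroup.one_closed[OF N] by (simp del: free_triples_ops)
  have L0: "L f = \<zero>" if "f \<in> ?N" for f
  proof -
    have "?N +>\<^bsub>?F\<^esub> f = ?N +>\<^bsub>?F\<^esub> \<zero>\<^bsub>?F\<^esub>"
      using F.M.a_coset_join2[OF _ N that] F.M.a_coset_join2[OF _ N zN] that NF zN by blast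
    then have "L f = L \<zero>\<^bsub>?F\<^esub>" unfolding L_def by (rule arg_cong)
    then show ?thesis using linear_functional_zero[OF modP F.module_axioms L] by simp
  qed
  have Lc: "L f \<in> carrier S" if "f \<in> carrier ?F" for f
    using L that unfolding linear_map_def regular_module_def by auto
  have La: "L (f \<oplus>\<^bsub>?F\<^esub> g) = L f \<oplus> L g" if "f \<in> carrier ?F" "g \<in> carrier ?F" for f g
    using L that unfolding linear_map_def regular_module_def by simp
  have Ls: "L (a \<odot>\<^bsub>?F\<^esub> f) = a \<otimes> L f" if "a \<in> carrier S" "f \<in> carrier ?F" for a f
    using L that unfolding linear_map_def regular_module_def by simp
  have lin: "L (\<phi> (a \<odot>\<^bsub>P\<^esub> u \<oplus>\<^bsub>P\<^esub> b \<odot>\<^bsub>P\<^esub> v)) = a \<otimes> L (\<phi> u) \<oplus> b \<otimes> L (\<phi> v)"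
    if "a \<in> carrier S" "b \<in> carrier S" "u \<in> carrier P" "v \<in> carrier P"
      and \<phi>: "\<And>z. z \<in> carrier P \<Longrightarrow> \<phi> z \<in> carrier ?F"
      and rel: "linearity_defect S P ?F \<phi> a b u v \<in> ?N"
    for \<phi> a b u v
  proof -
    have z: "\<phi> (a \<odot>\<^bsub>P\<^esub> u \<oplus>\<^bsub>P\<^esub> b \<odot>\<^bsub>P\<^esub> v) \<in> carrier ?F" "\<phi> u \<in> carrier ?F" "\<phi> v \<in> carrier ?F"
      using that by simp_all
    have s: "a \<odot>\<^bsub>?F\<^esub> \<phi> u \<in> carrier ?F" "b \<odot>\<^bsub>?F\<^esub> \<phi> v \<in> carrier ?F"
      using that by (intro F.smult_closed; simp)+
    have k: "(a \<odot>\<^bsub>?F\<^esub> \<phi> u) \<oplus>\<^bsub>?F\<^esub> (b \<odot>\<^bsub>?F\<^esub> \<phi> v) \<in> carrier ?F" using s by (rule F.M.a_closed)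
    have "L (\<phi> (a \<odot>\<^bsub>P\<^esub> u \<oplus>\<^bsub>P\<^esub> b \<odot>\<^bsub>P\<^esub> v)) \<ominus> L ((a \<odot>\<^bsub>?F\<^esub> \<phi> u) \<oplus>\<^bsub>?F\<^esub> (b \<odot>\<^bsub>?F\<^esub> \<phi> v)) = \<zero>"
      using L0[OF rel] unfolding linearity_defect_def
        linear_functional_minus[OF modP F.module_axioms L z(1) k] .
    then have "L (\<phi> (a \<odot>\<^bsub>P\<^esub> u \<oplus>\<^bsub>P\<^esub> b \<odot>\<^bsub>P\<^esub> v)) = L ((a \<odot>\<^bsub>?F\<^esub> \<phi> u) \<oplus>\<^bsub>?F\<^esub> (b \<odot>\<^bsub>?F\<^esub> \<phi> v))"
      by (rule R.eq_if_minus_zero[OF Lc[OF z(1)] Lc[OF k]])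
    then show ?thesis using La[OF s] Ls[OF _ z(2)] Ls[OF _ z(3)] that by simp
  qed
  note gen = triple_gen_closed[OF modP]
  note rel = subsetD[OF wedge_relations_subset[OF modP]]
  have r1: "linearity_defect S P ?F (\<lambda>z. triple_gen S z x y) a b u v \<in> ?N"
    if "a \<in> carrier S" "b \<in> carrier S" "u \<in> carrier P" "v \<in> carrier P" "x \<in> carrier P" "y \<in> carrier P"
    for a b u v x y
    by (rule rel, unfold wedge_relations_def, rule UnI1, rule UnI1, rule UnI1, use that in blast)
  have r2: "linearity_defect S P ?F (\<lambda>z. triple_gen S x z y) a b u v \<in> ?N"
    if "a \<in> carrier S" "b \<in> carrier S" "u \<in> carrier P" "v \<in> carrier P" "x \<in> carrier P" "y \<in> carrier P"
    for a b u v x y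
    by (rule rel, unfold wedge_relations_def, use that in blast)
  have r3: "linearity_defect S P ?F (\<lambda>z. triple_gen S x y z) a b u v \<in> ?N"
    if "a \<in> carrier S" "b \<in> carrier S" "u \<in> carrier P" "v \<in> carrier P" "x \<in> carrier P" "y \<in> carrier P"
    for a b u v x y
    by (rule rel, unfold wedge_relations_def, use that in blast)
  have r4: "triple_gen S u v w \<in> ?N"
    if "u \<in> carrier P" "v \<in> carrier P" "w \<in> carrier P" "u = v \<or> v = w \<or> u = w" for u v w
    by (rule rel, unfold wedge_relations_def, use that in blast)
  have "alternating_trilinear S P (\<lambda>u v w. L (triple_gen S u v w))"
    unfolding alternating_trilinear_def
    using lin[OF _ _ _ _ gen r1] lin[OF _ _ _ _ gen r2] lin[OF _ _ _ _ gen r3] Lc[OF gen]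
      L0[OF r4]
    by auto
  then show ?thesis unfolding L_def wedge3_def .
qed

text \<open>Every coset is a finite combination of wedges, so a functional with values in \<open>I\<close> on the wedges
  has all its values in \<open>I\<close>.\<close>

lemma exterior_cube_generated:
  assumes \<alpha>: "linear_map S (exterior_cube S P) (regular_module S) \<alpha>"
    and onto: "\<alpha> ` carrier (exterior_cube S P) = carrier S"
    and I: "ideal I S"
    and gen: "\<And>u v w. u \<in> carrier P \<Longrightarrow> v \<in> carrier P \<Longrightarrow> w \<in> carrier P \<Longrightarrow> \<alpha> (wedge3 S P u v w) \<in> I"
  shows "I = carrier S"
proof -
  let ?F = "free_triples S P" and ?N = "wedge_submodule S P"
  interpret I: ideal I S by fact
  define L where "L = (\<lambda>f. \<alpha> (?N +>\<^bsub>?F\<^esub> f))"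
  have L: "linear_map S ?F (regular_module S) L"
    unfolding L_def by (rule exterior_cube_functional[OF \<alpha>])
  have La: "L (f \<oplus>\<^bsub>?F\<^esub> g) = L f \<oplus> L g" if "f \<in> carrier ?F" "g \<in> carrier ?F" for f g
    using L that unfolding linear_map_def regular_module_def by simp
  have Ls: "L (a \<odot>\<^bsub>?F\<^esub> f) = a \<otimes> L f" if "a \<in> carrier S" "f \<in> carrier ?F" for a f
    using L that unfolding linear_map_def regular_module_def by simp
  have inI: "L f \<in> I" if "finite A" "f \<in> carrier ?F" "{t. f t \<noteq> \<zero>} \<subseteq> A" for A f
    using that
  proof (induction A arbitrary: f)
    case empty
    then have "f = \<zero>\<^bsub>?F\<^esub>" by auto
    then show ?case using linear_functional_zero[OF modP F.module_axioms L] by simp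
  next
    case (insert t A)
    note fc = insert.prems(1)[unfolded free_triples_carrier]
    define g where "g = f(t := \<zero>)"
    have sub: "{s. g s \<noteq> \<zero>} \<subseteq> {s. f s \<noteq> \<zero>}" by (auto simp: g_def)
    then have "finite {s. g s \<noteq> \<zero>}" using fc by (metis (no_types) finite_subset)
    moreover have "\<forall>s. g s \<in> carrier S" using fc by (simp add: g_def)
    ultimately have gc: "g \<in> carrier ?F"
      using fc order_trans[OF sub] unfolding free_triples_carrier by blast
    have gA: "{s. g s \<noteq> \<zero>} \<subseteq> A" using insert.prems(2) by (auto simp: g_def)
    note Lg = insert.IH[OF gc gA]
    show ?case
    proof (cases "f t = \<zero>")
      case True
      then have "f = g" by (auto simp: g_def)
      then show ?thesis using Lg by simp
    next
      case False
      obtain u v w where t: "t = (u, v, w)" by (cases t)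
      have uvw: "u \<in> carrier P" "v \<in> carrier P" "w \<in> carrier P" using fc False t by auto
      have ft: "f t \<in> carrier S" using fc by blast
      note gen_t = triple_gen_closed[OF modP uvw]
      have "f = g \<oplus>\<^bsub>?F\<^esub> (f t \<odot>\<^bsub>?F\<^esub> triple_gen S u v w)"
        using fc by (auto simp: g_def triple_gen_def t)
      then have "L f = L g \<oplus> f t \<otimes> L (triple_gen S u v w)"
        using La[OF gc F.smult_closed[OF ft gen_t]] Ls[OF ft gen_t] by metis
      moreover have "L (triple_gen S u v w) \<in> I" using gen[OF uvw] unfolding L_def wedge3_def .
      ultimately show ?thesis using Lg I.I_l_closed[OF _ ft] by simp
    qed
  qed
  have "\<one> \<in> \<alpha> ` carrier (exterior_cube S P)" unfolding onto by simp
  then obtain X where "X \<in> a_rcosets\<^bsub>?F\<^esub> ?N" and X1: "\<alpha> X = \<one>"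
    by (auto simp: exterior_cube_def Let_def)
  then obtain f where f: "f \<in> carrier ?F" and X: "X = ?N +>\<^bsub>?F\<^esub> f"
    unfolding A_RCOSETS_def' by blast
  have "L f \<in> I" by (rule inI[OF _ f subset_refl]) (use f in \<open>simp add: free_triples_carrier\<close>)
  then have "\<one> \<in> I" using X1 unfolding L_def X by simp
  then show ?thesis by (rule I.one_imp_carrier)
qed

end

section \<open>Hermitian modules with a volume form\<close>

text \<open>That \<open>cnj\<close> is an involutive ring automorphism is deduced below from the properties of \<open>h\<close>.\<close>

locale hermitian_module = S: cring S + module S P
  for S :: "('s, 'd) ring_scheme" (structure) and P :: "('s, 'p, 'e) module_scheme" +
  fixes cnj :: "'s \<Rightarrow> 's" and h :: "'p \<Rightarrow> 'p \<Rightarrow> 's"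
  assumes cnj_closed [simp]: "a \<in> carrier S \<Longrightarrow> cnj a \<in> carrier S"
    and cnj_add: "a \<in> carrier S \<Longrightarrow> b \<in> carrier S \<Longrightarrow> cnj (a \<oplus> b) = cnj a \<oplus> cnj b"
    and h_closed [simp]: "u \<in> carrier P \<Longrightarrow> v \<in> carrier P \<Longrightarrow> h u v \<in> carrier S"
    and h_add_left: "u \<in> carrier P \<Longrightarrow> u' \<in> carrier P \<Longrightarrow> v \<in> carrier P \<Longrightarrow>
       h (u \<oplus>\<^bsub>P\<^esub> u') v = h u v \<oplus> h u' v"
    and h_add_right: "u \<in> carrier P \<Longrightarrow> u' \<in> carrier P \<Longrightarrow> v \<in> carrier P \<Longrightarrow>
       h v (u \<oplus>\<^bsub>P\<^esub> u') = h v u \<oplus> h v u'"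
    and h_smult_left: "a \<in> carrier S \<Longrightarrow> u \<in> carrier P \<Longrightarrow> v \<in> carrier P \<Longrightarrow>
       h (a \<odot>\<^bsub>P\<^esub> u) v = a \<otimes> h u v"
    and h_smult_right: "a \<in> carrier S \<Longrightarrow> u \<in> carrier P \<Longrightarrow> v \<in> carrier P \<Longrightarrow>
       h u (a \<odot>\<^bsub>P\<^esub> v) = h u v \<otimes> cnj a"
    and cnj_h [simp]: "u \<in> carrier P \<Longrightarrow> v \<in> carrier P \<Longrightarrow> cnj (h u v) = h v u"
    and h_nondegenerate: "w \<in> carrier P \<Longrightarrow> (\<And>u. u \<in> carrier P \<Longrightarrow> h u w = \<zero>) \<Longrightarrow> w = \<zero>\<^bsub>P\<^esub>"

text \<open>The volume form is \<open>\<alpha>\<close> on wedges, and \<open>vol_unimodular\<close> says that its values generate the unit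
  ideal.\<close>

locale volume_hermitian = hermitian_module S P cnj h
  for S :: "('s, 'd) ring_scheme" (structure) and P :: "('s, 'p, 'e) module_scheme"
    and cnj :: "'s \<Rightarrow> 's" and h :: "'p \<Rightarrow> 'p \<Rightarrow> 's" +
  fixes vol :: "'p \<Rightarrow> 'p \<Rightarrow> 'p \<Rightarrow> 's" and cr :: "'p \<Rightarrow> 'p \<Rightarrow> 'p" (infixl \<open>\<times>\<^sub>P\<close> 70)
  assumes vol_alternating: "alternating_trilinear S P vol"
    and vol_unimodular: "ideal I S \<Longrightarrow>
      (\<And>u v w. u \<in> carrier P \<Longrightarrow> v \<in> carrier P \<Longrightarrow> w \<in> carrier P \<Longrightarrow> vol u v w \<in> I) \<Longrightarrow> I = carrier S"
    and cross_closed [simp]: "v \<in> carrier P \<Longrightarrow> w \<in> carrier P \<Longrightarrow> v \<times>\<^sub>P w \<in> carrier P"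
    and h_cross: "u \<in> carrier P \<Longrightarrow> v \<in> carrier P \<Longrightarrow> w \<in> carrier P \<Longrightarrow> h u (v \<times>\<^sub>P w) = vol u v w"
begin

lemma vol_closed [simp]:
  "u \<in> carrier P \<Longrightarrow> v \<in> carrier P \<Longrightarrow> w \<in> carrier P \<Longrightarrow> vol u v w \<in> carrier S"
  using vol_alternating unfolding alternating_trilinear_def by blast

lemma vol_repeat [simp]:
  assumes "u \<in> carrier P" "v \<in> carrier P"
  shows "vol u u v = \<zero>" "vol v u u = \<zero>" "vol u v u = \<zero>"
  using vol_alternating assms unfolding alternating_trilinear_def by auto

lemma vol_combination:
  assumes "a \<in> carrier S" "b \<in> carrier S" "u \<in> carrier P" "v \<in> carrier P" "x \<in> carrier P" "y \<in> carrier P"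
  shows "vol (a \<odot>\<^bsub>P\<^esub> u \<oplus>\<^bsub>P\<^esub> b \<odot>\<^bsub>P\<^esub> v) x y = a \<otimes> vol u x y \<oplus> b \<otimes> vol v x y"
    "vol x (a \<odot>\<^bsub>P\<^esub> u \<oplus>\<^bsub>P\<^esub> b \<odot>\<^bsub>P\<^esub> v) y = a \<otimes> vol x u y \<oplus> b \<otimes> vol x v y"
    "vol x y (a \<odot>\<^bsub>P\<^esub> u \<oplus>\<^bsub>P\<^esub> b \<odot>\<^bsub>P\<^esub> v) = a \<otimes> vol x y u \<oplus> b \<otimes> vol x y v"
  using vol_alternating assms unfolding alternating_trilinear_def by auto

lemma vol_add:
  assumes "u \<in> carrier P" "v \<in> carrier P" "x \<in> carrier P" "y \<in> carrier P"
  shows "vol (u \<oplus>\<^bsub>P\<^esub> v) x y = vol u x y \<oplus> vol v x y"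
    "vol x (u \<oplus>\<^bsub>P\<^esub> v) y = vol x u y \<oplus> vol x v y"
    "vol x y (u \<oplus>\<^bsub>P\<^esub> v) = vol x y u \<oplus> vol x y v"
  using vol_combination[of "\<one>" "\<one>" u v x y] assms by simp_all

lemma vol_smult:
  assumes "a \<in> carrier S" "u \<in> carrier P" "x \<in> carrier P" "y \<in> carrier P"
  shows "vol (a \<odot>\<^bsub>P\<^esub> u) x y = a \<otimes> vol u x y"
    "vol x (a \<odot>\<^bsub>P\<^esub> u) y = a \<otimes> vol x u y"
    "vol x y (a \<odot>\<^bsub>P\<^esub> u) = a \<otimes> vol x y u"
  using vol_combination[of a "\<zero>" u u x y] assms by simp_all

lemma vol_swap:
  assumes "u \<in> carrier P" "v \<in> carrier P" "w \<in> carrier P"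
  shows "vol v u w = \<ominus> vol u v w" "vol u w v = \<ominus> vol u v w" "vol w v u = \<ominus> vol u v w"
proof -
  have "vol v u w \<oplus> vol u v w = vol (u \<oplus>\<^bsub>P\<^esub> v) (u \<oplus>\<^bsub>P\<^esub> v) w"
    using assms by (simp only: vol_add M.a_closed) (simp add: S.a_comm)
  then show "vol v u w = \<ominus> vol u v w" using assms by (simp add: S.minus_equality)
  have "vol u w v \<oplus> vol u v w = vol u (v \<oplus>\<^bsub>P\<^esub> w) (v \<oplus>\<^bsub>P\<^esub> w)"
    using assms by (simp only: vol_add M.a_closed) (simp add: S.a_comm)
  then show "vol u w v = \<ominus> vol u v w" using assms by (simp add: S.minus_equality)
  have "vol w v u \<oplus> vol u v w = vol (u \<oplus>\<^bsub>P\<^esub> w) v (u \<oplus>\<^bsub>P\<^esub> w)"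
    using assms by (simp only: vol_add M.a_closed) (simp add: S.a_comm)
  then show "vol w v u = \<ominus> vol u v w" using assms by (simp add: S.minus_equality)
qed

lemma vol_rotate:
  assumes "u \<in> carrier P" "v \<in> carrier P" "w \<in> carrier P"
  shows "vol v w u = vol u v w" "vol w u v = vol u v w"
  using assms vol_swap(1)[of u v w] vol_swap(2)[of v u w] vol_swap(2)[of u v w] vol_swap(1)[of u w v]
  by simp_all

text \<open>The scalars \<open>r\<close> all of whose multiples lie in \<open>A\<close> form an ideal, and this ideal contains
  \<open>vol u v w = h u (v \<times> w)\<close>.\<close>

lemma hermitian_values_span:
  assumes "A \<subseteq> carrier S" "\<zero> \<in> A" and add: "\<And>a b. a \<in> A \<Longrightarrow> b \<in> A \<Longrightarrow> a \<oplus> b \<in> A"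
    and h: "\<And>u v. u \<in> carrier P \<Longrightarrow> v \<in> carrier P \<Longrightarrow> h u v \<in> A"
  shows "A = carrier S"
proof -
  let ?I = "{r \<in> carrier S. \<forall>s\<in>carrier S. s \<otimes> r \<in> A}"
  have "ideal ?I S"
  proof (rule S.ideal_if_closed)
    fix x a assume "x \<in> carrier S" "a \<in> ?I"
    then show "x \<otimes> a \<in> ?I" by (auto simp: S.m_assoc[symmetric])
  qed (use assms in \<open>auto simp: S.r_distr\<close>)
  then have "?I = carrier S"
  proof (rule vol_unimodular)
    fix u v w assume "u \<in> carrier P" "v \<in> carrier P" "w \<in> carrier P"
    moreover from this have "s \<otimes> vol u v w \<in> A" if "s \<in> carrier S" for s
      using h[of "s \<odot>\<^bsub>P\<^esub> u" "v \<times>\<^sub>P w"] that by (simp add: vol_smult h_cross)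
    ultimately show "vol u v w \<in> ?I" by simp
  qed
  then have "carrier S \<subseteq> A"
    using S.one_closed S.l_one by (metis (no_types, lifting) mem_Collect_eq subsetI)
  then show ?thesis using assms(1) by blast
qed

lemma cnj_zero [simp]: "cnj \<zero> = \<zero>"
  using cnj_add[of "\<zero>" "\<zero>"] by (simp add: S.add.l_cancel_one')

lemma cnj_minus: "a \<in> carrier S \<Longrightarrow> cnj (\<ominus> a) = \<ominus> cnj a"
  by (rule S.minus_equality[symmetric]) (simp_all add: cnj_add[symmetric] S.l_neg)

lemma cnj_cnj [simp]: "a \<in> carrier S \<Longrightarrow> cnj (cnj a) = a"
  using hermitian_values_span[of "{a \<in> carrier S. cnj (cnj a) = a}"] by (auto simp: cnj_add)

text \<open>On a value \<open>b = h u v\<close>, both sides are \<open>h v (a u)\<close>; such values span.\<close>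

lemma cnj_mult:
  assumes a: "a \<in> carrier S" and b: "b \<in> carrier S"
  shows "cnj (a \<otimes> b) = cnj a \<otimes> cnj b"
proof -
  have "{b \<in> carrier S. cnj (a \<otimes> b) = cnj a \<otimes> cnj b} = carrier S"
  proof (rule hermitian_values_span)
    fix u v assume uv: "u \<in> carrier P" "v \<in> carrier P"
    have "cnj (a \<otimes> h u v) = cnj (h (a \<odot>\<^bsub>P\<^esub> u) v)" using a uv by (simp add: h_smult_left)
    also have "\<dots> = h v (a \<odot>\<^bsub>P\<^esub> u)" using a uv by (intro cnj_h) auto
    also have "\<dots> = cnj a \<otimes> cnj (h u v)" using a uv by (simp add: h_smult_right S.m_comm)
    finally show "h u v \<in> {b \<in> carrier S. cnj (a \<otimes> b) = cnj a \<otimes> cnj b}" using uv by simp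
  qed (use a in \<open>auto simp: cnj_add S.r_distr\<close>)
  then show ?thesis using b by blast
qed

lemma cnj_finsum:
  assumes "finite A" "\<And>i. i \<in> A \<Longrightarrow> f i \<in> carrier S"
  shows "cnj (\<Oplus>i\<in>A. f i) = (\<Oplus>i\<in>A. cnj (f i))"
  using assms by (induction A) (auto simp: cnj_add Pi_iff)

definition minor :: "'p \<Rightarrow> 'p \<Rightarrow> 'p \<Rightarrow> 'p \<Rightarrow> 's"
  where "minor u v x y = h u x \<otimes> h v y \<ominus> h u y \<otimes> h v x"

definition gram :: "'p \<Rightarrow> 'p \<Rightarrow> 'p \<Rightarrow> 'p \<Rightarrow> 'p \<Rightarrow> 'p \<Rightarrow> 's"
  where "gram u v w x y z = gram_det3 S h (u, v, w) (x, y, z)"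

lemma minor_closed [simp]:
  "u \<in> carrier P \<Longrightarrow> v \<in> carrier P \<Longrightarrow> x \<in> carrier P \<Longrightarrow> y \<in> carrier P \<Longrightarrow> minor u v x y \<in> carrier S"
  by (simp add: minor_def)

lemma gram_expand_row:
  assumes "u \<in> carrier P" "v \<in> carrier P" "w \<in> carrier P" "x \<in> carrier P" "y \<in> carrier P" "z \<in> carrier P"
  shows "gram u v w x y z = h u x \<otimes> minor v w y z \<oplus> h u y \<otimes> minor v w z x \<oplus> h u z \<otimes> minor v w x y"
  unfolding gram_def gram_det3_def minor_def using assms by (simp add: S.ring_normalize)

lemma gram_expand_column:
  assumes "u \<in> carrier P" "v \<in> carrier P" "w \<in> carrier P" "x \<in> carrier P" "y \<in> carrier P" "z \<in> carrier P"
  shows "gram u v w x y z = h u x \<otimes> minor v w y z \<ominus> h v x \<otimes> minor u w y z \<oplus> h w x \<otimes> minor u v y z"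
  unfolding gram_def gram_det3_def minor_def using assms by (simp add: S.ring_normalize)

lemma gram_cnj:
  assumes "u \<in> carrier P" "v \<in> carrier P" "w \<in> carrier P" "x \<in> carrier P" "y \<in> carrier P" "z \<in> carrier P"
  shows "cnj (gram u v w x y z) = gram x y z u v w"
  unfolding gram_def gram_det3_def
  using assms by (simp add: S.ring_normalize cnj_add cnj_mult cnj_minus)

lemma gram_alternating:
  assumes "x \<in> carrier P" "y \<in> carrier P" "z \<in> carrier P"
  shows "alternating_trilinear S P (\<lambda>u v w. gram u v w x y z)"
  unfolding alternating_trilinear_def gram_def gram_det3_def
  using assms
  by (intro conjI ballI) (simp_all add: S.ring_normalize h_add_left h_smult_left S.r_neg1 S.r_neg2 S.r_neg S.l_neg)

text \<open>The form on the exterior cube is defined through representatives.  Rewriting its double sum as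
  one linear functional inside another, each given by an alternating form, shows that it depends only
  on the two wedges.\<close>

lemma exterior_cube_form_wedge:
  assumes u: "u1 \<in> carrier P" "u2 \<in> carrier P" "u3 \<in> carrier P"
    and v: "v1 \<in> carrier P" "v2 \<in> carrier P" "v3 \<in> carrier P"
  shows "exterior_cube_form S cnj h (wedge3 S P u1 u2 u3) (wedge3 S P v1 v2 v3)
    = gram u1 u2 u3 v1 v2 v3"
proof -
  let ?F = "free_triples S P" and ?N = "wedge_submodule S P"
  let ?T = "carrier P \<times> carrier P \<times> carrier P"
  let ?form = "\<lambda>f g. \<Oplus>s\<in>{s. f s \<noteq> \<zero>}. \<Oplus>t\<in>{t. g t \<noteq> \<zero>}.
         (f s \<otimes> cnj (g t)) \<otimes> gram_det3 S h s t"
  have self: "module S P" by (rule module_axioms)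
  interpret F: module S ?F by (rule free_triples_module[OF self])
  have NF: "?N \<subseteq> carrier ?F" using F.submoduleE(1)[OF wedge_submodule[OF self]] .
  have gc: "gram_det3 S h s t \<in> carrier S" if "s \<in> ?T" "t \<in> ?T" for s t
    using that unfolding gram_det3_def by auto
  have ext: "extend_linearly S c f = c w1 w2 w3"
    if c: "alternating_trilinear S P c" and f: "f \<in> wedge3 S P w1 w2 w3"
      and w: "w1 \<in> carrier P" "w2 \<in> carrier P" "w3 \<in> carrier P" for c f w1 w2 w3
  proof -
    have cc: "\<And>u v w. u \<in> carrier P \<Longrightarrow> v \<in> carrier P \<Longrightarrow> w \<in> carrier P \<Longrightarrow> c u v w \<in> carrier S"
      using c unfolding alternating_trilinear_def by blast
    obtain k where k: "k \<in> ?N" and f: "f = k \<oplus>\<^bsub>?F\<^esub> triple_gen S w1 w2 w3"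
      using f unfolding wedge3_def a_r_coset_def' by blast
    have "extend_linearly S c f = extend_linearly S c k \<oplus> extend_linearly S c (triple_gen S w1 w2 w3)"
      unfolding f using extend_linearly_linear[OF self cc] k NF triple_gen_closed[OF self w]
      unfolding linear_map_def regular_module_def by (simp add: subset_iff)
    then show ?thesis
      using extend_linearly_wedge_submodule[OF self c k] extend_linearly_gen[OF self cc w] cc[OF w]
      by simp
  qed
  have carF: "f \<in> carrier ?F" if "f \<in> wedge3 S P w1 w2 w3"
      and w: "w1 \<in> carrier P" "w2 \<in> carrier P" "w3 \<in> carrier P" for f w1 w2 w3
    using that(1) NF triple_gen_closed[OF self w] F.M.a_closed
    unfolding wedge3_def a_r_coset_def' by blast
  have main: "?form f g = gram u1 u2 u3 v1 v2 v3"
    if f: "f \<in> wedge3 S P u1 u2 u3" and g: "g \<in> wedge3 S P v1 v2 v3" for f g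
  proof -
    have fF: "finite {t. f t \<noteq> \<zero>}" "\<And>t. f t \<in> carrier S" "{t. f t \<noteq> \<zero>} \<subseteq> ?T"
      using carF[OF f u] unfolding free_triples_carrier by auto
    have gF: "finite {t. g t \<noteq> \<zero>}" "\<And>t. g t \<in> carrier S" "{t. g t \<noteq> \<zero>} \<subseteq> ?T"
      using carF[OF g v] unfolding free_triples_carrier by auto
    \<comment> \<open>Conjugation turns the sum over \<open>g\<close> into a linear functional evaluated at \<open>g\<close>.\<close>
    have inner: "(\<Oplus>t\<in>{t. g t \<noteq> \<zero>}. cnj (g t) \<otimes> gram_det3 S h (s1, s2, s3) t)
        = gram s1 s2 s3 v1 v2 v3"
      if s: "s1 \<in> carrier P" "s2 \<in> carrier P" "s3 \<in> carrier P" for s1 s2 s3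
    proof -
      have "gram s1 s2 s3 v1 v2 v3 = cnj (extend_linearly S (\<lambda>u v w. gram u v w s1 s2 s3) g)"
        using ext[OF gram_alternating[OF s] g v] gram_cnj[OF v s] by simp
      also have "\<dots> = (\<Oplus>t\<in>{t. g t \<noteq> \<zero>}.
          cnj (g t \<otimes> (case t of (u, v, w) \<Rightarrow> gram u v w s1 s2 s3)))"
        unfolding extend_linearly_def
        by (rule cnj_finsum) (use gF s gc in \<open>auto simp: gram_def\<close>)
      also have "\<dots> = (\<Oplus>t\<in>{t. g t \<noteq> \<zero>}. cnj (g t) \<otimes> gram_det3 S h (s1, s2, s3) t)"
      proof (rule S.finsum_cong')
        show "(\<lambda>t. cnj (g t) \<otimes> gram_det3 S h (s1, s2, s3) t) \<in> {t. g t \<noteq> \<zero>} \<rightarrow> carrier S"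
          using gF s gc by auto
      next
        fix t assume "t \<in> {t. g t \<noteq> \<zero>}"
        then obtain t1 t2 t3 where t: "t = (t1, t2, t3)" "t1 \<in> carrier P" "t2 \<in> carrier P" "t3 \<in> carrier P"
          using gF(3) by blast
        then show "cnj (g t \<otimes> (case t of (u, v, w) \<Rightarrow> gram u v w s1 s2 s3))
            = cnj (g t) \<otimes> gram_det3 S h (s1, s2, s3) t"
          using gF(2) s gc[of t "(s1, s2, s3)"] gram_cnj[of t1 t2 t3 s1 s2 s3]
          by (simp add: cnj_mult gram_def)
      qed simp
      finally show ?thesis by simp
    qed
    have "?form f g = (\<Oplus>s\<in>{s. f s \<noteq> \<zero>}. f s \<otimes> (case s of (u, v, w) \<Rightarrow> gram u v w v1 v2 v3))"
    proof (rule S.finsum_cong')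
      show "(\<lambda>s. f s \<otimes> (case s of (u, v, w) \<Rightarrow> gram u v w v1 v2 v3)) \<in> {s. f s \<noteq> \<zero>} \<rightarrow> carrier S"
        using fF v gc by (auto simp: gram_def)
    next
      fix s assume "s \<in> {s. f s \<noteq> \<zero>}"
      then obtain s1 s2 s3 where s: "s = (s1, s2, s3)" "s1 \<in> carrier P" "s2 \<in> carrier P" "s3 \<in> carrier P"
        using fF(3) by blast
      have gct: "gram_det3 S h s t \<in> carrier S" if "g t \<noteq> \<zero>" for t
        using that s gc gF(3) by blast
      have "(\<Oplus>t\<in>{t. g t \<noteq> \<zero>}. (f s \<otimes> cnj (g t)) \<otimes> gram_det3 S h s t)
          = (\<Oplus>t\<in>{t. g t \<noteq> \<zero>}. f s \<otimes> (cnj (g t) \<otimes> gram_det3 S h s t))"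
        by (rule S.finsum_cong') (use fF gF gct in \<open>auto simp: S.m_assoc\<close>)
      also have "\<dots> = f s \<otimes> (\<Oplus>t\<in>{t. g t \<noteq> \<zero>}. cnj (g t) \<otimes> gram_det3 S h s t)"
        by (rule S.finsum_rdistr[symmetric]) (use fF gF gct in auto)
      finally show "(\<Oplus>t\<in>{t. g t \<noteq> \<zero>}. (f s \<otimes> cnj (g t)) \<otimes> gram_det3 S h s t)
          = f s \<otimes> (case s of (u, v, w) \<Rightarrow> gram u v w v1 v2 v3)"
        using inner[OF s(2-4)] by (simp add: s(1))
    qed simp
    also have "\<dots> = gram u1 u2 u3 v1 v2 v3"
      using ext[OF gram_alternating[OF v] f u] unfolding extend_linearly_def .
    finally show ?thesis .
  qed
  have ne: "triple_gen S w1 w2 w3 \<in> wedge3 S P w1 w2 w3"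
    if w: "w1 \<in> carrier P" "w2 \<in> carrier P" "w3 \<in> carrier P" for w1 w2 w3
    unfolding wedge3_def
    by (rule abelian_subgroup.a_rcos_self[OF wedge_abelian_subgroup[OF self] triple_gen_closed[OF self w]])
  show ?thesis
    unfolding exterior_cube_form_def
  proof (rule the_equality)
    show "\<exists>f\<in>wedge3 S P u1 u2 u3. \<exists>g\<in>wedge3 S P v1 v2 v3. gram u1 u2 u3 v1 v2 v3 = ?form f g"
      by (intro bexI[OF _ ne[OF u]] bexI[OF _ ne[OF v]]) (rule main[OF ne[OF u] ne[OF v], symmetric])
  next
    fix c assume "\<exists>f\<in>wedge3 S P u1 u2 u3. \<exists>g\<in>wedge3 S P v1 v2 v3. c = ?form f g"
    then show "c = gram u1 u2 u3 v1 v2 v3" using main by blast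
  qed
qed

end

context volume_hermitian
begin

text \<open>A prime ideal that contains a power of each \<open>vol u v w\<close> contains each \<open>vol u v w\<close>.\<close>

lemma unimodular_power:
  assumes I: "ideal I S"
    and pow: "\<And>u v w. u \<in> carrier P \<Longrightarrow> v \<in> carrier P \<Longrightarrow> w \<in> carrier P \<Longrightarrow>
      vol u v w [^] (k::nat) \<in> I"
  shows "I = carrier S"
proof (rule ccontr)
  assume "I \<noteq> carrier S"
  then have "\<one> \<notin> I" using ideal.one_imp_carrier[OF I] by blast
  then obtain p where p: "primeideal p S" and Ip: "I \<subseteq> p" using S.prime_ideal_above[OF I] by blast
  interpret p: primeideal p S by fact
  have root: "x \<in> p" if "x \<in> carrier S" "x [^] (j::nat) \<in> p" for x j
    using that(2)
  proof (induction j)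
    case 0
    then show ?case using p.one_imp_carrier that(1) by simp
  next
    case (Suc j)
    then show ?case using p.I_prime[of "x [^] j" x] that(1) by auto
  qed
  have "p = carrier S"
  proof (rule vol_unimodular[OF p.is_ideal])
    fix u v w assume uvw: "u \<in> carrier P" "v \<in> carrier P" "w \<in> carrier P"
    show "vol u v w \<in> p" by (rule root[OF vol_closed[OF uvw] subsetD[OF Ip pow[OF uvw]]])
  qed
  then show False using p.I_notcarr by simp
qed

lemma vol_power_faithful:
  assumes m: "m \<in> carrier S"
    and 0: "\<And>u v w. u \<in> carrier P \<Longrightarrow> v \<in> carrier P \<Longrightarrow> w \<in> carrier P \<Longrightarrow>
      vol u v w [^] (k::nat) \<otimes> m = \<zero>"
  shows "m = \<zero>"
proof -
  let ?I = "{r \<in> carrier S. r \<otimes> m = \<zero>}"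
  have "ideal ?I S"
    by (rule S.ideal_if_closed) (use m in \<open>auto simp: S.l_distr S.m_assoc\<close>)
  then have "?I = carrier S" by (rule unimodular_power[of _ k]) (use 0 in simp)
  then have "\<one> \<in> ?I" by simp
  then show ?thesis using m by simp
qed

lemma vol_faithful:
  assumes "m \<in> carrier S"
    and "\<And>u v w. u \<in> carrier P \<Longrightarrow> v \<in> carrier P \<Longrightarrow> w \<in> carrier P \<Longrightarrow> vol u v w \<otimes> m = \<zero>"
  shows "m = \<zero>"
  using vol_power_faithful[of m 1] assms by simp

lemma h_minus_left: "u \<in> carrier P \<Longrightarrow> v \<in> carrier P \<Longrightarrow> h (\<ominus>\<^bsub>P\<^esub> u) v = \<ominus> h u v"
  using h_smult_left[of "\<ominus> \<one>" u v] by (simp add: smult_l_minus S.l_minus)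

lemma h_minus_right: "u \<in> carrier P \<Longrightarrow> v \<in> carrier P \<Longrightarrow> h u (\<ominus>\<^bsub>P\<^esub> v) = \<ominus> h u v"
  using cnj_h[of "\<ominus>\<^bsub>P\<^esub> v" u] by (simp add: h_minus_left cnj_minus)

lemma h_zero_left [simp]: "v \<in> carrier P \<Longrightarrow> h \<zero>\<^bsub>P\<^esub> v = \<zero>"
  using h_smult_left[of "\<zero>" "\<zero>\<^bsub>P\<^esub>" v] by simp

lemma h_zero_right [simp]: "v \<in> carrier P \<Longrightarrow> h v \<zero>\<^bsub>P\<^esub> = \<zero>"
  using h_smult_right[of "\<zero>" v "\<zero>\<^bsub>P\<^esub>"] by simp

lemma eq_if_h_eq:
  assumes "v \<in> carrier P" "w \<in> carrier P" and eq: "\<And>u. u \<in> carrier P \<Longrightarrow> h u v = h u w"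
  shows "v = w"
proof -
  have "v \<ominus>\<^bsub>P\<^esub> w = \<zero>\<^bsub>P\<^esub>"
    by (rule h_nondegenerate)
      (use assms in \<open>simp_all add: M.minus_eq h_add_right h_minus_right S.r_neg\<close>)
  then show ?thesis using assms M.eq_if_minus_zero by blast
qed

lemma h_zero_imp_zero:
  assumes "w \<in> carrier P" and 0: "\<And>u. u \<in> carrier P \<Longrightarrow> h w u = \<zero>"
  shows "w = \<zero>\<^bsub>P\<^esub>"
  by (rule h_nondegenerate) (use assms cnj_h[of w] in force)+

lemma vol_minus:
  assumes "u \<in> carrier P" "v \<in> carrier P" "w \<in> carrier P"
  shows "vol (\<ominus>\<^bsub>P\<^esub> u) v w = \<ominus> vol u v w" "vol v (\<ominus>\<^bsub>P\<^esub> u) w = \<ominus> vol v u w"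
    "vol v w (\<ominus>\<^bsub>P\<^esub> u) = \<ominus> vol v w u"
  using vol_smult[of "\<ominus> \<one>" u v w] assms by (simp_all add: smult_l_minus S.l_minus)

lemmas vol_simps = vol_add vol_smult vol_minus

lemma smult_faithful:
  assumes l: "l \<in> carrier S" and 0: "\<And>u. u \<in> carrier P \<Longrightarrow> l \<odot>\<^bsub>P\<^esub> u = \<zero>\<^bsub>P\<^esub>"
  shows "l = \<zero>"
proof (rule vol_faithful[OF l])
  fix u v w assume uvw: "u \<in> carrier P" "v \<in> carrier P" "w \<in> carrier P"
  have "l \<otimes> vol u v w = h (l \<odot>\<^bsub>P\<^esub> u) (v \<times>\<^sub>P w)" using l uvw by (simp add: vol_smult h_cross)
  also have "\<dots> = \<zero>" unfolding 0[OF uvw(1)] using uvw by simp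
  finally show "vol u v w \<otimes> l = \<zero>" using l uvw by (simp add: S.m_comm)
qed

lemma cross_add_left:
  assumes "u \<in> carrier P" "u' \<in> carrier P" "v \<in> carrier P"
  shows "(u \<oplus>\<^bsub>P\<^esub> u') \<times>\<^sub>P v = u \<times>\<^sub>P v \<oplus>\<^bsub>P\<^esub> u' \<times>\<^sub>P v"
  by (rule eq_if_h_eq) (use assms in \<open>simp_all add: h_cross h_add_right vol_add\<close>)

lemma cross_add_right:
  assumes "u \<in> carrier P" "u' \<in> carrier P" "v \<in> carrier P"
  shows "v \<times>\<^sub>P (u \<oplus>\<^bsub>P\<^esub> u') = v \<times>\<^sub>P u \<oplus>\<^bsub>P\<^esub> v \<times>\<^sub>P u'"
  by (rule eq_if_h_eq) (use assms in \<open>simp_all add: h_cross h_add_right vol_add\<close>)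

lemma cross_smult_left:
  assumes "a \<in> carrier S" "u \<in> carrier P" "v \<in> carrier P"
  shows "(a \<odot>\<^bsub>P\<^esub> u) \<times>\<^sub>P v = cnj a \<odot>\<^bsub>P\<^esub> (u \<times>\<^sub>P v)"
  by (rule eq_if_h_eq) (use assms in \<open>simp_all add: h_cross h_smult_right vol_smult S.m_comm\<close>)

lemma cross_smult_right:
  assumes "a \<in> carrier S" "u \<in> carrier P" "v \<in> carrier P"
  shows "u \<times>\<^sub>P (a \<odot>\<^bsub>P\<^esub> v) = cnj a \<odot>\<^bsub>P\<^esub> (u \<times>\<^sub>P v)"
  by (rule eq_if_h_eq) (use assms in \<open>simp_all add: h_cross h_smult_right vol_smult S.m_comm\<close>)

lemma cross_swap:
  assumes "u \<in> carrier P" "v \<in> carrier P"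
  shows "v \<times>\<^sub>P u = \<ominus>\<^bsub>P\<^esub> (u \<times>\<^sub>P v)"
proof (rule eq_if_h_eq)
  fix x assume "x \<in> carrier P"
  then show "h x (v \<times>\<^sub>P u) = h x (\<ominus>\<^bsub>P\<^esub> (u \<times>\<^sub>P v))"
    using assms vol_swap(2)[of x u v] by (simp add: h_cross h_minus_right)
qed (use assms in auto)

end

section \<open>Cross products in rank three\<close>

locale cross_product_space = volume_hermitian S P cnj h vol cr
  for S :: "('s, 'd) ring_scheme" (structure) and P :: "('s, 'p, 'e) module_scheme"
    and cnj :: "'s \<Rightarrow> 's" and h :: "'p \<Rightarrow> 'p \<Rightarrow> 's"
    and vol :: "'p \<Rightarrow> 'p \<Rightarrow> 'p \<Rightarrow> 's" and cr :: "'p \<Rightarrow> 'p \<Rightarrow> 'p" (infixl \<open>\<times>\<^sub>P\<close> 70) +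
  assumes vol_gram: "u \<in> carrier P \<Longrightarrow> v \<in> carrier P \<Longrightarrow> w \<in> carrier P \<Longrightarrow>
      x \<in> carrier P \<Longrightarrow> y \<in> carrier P \<Longrightarrow> z \<in> carrier P \<Longrightarrow>
      vol u v w \<otimes> cnj (vol x y z) = gram u v w x y z"
begin

text \<open>The difference \<open>p\<close> of the two sides without the outer factor \<open>s = vol a b c\<close> satisfies
  \<open>vol p b c = vol a p c = vol a b p = 0\<close>.  Then the Gram determinant of \<open>(p, b, c)\<close> with any triple
  vanishes; expanding it along its first column and inserting the result into the expansion of the
  Gram determinant of \<open>(a, b, c)\<close> shows that \<open>h p q\<close> times the latter is a combination of
  the Gram determinants of \<open>(a, p, c)\<close> and \<open>(a, p, b)\<close>, which vanish as well.  So \<open>s\<close> times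
  \<open>h p q\<close> is killed by all conjugated volumes, and \<open>s p = 0\<close> by nondegeneracy.\<close>

lemma cramer:
  assumes P: "a \<in> carrier P" "b \<in> carrier P" "c \<in> carrier P" "v \<in> carrier P"
  shows "vol a b c \<odot>\<^bsub>P\<^esub> (vol a b c \<odot>\<^bsub>P\<^esub> v) =
    vol a b c \<odot>\<^bsub>P\<^esub> (vol v b c \<odot>\<^bsub>P\<^esub> a \<oplus>\<^bsub>P\<^esub> vol a v c \<odot>\<^bsub>P\<^esub> b \<oplus>\<^bsub>P\<^esub> vol a b v \<odot>\<^bsub>P\<^esub> c)"
proof -
  let ?s = "vol a b c"
  define r where "r = vol v b c \<odot>\<^bsub>P\<^esub> a \<oplus>\<^bsub>P\<^esub> vol a v c \<odot>\<^bsub>P\<^esub> b \<oplus>\<^bsub>P\<^esub> vol a b v \<odot>\<^bsub>P\<^esub> c"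
  define p where "p = ?s \<odot>\<^bsub>P\<^esub> v \<ominus>\<^bsub>P\<^esub> r"
  have r: "r \<in> carrier P" using P by (simp add: r_def)
  have p: "p \<in> carrier P" using P r by (simp add: p_def)
  have "vol r b c = ?s \<otimes> vol v b c" "vol a r c = ?s \<otimes> vol a v c" "vol a b r = ?s \<otimes> vol a b v"
    unfolding r_def using P by (simp_all add: vol_simps S.m_comm)
  then have p0: "vol p b c = \<zero>" "vol a p c = \<zero>" "vol a b p = \<zero>"
    unfolding p_def using P r by (simp_all add: M.minus_eq vol_simps S.r_neg)
  have "?s \<odot>\<^bsub>P\<^esub> p = \<zero>\<^bsub>P\<^esub>"
  proof (rule h_zero_imp_zero)
    fix q assume q: "q \<in> carrier P"
    have step: "h p q \<otimes> minor b c x y = h b q \<otimes> minor p c x y \<ominus> h c q \<otimes> minor p b x y"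
      if xy: "x \<in> carrier P" "y \<in> carrier P" for x y
    proof (rule S.eq_if_minus_zero)
      have "\<zero> = gram p b c q x y" using vol_gram[of p b c q x y] p0 p q P xy by simp
      also have "\<dots> = h p q \<otimes> minor b c x y \<ominus>
          (h b q \<otimes> minor p c x y \<ominus> h c q \<otimes> minor p b x y)"
        using p q P xy by (simp add: gram_expand_column S.ring_normalize)
      finally show "h p q \<otimes> minor b c x y \<ominus>
          (h b q \<otimes> minor p c x y \<ominus> h c q \<otimes> minor p b x y) = \<zero>" by simp
    qed (use p q P xy in auto)
    have "?s \<otimes> h p q = \<zero>"
    proof -
      have "cnj (?s \<otimes> h p q) = \<zero>"
      proof (rule vol_faithful)
        fix x y z assume xyz: "x \<in> carrier P" "y \<in> carrier P" "z \<in> carrier P"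
        have "(?s \<otimes> cnj (vol x y z)) \<otimes> h p q
          = h a x \<otimes> (h p q \<otimes> minor b c y z) \<oplus> h a y \<otimes> (h p q \<otimes> minor b c z x)
            \<oplus> h a z \<otimes> (h p q \<otimes> minor b c x y)"
          using P xyz p q by (simp add: vol_gram gram_expand_row S.ring_normalize)
        also have "\<dots> = h b q \<otimes> gram a p c x y z \<ominus> h c q \<otimes> gram a p b x y z"
          using P xyz p q by (simp add: step gram_expand_row S.ring_normalize)
        also have "gram a p c x y z = \<zero>"
          using vol_gram[of a p c x y z] p0 p P xyz by simp
        also have "gram a p b x y z = \<zero>"
          using vol_gram[of a p b x y z] p0 p P xyz vol_swap(2)[of a b p] by simp
        finally have "(?s \<otimes> cnj (vol x y z)) \<otimes> h p q = \<zero>"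
          using P xyz p q by (simp add: S.minus_eq)
        then have "cnj (cnj (vol x y z) \<otimes> (?s \<otimes> h p q)) = \<zero>"
          using P xyz p q by (simp add: S.m_ac)
        then show "vol x y z \<otimes> cnj (?s \<otimes> h p q) = \<zero>"
          using P xyz p q by (subst (asm) cnj_mult) simp_all
      qed (use P p q in simp)
      then have "cnj (cnj (?s \<otimes> h p q)) = \<zero>" by simp
      then show ?thesis using P p q by (simp del: cnj_h)
    qed
    then show "h (?s \<odot>\<^bsub>P\<^esub> p) q = \<zero>" using P p q by (simp add: h_smult_left)
  qed (use P p in simp)
  then have "?s \<odot>\<^bsub>P\<^esub> (?s \<odot>\<^bsub>P\<^esub> v) \<ominus>\<^bsub>P\<^esub> ?s \<odot>\<^bsub>P\<^esub> r = \<zero>\<^bsub>P\<^esub>"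
    unfolding p_def using P r by (simp add: M.minus_eq smult_r_distr smult_r_minus)
  from M.eq_if_minus_zero[OF _ _ this] show ?thesis
    unfolding r_def[symmetric] using P r by simp
qed

lemma cramer_functional:
  assumes n: "\<And>u. u \<in> carrier P \<Longrightarrow> n u \<in> carrier S"
    and add: "\<And>u v. u \<in> carrier P \<Longrightarrow> v \<in> carrier P \<Longrightarrow> n (u \<oplus>\<^bsub>P\<^esub> v) = n u \<oplus> n v"
    and smult: "\<And>a u. a \<in> carrier S \<Longrightarrow> u \<in> carrier P \<Longrightarrow> n (a \<odot>\<^bsub>P\<^esub> u) = a \<otimes> n u"
    and P: "a \<in> carrier P" "b \<in> carrier P" "c \<in> carrier P" "v \<in> carrier P"
  shows "vol a b c \<otimes> (vol a b c \<otimes> n v) =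
    vol v b c \<otimes> (vol a b c \<otimes> n a) \<oplus> vol a v c \<otimes> (vol a b c \<otimes> n b)
      \<oplus> vol a b v \<otimes> (vol a b c \<otimes> n c)"
proof -
  have "vol a b c \<otimes> (vol a b c \<otimes> n v) = n (vol a b c \<odot>\<^bsub>P\<^esub> (vol a b c \<odot>\<^bsub>P\<^esub> v))"
    using P n by (simp add: smult)
  also have "\<dots> = vol a b c \<otimes>
      (vol v b c \<otimes> n a \<oplus> vol a v c \<otimes> n b \<oplus> vol a b v \<otimes> n c)"
    unfolding cramer[OF P] using P n by (simp add: smult add)
  finally show ?thesis using P n by (simp add: S.r_distr S.m_ac)
qed

text \<open>Polarizing the hypothesis shows that \<open>n\<close> is \<open>S\<close>-linear.  As \<open>vol a b c\<close> kills \<open>n a\<close>, \<open>n b\<close> and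
  \<open>n c\<close>, Cramer's rule shows that its square kills every value of \<open>n\<close>.\<close>

lemma vol_annihilates:
  assumes n: "\<And>u. u \<in> carrier P \<Longrightarrow> n u \<in> carrier S"
    and add: "\<And>u v. u \<in> carrier P \<Longrightarrow> v \<in> carrier P \<Longrightarrow> n (u \<oplus>\<^bsub>P\<^esub> v) = n u \<oplus> n v"
    and ann: "\<And>u v w. u \<in> carrier P \<Longrightarrow> v \<in> carrier P \<Longrightarrow> w \<in> carrier P \<Longrightarrow>
      vol u v w \<otimes> n u = \<zero>"
    and x: "x \<in> carrier P"
  shows "n x = \<zero>"
proof -
  have polar: "vol y v w \<otimes> n u = \<ominus> (vol u v w \<otimes> n y)"
    if c: "u \<in> carrier P" "y \<in> carrier P" "v \<in> carrier P" "w \<in> carrier P" for u y v w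
  proof -
    have "vol y v w \<otimes> n u \<oplus> vol u v w \<otimes> n y = vol (u \<oplus>\<^bsub>P\<^esub> y) v w \<otimes> n (u \<oplus>\<^bsub>P\<^esub> y)"
      using c n ann[of u v w] ann[of y v w] by (simp add: vol_add add S.l_distr S.r_distr)
    also have "\<dots> = \<zero>" using c by (intro ann) auto
    finally show ?thesis using c n by (intro S.minus_equality[symmetric]) auto
  qed
  have smult: "n (s \<odot>\<^bsub>P\<^esub> u) = s \<otimes> n u" if s: "s \<in> carrier S" and u: "u \<in> carrier P" for s u
  proof -
    have "n (s \<odot>\<^bsub>P\<^esub> u) \<ominus> s \<otimes> n u = \<zero>"
    proof (rule vol_faithful)
      fix y v w assume c: "y \<in> carrier P" "v \<in> carrier P" "w \<in> carrier P"
      have "vol y v w \<otimes> n (s \<odot>\<^bsub>P\<^esub> u) = \<ominus> (vol (s \<odot>\<^bsub>P\<^esub> u) v w \<otimes> n y)"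
        using polar[OF _ c] s u by simp
      also have "\<dots> = s \<otimes> (\<ominus> (vol u v w \<otimes> n y))"
        using s u c n by (simp add: vol_smult S.m_assoc S.r_minus)
      also have "\<dots> = s \<otimes> (vol y v w \<otimes> n u)" using polar[OF u c] by simp
      finally show "vol y v w \<otimes> (n (s \<odot>\<^bsub>P\<^esub> u) \<ominus> s \<otimes> n u) = \<zero>"
        using s u c n by (simp add: S.minus_eq S.r_distr S.r_minus S.m_ac S.r_neg)
    qed (use s u n in simp)
    from S.eq_if_minus_zero[OF _ _ this] show ?thesis using s u n by simp
  qed
  show ?thesis
  proof (rule vol_power_faithful[of _ 2])
    fix a b c assume c: "a \<in> carrier P" "b \<in> carrier P" "c \<in> carrier P"
    have "vol a b c \<otimes> n a = \<zero>" "vol a b c \<otimes> n b = \<zero>" "vol a b c \<otimes> n c = \<zero>"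
      using c ann[of a b c] ann[of b c a] ann[of c a b] vol_rotate[of a b c] by simp_all
    then show "vol a b c [^] (2::nat) \<otimes> n x = \<zero>"
      using cramer_functional[OF n add smult c x] c x n
      by (simp add: numeral_2_eq_2 S.m_assoc)
  qed (use n x in simp)
qed

text \<open>The same argument for an alternating bilinear \<open>q\<close>, with Cramer's rule applied in both arguments.\<close>

lemma vol_annihilates_form:
  assumes q: "\<And>u v. u \<in> carrier P \<Longrightarrow> v \<in> carrier P \<Longrightarrow> q u v \<in> carrier S"
    and addl: "\<And>u v w. u \<in> carrier P \<Longrightarrow> v \<in> carrier P \<Longrightarrow> w \<in> carrier P \<Longrightarrow>
      q (u \<oplus>\<^bsub>P\<^esub> v) w = q u w \<oplus> q v w"
    and addr: "\<And>u v w. u \<in> carrier P \<Longrightarrow> v \<in> carrier P \<Longrightarrow> w \<in> carrier P \<Longrightarrow>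
      q w (u \<oplus>\<^bsub>P\<^esub> v) = q w u \<oplus> q w v"
    and smultl: "\<And>a u w. a \<in> carrier S \<Longrightarrow> u \<in> carrier P \<Longrightarrow> w \<in> carrier P \<Longrightarrow>
      q (a \<odot>\<^bsub>P\<^esub> u) w = a \<otimes> q u w"
    and smultr: "\<And>a u w. a \<in> carrier S \<Longrightarrow> u \<in> carrier P \<Longrightarrow> w \<in> carrier P \<Longrightarrow>
      q w (a \<odot>\<^bsub>P\<^esub> u) = a \<otimes> q w u"
    and diag: "\<And>u. u \<in> carrier P \<Longrightarrow> q u u = \<zero>"
    and ann: "\<And>u v w. u \<in> carrier P \<Longrightarrow> v \<in> carrier P \<Longrightarrow> w \<in> carrier P \<Longrightarrow>
      vol u v w \<otimes> q v w = \<zero>"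
    and x: "x \<in> carrier P" and y: "y \<in> carrier P"
  shows "q x y = \<zero>"
proof (rule vol_power_faithful[of _ 4])
  fix a b c assume c: "a \<in> carrier P" "b \<in> carrier P" "c \<in> carrier P"
  let ?s = "vol a b c"
  have basis: "?s \<otimes> q u v = \<zero>" if uv: "u \<in> {a, b, c}" "v \<in> {a, b, c}" for u v
  proof (cases "u = v")
    case True
    then show ?thesis using diag c uv by auto
  next
    case False
    have "?s \<otimes> q a b = \<zero>" "?s \<otimes> q b c = \<zero>" "?s \<otimes> q c a = \<zero>"
      using ann[of c a b] ann[of a b c] ann[of b c a] vol_rotate[of a b c] c by simp_all
    moreover have "(\<ominus> ?s) \<otimes> q b a = \<zero>" "(\<ominus> ?s) \<otimes> q c b = \<zero>" "(\<ominus> ?s) \<otimes> q a c = \<zero>"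
      using ann[of c b a] ann[of a c b] ann[of b a c] vol_swap[of a b c] c by simp_all
    then have "?s \<otimes> q b a = \<zero>" "?s \<otimes> q c b = \<zero>" "?s \<otimes> q a c = \<zero>"
      using c q S.minus_minus[of "?s \<otimes> q b a"] S.minus_minus[of "?s \<otimes> q c b"]
        S.minus_minus[of "?s \<otimes> q a c"] by (simp_all add: S.l_minus)
    ultimately show ?thesis using False uv by auto
  qed
  have half: "?s \<otimes> (?s \<otimes> q u y) = \<zero>" if u: "u \<in> {a, b, c}" for u
  proof -
    have uc: "u \<in> carrier P" using u c by auto
    have "?s \<otimes> (?s \<otimes> q u y) = vol y b c \<otimes> (?s \<otimes> q u a) \<oplus>
        vol a y c \<otimes> (?s \<otimes> q u b) \<oplus> vol a b y \<otimes> (?s \<otimes> q u c)"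
      by (rule cramer_functional) (use uc c y q addr smultr in auto)
    then show ?thesis using basis[OF u] c y by simp
  qed
  have "?s \<otimes> (?s \<otimes> q x y) = vol x b c \<otimes> (?s \<otimes> q a y) \<oplus>
      vol a x c \<otimes> (?s \<otimes> q b y) \<oplus> vol a b x \<otimes> (?s \<otimes> q c y)"
    by (rule cramer_functional) (use c x y q addl smultl in auto)
  then have "?s \<otimes> (?s \<otimes> (?s \<otimes> q x y)) =
      vol x b c \<otimes> (?s \<otimes> (?s \<otimes> q a y)) \<oplus>
      vol a x c \<otimes> (?s \<otimes> (?s \<otimes> q b y)) \<oplus> vol a b x \<otimes> (?s \<otimes> (?s \<otimes> q c y))"
    using c x y q by (simp add: S.r_distr S.m_lcomm)
  also have "\<dots> = \<zero>" using half c x by simp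
  finally have "?s \<otimes> (?s \<otimes> (?s \<otimes> q x y)) = \<zero>" .
  then show "?s [^] (4::nat) \<otimes> q x y = \<zero>"
    using c x y q by (simp add: eval_nat_numeral S.m_assoc)
qed (use q x y in simp)

text \<open>Expand the Gram determinant of \<open>(a, x, y)\<close> and \<open>(x \<times> y, u, v)\<close> along its first column.  Two of the
  entries are \<open>vol x x y\<close> and \<open>vol y x y\<close>, which vanish, so that \<open>vol a x y\<close> kills the difference of
  the two sides.\<close>

lemma h_cross_cross:
  assumes P: "u \<in> carrier P" "v \<in> carrier P" "x \<in> carrier P" "y \<in> carrier P"
  shows "h (u \<times>\<^sub>P v) (x \<times>\<^sub>P y) = minor x y u v"
proof -
  define q where "q = (\<lambda>x y. h (u \<times>\<^sub>P v) (x \<times>\<^sub>P y) \<ominus> minor x y u v)"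
  have "q x y = \<zero>"
  proof (rule vol_annihilates_form)
    fix a x y assume axy: "a \<in> carrier P" "x \<in> carrier P" "y \<in> carrier P"
    let ?b = "x \<times>\<^sub>P y"
    have "vol a x y \<otimes> h (u \<times>\<^sub>P v) ?b = vol a x y \<otimes> cnj (vol ?b u v)"
      using axy P by (simp add: h_cross[symmetric])
    also have "\<dots> = gram a x y ?b u v" using axy P by (simp add: vol_gram)
    also have "\<dots> = vol a x y \<otimes> minor x y u v"
      using axy P by (simp add: gram_expand_column h_cross S.minus_eq)
    finally show "vol a x y \<otimes> q x y = \<zero>"
      unfolding q_def using axy P by (simp add: S.minus_eq S.r_distr S.r_minus S.r_neg)
  next
    fix u' v' w' assume "u' \<in> carrier P" "v' \<in> carrier P" "w' \<in> carrier P"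
    then show "q (u' \<oplus>\<^bsub>P\<^esub> v') w' = q u' w' \<oplus> q v' w'" "q w' (u' \<oplus>\<^bsub>P\<^esub> v') = q w' u' \<oplus> q w' v'"
      unfolding q_def minor_def using P
      by (simp_all add: cross_add_left cross_add_right h_add_left h_add_right S.ring_normalize)
  next
    fix a u' w' assume "a \<in> carrier S" "u' \<in> carrier P" "w' \<in> carrier P"
    then show "q (a \<odot>\<^bsub>P\<^esub> u') w' = a \<otimes> q u' w'" "q w' (a \<odot>\<^bsub>P\<^esub> u') = a \<otimes> q w' u'"
      unfolding q_def minor_def using P
      by (simp_all add: cross_smult_left cross_smult_right h_smult_left h_smult_right S.ring_normalize)
  next
    fix w assume w: "w \<in> carrier P"
    have "w \<times>\<^sub>P w = \<zero>\<^bsub>P\<^esub>" by (rule eq_if_h_eq) (use w in \<open>simp_all add: h_cross\<close>)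
    then show "q w w = \<zero>"
      unfolding q_def minor_def using P w by (simp add: S.minus_eq S.m_comm S.r_neg)
  qed (use P in \<open>simp_all add: q_def\<close>)
  from S.eq_if_minus_zero[OF _ _ this[unfolded q_def]] show ?thesis using P by simp
qed

text \<open>Paired with \<open>x\<close>, the left side is \<open>h (v \<times> w) (x \<times> u)\<close>.\<close>

lemma triple_cross:
  assumes P: "u \<in> carrier P" "v \<in> carrier P" "w \<in> carrier P"
  shows "u \<times>\<^sub>P (v \<times>\<^sub>P w) = h w u \<odot>\<^bsub>P\<^esub> v \<ominus>\<^bsub>P\<^esub> h v u \<odot>\<^bsub>P\<^esub> w"
proof (rule eq_if_h_eq)
  fix x assume x: "x \<in> carrier P"
  have "h x (u \<times>\<^sub>P (v \<times>\<^sub>P w)) = vol (v \<times>\<^sub>P w) x u"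
    using P x vol_rotate(2)[of x u "v \<times>\<^sub>P w"] by (simp add: h_cross)
  also have "\<dots> = minor x u v w" using P x by (simp add: h_cross[symmetric] h_cross_cross)
  finally show "h x (u \<times>\<^sub>P (v \<times>\<^sub>P w)) = h x (h w u \<odot>\<^bsub>P\<^esub> v \<ominus>\<^bsub>P\<^esub> h v u \<odot>\<^bsub>P\<^esub> w)"
    using P x by (simp add: minor_def M.minus_eq S.minus_eq h_add_right h_minus_right h_smult_right)
qed (use P in auto)

lemma triple_cross_left:
  assumes P: "u \<in> carrier P" "v \<in> carrier P" "w \<in> carrier P"
  shows "(u \<times>\<^sub>P v) \<times>\<^sub>P w = h u w \<odot>\<^bsub>P\<^esub> v \<ominus>\<^bsub>P\<^esub> h v w \<odot>\<^bsub>P\<^esub> u"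
  using P cross_swap[of w "u \<times>\<^sub>P v"]
  by (simp add: triple_cross M.minus_eq M.minus_add M.a_comm)

text \<open>Pairing Cramer's rule with \<open>x\<close> gives its dual form: \<open>x\<close> times the square of the conjugate of
  \<open>vol a b c\<close> is a combination of \<open>b \<times> c\<close>, \<open>c \<times> a\<close> and \<open>a \<times> b\<close>.  The scalars can be moved into
  the factors of the cross products.\<close>

lemma cross_products_span:
  assumes A: "A \<subseteq> carrier P" "\<zero>\<^bsub>P\<^esub> \<in> A" and add: "\<And>u v. u \<in> A \<Longrightarrow> v \<in> A \<Longrightarrow> u \<oplus>\<^bsub>P\<^esub> v \<in> A"
    and cross: "\<And>u v. u \<in> carrier P \<Longrightarrow> v \<in> carrier P \<Longrightarrow> u \<times>\<^sub>P v \<in> A"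
    and x: "x \<in> carrier P"
  shows "x \<in> A"
proof -
  let ?I = "{r \<in> carrier S. \<forall>t\<in>carrier S. (t \<otimes> cnj r) \<odot>\<^bsub>P\<^esub> x \<in> A}"
  have scaled: "a \<odot>\<^bsub>P\<^esub> (u \<times>\<^sub>P v) \<in> A" if "a \<in> carrier S" "u \<in> carrier P" "v \<in> carrier P" for a u v
    using cross[of "cnj a \<odot>\<^bsub>P\<^esub> u" v] that by (simp add: cross_smult_left)
  have "ideal ?I S"
  proof (rule S.ideal_if_closed)
    fix s r assume s: "s \<in> carrier S" and r: "r \<in> ?I"
    have "(t \<otimes> cnj (s \<otimes> r)) \<odot>\<^bsub>P\<^esub> x \<in> A" if t: "t \<in> carrier S" for t
    proof -
      have "t \<otimes> cnj (s \<otimes> r) = (t \<otimes> cnj s) \<otimes> cnj r" using s r t by (simp add: cnj_mult S.m_assoc)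
      then show ?thesis using s r t by simp
    qed
    then show "s \<otimes> r \<in> ?I" using s r by simp
  qed (use A x add in \<open>auto simp: cnj_add S.r_distr smult_l_distr\<close>)
  then have "?I = carrier S"
  proof (rule unimodular_power[of _ 2])
    fix a b c assume c: "a \<in> carrier P" "b \<in> carrier P" "c \<in> carrier P"
    let ?s = "vol a b c"
    have eq: "cnj ?s \<odot>\<^bsub>P\<^esub> (cnj ?s \<odot>\<^bsub>P\<^esub> x) =
        (cnj ?s \<otimes> h x a) \<odot>\<^bsub>P\<^esub> (b \<times>\<^sub>P c) \<oplus>\<^bsub>P\<^esub> (cnj ?s \<otimes> h x b) \<odot>\<^bsub>P\<^esub> (c \<times>\<^sub>P a) \<oplus>\<^bsub>P\<^esub> (cnj ?s \<otimes> h x c) \<odot>\<^bsub>P\<^esub> (a \<times>\<^sub>P b)"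
    proof (rule eq_if_h_eq)
      fix y assume y: "y \<in> carrier P"
      have "?s \<otimes> (?s \<otimes> h y x) = vol y b c \<otimes> (?s \<otimes> h a x) \<oplus>
          vol a y c \<otimes> (?s \<otimes> h b x) \<oplus> vol a b y \<otimes> (?s \<otimes> h c x)"
        by (rule cramer_functional[of "\<lambda>u. h u x"]) (use c x y in \<open>auto simp: h_add_left h_smult_left\<close>)
      moreover have "vol a y c = vol y c a" "vol a b y = vol y a b"
        using vol_rotate[of y c a] vol_rotate[of y a b] c y by simp_all
      ultimately show "h y (cnj ?s \<odot>\<^bsub>P\<^esub> (cnj ?s \<odot>\<^bsub>P\<^esub> x)) = h y ((cnj ?s \<otimes> h x a) \<odot>\<^bsub>P\<^esub> (b \<times>\<^sub>P c) \<oplus>\<^bsub>P\<^esub>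
          (cnj ?s \<otimes> h x b) \<odot>\<^bsub>P\<^esub> (c \<times>\<^sub>P a) \<oplus>\<^bsub>P\<^esub> (cnj ?s \<otimes> h x c) \<odot>\<^bsub>P\<^esub> (a \<times>\<^sub>P b))"
        using c x y by (simp add: h_add_right h_smult_right h_cross cnj_mult S.m_ac)
    qed (use c x in auto)
    have "(t \<otimes> cnj (?s [^] (2::nat))) \<odot>\<^bsub>P\<^esub> x \<in> A" if t: "t \<in> carrier S" for t
    proof -
      have "(t \<otimes> cnj (?s [^] (2::nat))) \<odot>\<^bsub>P\<^esub> x = t \<odot>\<^bsub>P\<^esub> (cnj ?s \<odot>\<^bsub>P\<^esub> (cnj ?s \<odot>\<^bsub>P\<^esub> x))"
        using t c x by (simp add: numeral_2_eq_2 cnj_mult smult_assoc1)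
      also have "\<dots> = (t \<otimes> (cnj ?s \<otimes> h x a)) \<odot>\<^bsub>P\<^esub> (b \<times>\<^sub>P c) \<oplus>\<^bsub>P\<^esub> (t \<otimes> (cnj ?s \<otimes> h x b)) \<odot>\<^bsub>P\<^esub> (c \<times>\<^sub>P a)
          \<oplus>\<^bsub>P\<^esub> (t \<otimes> (cnj ?s \<otimes> h x c)) \<odot>\<^bsub>P\<^esub> (a \<times>\<^sub>P b)"
        unfolding eq using t c x by (simp add: smult_r_distr smult_assoc1)
      finally show ?thesis using t c x by (simp add: add scaled)
    qed
    then show "?s [^] (2::nat) \<in> ?I" using c by simp
  qed
  then have "\<one> \<in> ?I" by simp
  moreover have "cnj \<one> = \<one>"
    using cnj_mult[of "cnj \<one>" "\<one>"] by simp
  ultimately show ?thesis using x by force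
qed

end

section \<open>Derivations of the vector algebra\<close>

locale etale_cross_product = cross_product_space S P cnj h vol cr + R: cring R +
  T: quadratic_trace_algebra R S tr cnj
  for R :: "('r, 'c) ring_scheme" and S :: "('r, 's, 'd) module_scheme" (structure)
    and P :: "('s, 'p, 'e) module_scheme"
    and tr :: "'s \<Rightarrow> 'r" and cnj :: "'s \<Rightarrow> 's" and h :: "'p \<Rightarrow> 'p \<Rightarrow> 's"
    and vol :: "'p \<Rightarrow> 'p \<Rightarrow> 'p \<Rightarrow> 's" and cr :: "'p \<Rightarrow> 'p \<Rightarrow> 'p" (infixl \<open>\<times>\<^sub>P\<close> 70)
begin

abbreviation base :: "'r \<Rightarrow> 's" where "base r \<equiv> r \<odot>\<^bsub>S\<^esub> \<one>"

lemma base_closed [simp]: "r \<in> carrier R \<Longrightarrow> base r \<in> carrier S"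
  by simp

context
  fixes D
  assumes D_closed [simp]: "\<And>u. u \<in> carrier P \<Longrightarrow> D u \<in> carrier P"
    and D_add: "\<And>u v. u \<in> carrier P \<Longrightarrow> v \<in> carrier P \<Longrightarrow> D (u \<oplus>\<^bsub>P\<^esub> v) = D u \<oplus>\<^bsub>P\<^esub> D v"
    and D_base: "\<And>r u. r \<in> carrier R \<Longrightarrow> u \<in> carrier P \<Longrightarrow> D (base r \<odot>\<^bsub>P\<^esub> u) = base r \<odot>\<^bsub>P\<^esub> D u"
    and D_cross: "\<And>u v. u \<in> carrier P \<Longrightarrow> v \<in> carrier P \<Longrightarrow> D (u \<times>\<^sub>P v) = D u \<times>\<^sub>P v \<oplus>\<^bsub>P\<^esub> u \<times>\<^sub>P D v"
begin

text \<open>The failure of \<open>D\<close> to commute with the scalar \<open>a\<close>.\<close>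

definition E :: "'s \<Rightarrow> 'p \<Rightarrow> 'p" where "E a u = D (a \<odot>\<^bsub>P\<^esub> u) \<ominus>\<^bsub>P\<^esub> a \<odot>\<^bsub>P\<^esub> D u"

lemma E_closed [simp]: "a \<in> carrier S \<Longrightarrow> u \<in> carrier P \<Longrightarrow> E a u \<in> carrier P"
  by (simp add: E_def)

lemma D_smult: "a \<in> carrier S \<Longrightarrow> u \<in> carrier P \<Longrightarrow> D (a \<odot>\<^bsub>P\<^esub> u) = E a u \<oplus>\<^bsub>P\<^esub> a \<odot>\<^bsub>P\<^esub> D u"
  by (simp add: E_def M.minus_eq M.a_assoc M.l_neg)

lemma E_add:
  "a \<in> carrier S \<Longrightarrow> u \<in> carrier P \<Longrightarrow> v \<in> carrier P \<Longrightarrow> E a (u \<oplus>\<^bsub>P\<^esub> v) = E a u \<oplus>\<^bsub>P\<^esub> E a v"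
  by (simp add: E_def D_add smult_r_distr M.minus_eq M.minus_add M.a_ac)

lemma E_add_scalar:
  "a \<in> carrier S \<Longrightarrow> b \<in> carrier S \<Longrightarrow> u \<in> carrier P \<Longrightarrow> E (a \<oplus> b) u = E a u \<oplus>\<^bsub>P\<^esub> E b u"
  by (simp add: E_def D_add smult_l_distr M.minus_eq M.minus_add M.a_ac)

lemma E_mult:
  "a \<in> carrier S \<Longrightarrow> b \<in> carrier S \<Longrightarrow> u \<in> carrier P \<Longrightarrow>
    E (a \<otimes> b) u = E a (b \<odot>\<^bsub>P\<^esub> u) \<oplus>\<^bsub>P\<^esub> a \<odot>\<^bsub>P\<^esub> E b u"
  by (simp add: E_def smult_assoc1 smult_r_distr smult_r_minus M.minus_eq M.a_assoc M.r_neg1 M.r_neg2)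

lemma E_base: "r \<in> carrier R \<Longrightarrow> u \<in> carrier P \<Longrightarrow> E (base r) u = \<zero>\<^bsub>P\<^esub>"
  by (simp add: E_def D_base M.minus_eq M.r_neg)

lemma E_cross_balanced:
  assumes a: "a \<in> carrier S" and P: "u \<in> carrier P" "v \<in> carrier P"
  shows "E a u \<times>\<^sub>P v = u \<times>\<^sub>P E a v"
proof -
  let ?X = "cnj a \<odot>\<^bsub>P\<^esub> (D u \<times>\<^sub>P v)" and ?Y = "cnj a \<odot>\<^bsub>P\<^esub> (u \<times>\<^sub>P D v)"
  have "D ((a \<odot>\<^bsub>P\<^esub> u) \<times>\<^sub>P v) = (E a u \<times>\<^sub>P v \<oplus>\<^bsub>P\<^esub> ?X) \<oplus>\<^bsub>P\<^esub> ?Y"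
    using a P by (subst D_cross) (simp_all add: D_smult cross_add_left cross_smult_left)
  moreover have "D (u \<times>\<^sub>P (a \<odot>\<^bsub>P\<^esub> v)) = ?X \<oplus>\<^bsub>P\<^esub> (u \<times>\<^sub>P E a v \<oplus>\<^bsub>P\<^esub> ?Y)"
    using a P by (subst D_cross) (simp_all add: D_smult cross_add_right cross_smult_right)
  moreover have "(a \<odot>\<^bsub>P\<^esub> u) \<times>\<^sub>P v = u \<times>\<^sub>P (a \<odot>\<^bsub>P\<^esub> v)"
    using a P by (simp add: cross_smult_left cross_smult_right)
  ultimately have "(E a u \<times>\<^sub>P v \<oplus>\<^bsub>P\<^esub> ?X) \<oplus>\<^bsub>P\<^esub> ?Y = ?X \<oplus>\<^bsub>P\<^esub> (u \<times>\<^sub>P E a v \<oplus>\<^bsub>P\<^esub> ?Y)" by metis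
  then have "(?X \<oplus>\<^bsub>P\<^esub> ?Y) \<oplus>\<^bsub>P\<^esub> E a u \<times>\<^sub>P v = (?X \<oplus>\<^bsub>P\<^esub> ?Y) \<oplus>\<^bsub>P\<^esub> u \<times>\<^sub>P E a v"
    using a P by (simp add: M.a_ac)
  then show ?thesis using a P by simp
qed

text \<open>Twice the cross product of \<open>E a u\<close> and \<open>u\<close> vanishes by \<open>E_cross_balanced\<close>.\<close>

lemma E_parallel:
  assumes a: "a \<in> carrier S" and P: "x \<in> carrier P" "u \<in> carrier P"
  shows "vol x (E a u) u = \<zero>"
proof (rule T.double_S)
  have "vol x (E a u) u = vol x u (E a u)"
    using E_cross_balanced[OF a P(2) P(2)] a P h_cross[of x "E a u" u] h_cross[of x u "E a u"] by simp
  then show "vol x (E a u) u \<oplus> vol x (E a u) u = \<zero>"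
    using vol_swap(2)[of x u "E a u"] a P by (metis E_closed S.r_neg vol_closed)
qed (use a P in simp)

lemma E_cross:
  assumes a: "a \<in> carrier S" and P: "u \<in> carrier P" "v \<in> carrier P"
  shows "E a (u \<times>\<^sub>P v) = E (cnj a) u \<times>\<^sub>P v"
proof -
  have "a \<odot>\<^bsub>P\<^esub> (u \<times>\<^sub>P v) = (cnj a \<odot>\<^bsub>P\<^esub> u) \<times>\<^sub>P v" using a P by (simp add: cross_smult_left)
  then have "E a (u \<times>\<^sub>P v) = D ((cnj a \<odot>\<^bsub>P\<^esub> u) \<times>\<^sub>P v) \<ominus>\<^bsub>P\<^esub> a \<odot>\<^bsub>P\<^esub> D (u \<times>\<^sub>P v)"
    by (simp add: E_def)
  also have "D ((cnj a \<odot>\<^bsub>P\<^esub> u) \<times>\<^sub>P v) = E (cnj a) u \<times>\<^sub>P v \<oplus>\<^bsub>P\<^esub> a \<odot>\<^bsub>P\<^esub> D (u \<times>\<^sub>P v)"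
    using a P
    by (subst D_cross)
      (simp_all add: D_smult D_cross cross_add_left cross_smult_left smult_r_distr M.a_assoc)
  also have "\<dots> \<ominus>\<^bsub>P\<^esub> a \<odot>\<^bsub>P\<^esub> D (u \<times>\<^sub>P v) = E (cnj a) u \<times>\<^sub>P v"
    using a P by (simp add: M.minus_eq M.a_assoc M.r_neg)
  finally show ?thesis .
qed

text \<open>Expanding both sides of \<open>(E (cnj a) u \<times> v) \<times> w = (u \<times> v) \<times> E a w\<close> as triple products and taking the
  volume with \<open>x\<close> and \<open>u\<close> leaves only the coefficients of \<open>v\<close>, since \<open>E (cnj a) u\<close> is parallel to \<open>u\<close>.
  Hence these coefficients agree, and so do the other two terms.\<close>

lemma E_adjoint:
  assumes a: "a \<in> carrier S" and P: "u \<in> carrier P" "w \<in> carrier P"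
  shows "h (E (cnj a) u) w = h u (E a w)"
    and "v \<in> carrier P \<Longrightarrow> h v w \<odot>\<^bsub>P\<^esub> E (cnj a) u = h v (E a w) \<odot>\<^bsub>P\<^esub> u"
proof -
  have key: "h (E (cnj a) u) w \<odot>\<^bsub>P\<^esub> v \<ominus>\<^bsub>P\<^esub> h v w \<odot>\<^bsub>P\<^esub> E (cnj a) u
      = h u (E a w) \<odot>\<^bsub>P\<^esub> v \<ominus>\<^bsub>P\<^esub> h v (E a w) \<odot>\<^bsub>P\<^esub> u"
    if P: "u \<in> carrier P" "v \<in> carrier P" "w \<in> carrier P" for u v w
  proof -
    have "(E (cnj a) u \<times>\<^sub>P v) \<times>\<^sub>P w = (u \<times>\<^sub>P v) \<times>\<^sub>P E a w"
      using E_cross[OF a P(1,2)] E_cross_balanced[OF a, of "u \<times>\<^sub>P v" w] P by simp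
    then show ?thesis using a P by (simp add: triple_cross_left)
  qed
  define n where "n = (\<lambda>u. h (E (cnj a) u) w \<ominus> h u (E a w))"
  have "n u = \<zero>"
  proof (rule vol_annihilates)
    fix u x v assume c: "u \<in> carrier P" "x \<in> carrier P" "v \<in> carrier P"
    have "vol x (h (E (cnj a) u) w \<odot>\<^bsub>P\<^esub> v \<ominus>\<^bsub>P\<^esub> h v w \<odot>\<^bsub>P\<^esub> E (cnj a) u) u
        = vol x (h u (E a w) \<odot>\<^bsub>P\<^esub> v \<ominus>\<^bsub>P\<^esub> h v (E a w) \<odot>\<^bsub>P\<^esub> u) u"
      using key[OF c(1,3) P(2)] by simp
    then have "h (E (cnj a) u) w \<otimes> vol x v u = h u (E a w) \<otimes> vol x v u"
      using a c P by (simp add: M.minus_eq vol_simps E_parallel)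
    moreover have "vol x v u = vol u x v" using c vol_rotate[of u x v] by simp
    ultimately show "vol u x v \<otimes> n u = \<zero>"
      using a c P by (simp add: n_def S.minus_eq S.r_distr S.r_minus S.m_comm[of "vol u x v"] S.r_neg)
  qed (use a P in \<open>simp_all add: n_def E_add h_add_left S.minus_eq S.minus_add S.a_ac\<close>)
  from S.eq_if_minus_zero[OF _ _ this[unfolded n_def]]
  show adj: "h (E (cnj a) u) w = h u (E a w)" using a P by simp
  assume v: "v \<in> carrier P"
  show "h v w \<odot>\<^bsub>P\<^esub> E (cnj a) u = h v (E a w) \<odot>\<^bsub>P\<^esub> u"
  proof -
    let ?Z = "h u (E a w) \<odot>\<^bsub>P\<^esub> v"
    have "?Z \<oplus>\<^bsub>P\<^esub> \<ominus>\<^bsub>P\<^esub> (h v w \<odot>\<^bsub>P\<^esub> E (cnj a) u) = ?Z \<oplus>\<^bsub>P\<^esub> \<ominus>\<^bsub>P\<^esub> (h v (E a w) \<odot>\<^bsub>P\<^esub> u)"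
      using key[OF P(1) v P(2)] unfolding adj by (simp add: M.minus_eq)
    then have "\<ominus>\<^bsub>P\<^esub> (h v w \<odot>\<^bsub>P\<^esub> E (cnj a) u) = \<ominus>\<^bsub>P\<^esub> (h v (E a w) \<odot>\<^bsub>P\<^esub> u)"
      using a P v by simp
    then show ?thesis using a P v by (metis E_closed M.minus_minus cnj_closed h_closed smult_closed)
  qed
qed

text \<open>By \<open>E_adjoint\<close> a multiple \<open>h v w\<close> of \<open>E a\<close> is a scalar operator, and the values of \<open>h\<close> span \<open>S\<close>.\<close>

lemma E_scalar:
  assumes a: "a \<in> carrier S"
  shows "\<exists>l\<in>carrier S. \<forall>u\<in>carrier P. E a u = l \<odot>\<^bsub>P\<^esub> u"
proof -
  let ?I = "{r \<in> carrier S. \<exists>m\<in>carrier S. \<forall>u\<in>carrier P. r \<odot>\<^bsub>P\<^esub> E a u = m \<odot>\<^bsub>P\<^esub> u}"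
  have "?I = carrier S"
  proof (rule hermitian_values_span)
    show "\<zero> \<in> ?I" using a by (auto intro!: bexI[of _ "\<zero>"])
  next
    fix r s assume "r \<in> ?I" "s \<in> ?I"
    then obtain m k where "r \<in> carrier S" "s \<in> carrier S" "m \<in> carrier S" "k \<in> carrier S"
      "\<forall>u\<in>carrier P. r \<odot>\<^bsub>P\<^esub> E a u = m \<odot>\<^bsub>P\<^esub> u" "\<forall>u\<in>carrier P. s \<odot>\<^bsub>P\<^esub> E a u = k \<odot>\<^bsub>P\<^esub> u" by blast
    then show "r \<oplus> s \<in> ?I"
      using a by (auto simp: smult_l_distr intro!: bexI[of _ "m \<oplus> k"])
  next
    fix v w assume vw: "v \<in> carrier P" "w \<in> carrier P"
    have "h v w \<odot>\<^bsub>P\<^esub> E a u = h v (E (cnj a) w) \<odot>\<^bsub>P\<^esub> u" if "u \<in> carrier P" for u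
      using E_adjoint(2)[of "cnj a" u w v] a that vw by simp
    then show "h v w \<in> ?I" using a vw by (auto intro!: bexI[of _ "h v (E (cnj a) w)"])
  qed auto
  then have "\<one> \<in> ?I" by simp
  then show ?thesis using a by (auto simp: smult_one)
qed

text \<open>The scalars \<open>l a\<close> with \<open>E a u = l a u\<close> form an \<open>R\<close>-linear derivation of \<open>S\<close>.\<close>

lemma D_linear:
  assumes a: "a \<in> carrier S" and u: "u \<in> carrier P"
  shows "D (a \<odot>\<^bsub>P\<^esub> u) = a \<odot>\<^bsub>P\<^esub> D u"
proof -
  have "\<forall>a\<in>carrier S. \<exists>l. l \<in> carrier S \<and> (\<forall>u\<in>carrier P. E a u = l \<odot>\<^bsub>P\<^esub> u)"
    using E_scalar by blast
  from bchoice[OF this] obtain l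
    where l: "\<And>a. a \<in> carrier S \<Longrightarrow> l a \<in> carrier S"
      and El: "\<And>a u. a \<in> carrier S \<Longrightarrow> u \<in> carrier P \<Longrightarrow> E a u = l a \<odot>\<^bsub>P\<^esub> u" by blast
  have unique: "b = c" if "b \<in> carrier S" "c \<in> carrier S"
    and "\<And>u. u \<in> carrier P \<Longrightarrow> b \<odot>\<^bsub>P\<^esub> u = c \<odot>\<^bsub>P\<^esub> u" for b c
  proof -
    have "b \<ominus> c = \<zero>"
      by (rule smult_faithful) (use that in \<open>simp_all add: S.minus_eq smult_l_distr smult_l_minus M.r_neg\<close>)
    then show ?thesis using that S.eq_if_minus_zero by blast
  qed
  have "l a = \<zero>"
  proof (rule T.derivation_zero[OF _ _ _ _ a])
    fix a b assume ab: "a \<in> carrier S" "b \<in> carrier S"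
    show "l (a \<oplus> b) = l a \<oplus> l b"
      by (rule unique) (use ab l in \<open>simp_all add: El[symmetric] E_add_scalar smult_l_distr\<close>)
    show "l (a \<otimes> b) = a \<otimes> l b \<oplus> b \<otimes> l a"
    proof (rule unique)
      fix u assume u: "u \<in> carrier P"
      have "l (a \<otimes> b) \<odot>\<^bsub>P\<^esub> u = E (a \<otimes> b) u" using ab u by (simp add: El)
      also have "\<dots> = l a \<odot>\<^bsub>P\<^esub> (b \<odot>\<^bsub>P\<^esub> u) \<oplus>\<^bsub>P\<^esub> a \<odot>\<^bsub>P\<^esub> (l b \<odot>\<^bsub>P\<^esub> u)"
        using ab u by (simp add: E_mult[OF ab u] El[OF ab(1)] El[OF ab(2)])
      also have "\<dots> = (b \<otimes> l a \<oplus> a \<otimes> l b) \<odot>\<^bsub>P\<^esub> u"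
        using ab u l by (simp add: smult_l_distr smult_assoc1[symmetric] S.m_comm[of "l a"])
      also have "\<dots> = (a \<otimes> l b \<oplus> b \<otimes> l a) \<odot>\<^bsub>P\<^esub> u"
        using ab l by (simp add: S.a_comm)
      finally show "l (a \<otimes> b) \<odot>\<^bsub>P\<^esub> u = (a \<otimes> l b \<oplus> b \<otimes> l a) \<odot>\<^bsub>P\<^esub> u" .
    qed (use ab l in simp_all)
  next
    fix r assume r: "r \<in> carrier R"
    show "l (base r) = \<zero>"
      by (rule smult_faithful) (use r l in \<open>simp_all add: El[symmetric] E_base\<close>)
  qed (use l in simp)
  then show ?thesis using D_smult[OF a u] El[OF a u] a u by simp
qed

text \<open>Applying \<open>D\<close> to \<open>u \<times> (v \<times> w) = h w u v - h v u w\<close> in two ways gives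
  the vector equation \<open>k(w) v = k(v) w\<close> with the scalars \<open>k(z) = h (D z) u + h z (D u)\<close>.  The volume with \<open>w\<close> and
  \<open>x\<close> removes the right side.\<close>

lemma D_skew:
  assumes w: "w \<in> carrier P" and u: "u \<in> carrier P"
  shows "h (D w) u \<oplus> h w (D u) = \<zero>"
proof (rule vol_annihilates[where n = "\<lambda>w. h (D w) u \<oplus> h w (D u)"])
  fix w x v assume c: "w \<in> carrier P" "x \<in> carrier P" "v \<in> carrier P"
  let ?f = "vol w x"
  have Dm: "D (\<ominus>\<^bsub>P\<^esub> z) = \<ominus>\<^bsub>P\<^esub> D z" if "z \<in> carrier P" for z
    using D_linear[of "\<ominus> \<one>" z] that by (simp add: smult_l_minus)
  have "D (u \<times>\<^sub>P (v \<times>\<^sub>P w)) = D u \<times>\<^sub>P (v \<times>\<^sub>P w) \<oplus>\<^bsub>P\<^esub> (u \<times>\<^sub>P (D v \<times>\<^sub>P w) \<oplus>\<^bsub>P\<^esub> u \<times>\<^sub>P (v \<times>\<^sub>P D w))"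
    using c u by (simp add: D_cross cross_add_right)
  then have "?f (D (h w u \<odot>\<^bsub>P\<^esub> v \<ominus>\<^bsub>P\<^esub> h v u \<odot>\<^bsub>P\<^esub> w)) =
      ?f ((h w (D u) \<odot>\<^bsub>P\<^esub> v \<ominus>\<^bsub>P\<^esub> h v (D u) \<odot>\<^bsub>P\<^esub> w) \<oplus>\<^bsub>P\<^esub> ((h w u \<odot>\<^bsub>P\<^esub> D v \<ominus>\<^bsub>P\<^esub> h (D v) u \<odot>\<^bsub>P\<^esub> w)
        \<oplus>\<^bsub>P\<^esub> (h (D w) u \<odot>\<^bsub>P\<^esub> v \<ominus>\<^bsub>P\<^esub> h v u \<odot>\<^bsub>P\<^esub> D w)))"
    using c u by (simp add: triple_cross)
  then have "h w u \<otimes> ?f (D v) \<oplus> \<ominus> (h v u \<otimes> ?f (D w)) =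
      h w (D u) \<otimes> ?f v \<oplus> (h w u \<otimes> ?f (D v) \<oplus>
        (h (D w) u \<otimes> ?f v \<oplus> \<ominus> (h v u \<otimes> ?f (D w))))"
    using c u by (simp add: D_add Dm D_linear M.minus_eq vol_simps)
  then have "(h w u \<otimes> ?f (D v) \<oplus> \<ominus> (h v u \<otimes> ?f (D w))) \<oplus> \<zero> =
      (h w u \<otimes> ?f (D v) \<oplus> \<ominus> (h v u \<otimes> ?f (D w))) \<oplus>
      (h (D w) u \<otimes> ?f v \<oplus> h w (D u) \<otimes> ?f v)"
    using c u by (simp add: S.a_ac)
  then have "\<zero> = h (D w) u \<otimes> ?f v \<oplus> h w (D u) \<otimes> ?f v"
    using c u by simp
  then show "?f v \<otimes> (h (D w) u \<oplus> h w (D u)) = \<zero>"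
    using c u by (simp add: S.r_distr S.m_comm[of "?f v"])
qed (use w u in \<open>simp_all add: D_add h_add_left h_add_right S.a_ac\<close>)

end

end

section \<open>Restriction and extension by zero\<close>

text \<open>The maps in \<open>X\<close> have scalar component zero and depend only on the vector component of their
  argument, so that sums, multiples and commutators are computed in the vector component.\<close>

lemma lie_iso_restrict_to_P:
  fixes Z :: "('z, 'c) ring_scheme" and P :: "('s, 'p, 'e) module_scheme"
    and A :: "('r, 'z \<times> 'p) module" and W :: "('r, 'p) module" and R :: "('r, 'b) ring_scheme"
  assumes Z: "abelian_group Z" and P: "abelian_group P"
    and A: "carrier A = carrier Z \<times> carrier P" "\<zero>\<^bsub>A\<^esub> = (\<zero>\<^bsub>Z\<^esub>, \<zero>\<^bsub>P\<^esub>)"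
      "\<And>a u b v. (a, u) \<oplus>\<^bsub>A\<^esub> (b, v) = (a \<oplus>\<^bsub>Z\<^esub> b, u \<oplus>\<^bsub>P\<^esub> v)"
      "\<And>r a u. snd (r \<odot>\<^bsub>A\<^esub> (a, u)) = r \<odot>\<^bsub>W\<^esub> u"
    and W: "carrier W = carrier P" "add W = add P" "\<zero>\<^bsub>W\<^esub> = \<zero>\<^bsub>P\<^esub>"
    and Y: "Y \<subseteq> extensional (carrier P) \<inter> (carrier P \<rightarrow> carrier P)"
    and XY: "\<And>d. d \<in> X \<Longrightarrow> restrict_to_P Z P d \<in> Y"
      "\<And>d. d \<in> X \<Longrightarrow> extend_by_zero Z P (restrict_to_P Z P d) = d"
      "\<And>D. D \<in> Y \<Longrightarrow> extend_by_zero Z P D \<in> X"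
  shows "lie_iso R (lie_algebra_on A X) (lie_algebra_on W Y) (restrict_to_P Z P)"
    and "D \<in> Y \<Longrightarrow> restrict_to_P Z P (extend_by_zero Z P D) = D"
proof -
  interpret Z: abelian_group Z by fact
  interpret P: abelian_group P by fact
  interpret A: abelian_group A
  proof (rule abelian_groupI)
    fix x assume "x \<in> carrier A"
    then show "\<exists>y\<in>carrier A. y \<oplus>\<^bsub>A\<^esub> x = \<zero>\<^bsub>A\<^esub>"
      by (intro bexI[of _ "(\<ominus>\<^bsub>Z\<^esub> fst x, \<ominus>\<^bsub>P\<^esub> snd x)"]) (auto simp: A Z.l_neg P.l_neg)
  qed (auto simp: A Z.a_ac P.a_ac)
  have invA: "\<ominus>\<^bsub>A\<^esub> (a, u) = (\<ominus>\<^bsub>Z\<^esub> a, \<ominus>\<^bsub>P\<^esub> u)" if "a \<in> carrier Z" "u \<in> carrier P" for a u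
    by (rule A.minus_equality) (use that in \<open>simp_all add: A Z.l_neg P.l_neg\<close>)
  have invW: "\<ominus>\<^bsub>W\<^esub> u = \<ominus>\<^bsub>P\<^esub> u" for u
    by (simp add: a_inv_def m_inv_def W)
  have RE: "restrict_to_P Z P (extend_by_zero Z P D) = D" if "D \<in> Y" for D
    using that Y unfolding restrict_to_P_def extend_by_zero_def
    by (auto simp: extensional_def fun_eq_iff restrict_def)
  then show "D \<in> Y \<Longrightarrow> restrict_to_P Z P (extend_by_zero Z P D) = D" .
  have val: "d (\<zero>\<^bsub>Z\<^esub>, u) = (\<zero>\<^bsub>Z\<^esub>, restrict_to_P Z P d u)" if "d \<in> X" "u \<in> carrier P" for d u
  proof -
    have "d (\<zero>\<^bsub>Z\<^esub>, u) = extend_by_zero Z P (restrict_to_P Z P d) (\<zero>\<^bsub>Z\<^esub>, u)" using XY(2)[OF that(1)] by simp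
    then show ?thesis using that by (simp add: extend_by_zero_def)
  qed
  have closed: "restrict_to_P Z P d u \<in> carrier P" if "d \<in> X" "u \<in> carrier P" for d u
    using XY(1)[OF that(1)] Y that(2) by auto
  have outside: "restrict_to_P Z P d u = undefined" if "u \<notin> carrier P" for d u
    using that by (simp add: restrict_to_P_def)
  have eval: "restrict_to_P Z P (\<lambda>x\<in>carrier Z \<times> carrier P. g x) = (\<lambda>u\<in>carrier P. snd (g (\<zero>\<^bsub>Z\<^esub>, u)))" for g
    unfolding restrict_to_P_def by auto
  have "linear_map R (lie_algebra_on A X) (lie_algebra_on W Y) (restrict_to_P Z P)"
    unfolding linear_map_def lie_algebra_on_def
    using XY(1) by (auto simp: eval A W val intro!: restrict_ext)
  moreover have "bij_betw (restrict_to_P Z P) X Y"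
    by (rule bij_betw_byWitness[where f' = "extend_by_zero Z P"]) (use XY RE in auto)
  moreover have "restrict_to_P Z P (\<lambda>x\<in>carrier A. d (e x) \<ominus>\<^bsub>A\<^esub> e (d x)) =
      (\<lambda>u\<in>carrier W. restrict_to_P Z P d (restrict_to_P Z P e u) \<ominus>\<^bsub>W\<^esub> restrict_to_P Z P e (restrict_to_P Z P d u))"
    if "d \<in> X" "e \<in> X" for d e
    using that by (auto simp: eval W A invA invW val closed a_minus_def intro!: restrict_ext)
  ultimately show "lie_iso R (lie_algebra_on A X) (lie_algebra_on W Y) (restrict_to_P Z P)"
    unfolding lie_iso_def by (simp add: lie_algebra_on_def)
qed

section \<open>The scalar component of a derivation\<close>

context etale_cross_product
begin

lemma tr_cnj: "a \<in> carrier S \<Longrightarrow> tr (cnj a) = tr a"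
  using T.add_cnj[of a] T.add_cnj[of "cnj a"] by (intro T.base_inj) (simp_all add: S.a_comm)

lemma cross_zero [simp]: "u \<in> carrier P \<Longrightarrow> u \<times>\<^sub>P \<zero>\<^bsub>P\<^esub> = \<zero>\<^bsub>P\<^esub>" "u \<in> carrier P \<Longrightarrow> \<zero>\<^bsub>P\<^esub> \<times>\<^sub>P u = \<zero>\<^bsub>P\<^esub>"
  using cross_smult_right[of "\<zero>" u "\<zero>\<^bsub>P\<^esub>"] cross_smult_left[of "\<zero>" "\<zero>\<^bsub>P\<^esub>" u] by simp_all

lemma additive_minus:
  assumes "abelian_group G"
    and f: "\<And>u. u \<in> carrier P \<Longrightarrow> f u \<in> carrier G"
      "\<And>u v. u \<in> carrier P \<Longrightarrow> v \<in> carrier P \<Longrightarrow> f (u \<oplus>\<^bsub>P\<^esub> v) = f u \<oplus>\<^bsub>G\<^esub> f v"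
  shows "f \<zero>\<^bsub>P\<^esub> = \<zero>\<^bsub>G\<^esub>" and "u \<in> carrier P \<Longrightarrow> f (\<ominus>\<^bsub>P\<^esub> u) = \<ominus>\<^bsub>G\<^esub> f u"
proof -
  interpret G: abelian_group G by fact
  show z: "f \<zero>\<^bsub>P\<^esub> = \<zero>\<^bsub>G\<^esub>"
    using f(2)[of "\<zero>\<^bsub>P\<^esub>" "\<zero>\<^bsub>P\<^esub>"] f(1)[of "\<zero>\<^bsub>P\<^esub>"] by (simp add: G.add.l_cancel_one')
  assume u: "u \<in> carrier P"
  have "f (\<ominus>\<^bsub>P\<^esub> u) \<oplus>\<^bsub>G\<^esub> f u = \<zero>\<^bsub>G\<^esub>"
    using f(2)[of "\<ominus>\<^bsub>P\<^esub> u" u] u z by (simp add: M.l_neg)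
  then show "f (\<ominus>\<^bsub>P\<^esub> u) = \<ominus>\<^bsub>G\<^esub> f u" using u f(1) by (simp add: G.minus_equality)
qed

text \<open>The right side of \<open>f_cross\<close> is symmetric in \<open>u\<close> and \<open>v\<close> because the trace is invariant under
  conjugation, whereas the left side changes sign.\<close>

lemma real_component_zero:
  assumes f: "\<And>u. u \<in> carrier P \<Longrightarrow> f u \<in> carrier R"
      "\<And>u v. u \<in> carrier P \<Longrightarrow> v \<in> carrier P \<Longrightarrow> f (u \<oplus>\<^bsub>P\<^esub> v) = f u \<oplus>\<^bsub>R\<^esub> f v"
    and D: "\<And>u. u \<in> carrier P \<Longrightarrow> D u \<in> carrier P" and c: "c \<in> carrier R"
    and f_cross: "\<And>u v. u \<in> carrier P \<Longrightarrow> v \<in> carrier P \<Longrightarrow> f (u \<times>\<^sub>P v) =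
      \<ominus>\<^bsub>R\<^esub> (c \<otimes>\<^bsub>R\<^esub> tr (h (D u) v)) \<oplus>\<^bsub>R\<^esub> \<ominus>\<^bsub>R\<^esub> (c \<otimes>\<^bsub>R\<^esub> tr (h u (D v)))"
    and x: "x \<in> carrier P"
  shows "f x = \<zero>\<^bsub>R\<^esub>"
proof -
  have "x \<in> {x \<in> carrier P. f x = \<zero>\<^bsub>R\<^esub>}"
  proof (rule cross_products_span[OF _ _ _ _ x])
    show "\<zero>\<^bsub>P\<^esub> \<in> {x \<in> carrier P. f x = \<zero>\<^bsub>R\<^esub>}"
      using additive_minus(1)[OF R.abelian_group_axioms f] by simp
  next
    fix u v assume P: "u \<in> carrier P" "v \<in> carrier P"
    have sym: "tr (h w z) = tr (h z w)" if "w \<in> carrier P" "z \<in> carrier P" for w z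
      using tr_cnj[of "h w z"] that by simp
    have "f (v \<times>\<^sub>P u) = f (u \<times>\<^sub>P v)"
      using P D c f_cross[OF P] f_cross[OF P(2,1)] sym[of "D u" v] sym[of "D v" u] by (simp add: R.a_comm)
    moreover have "f (v \<times>\<^sub>P u) = \<ominus>\<^bsub>R\<^esub> f (u \<times>\<^sub>P v)"
      using P additive_minus(2)[OF R.abelian_group_axioms f, of "u \<times>\<^sub>P v"] by (simp add: cross_swap[of u v])
    ultimately have "f (u \<times>\<^sub>P v) \<oplus>\<^bsub>R\<^esub> f (u \<times>\<^sub>P v) = \<zero>\<^bsub>R\<^esub>"
      using P f(1)[of "u \<times>\<^sub>P v"] by (metis R.r_neg cross_closed)
    then show "u \<times>\<^sub>P v \<in> {x \<in> carrier P. f x = \<zero>\<^bsub>R\<^esub>}" using T.double_R f(1) P cross_closed by blast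
  qed (use f in auto)
  then show ?thesis by simp
qed

text \<open>Exchanging \<open>u\<close> and \<open>v\<close> in \<open>f_cross\<close> conjugates the right side and changes the sign of the left side,
  so the values of \<open>f\<close> have trace zero; by linearity so do all their multiples.\<close>

lemma extension_component_zero:
  assumes f: "\<And>u. u \<in> carrier P \<Longrightarrow> f u \<in> carrier S"
      "\<And>u v. u \<in> carrier P \<Longrightarrow> v \<in> carrier P \<Longrightarrow> f (u \<oplus>\<^bsub>P\<^esub> v) = f u \<oplus> f v"
      "\<And>a u. a \<in> carrier S \<Longrightarrow> u \<in> carrier P \<Longrightarrow> f (a \<odot>\<^bsub>P\<^esub> u) = a \<otimes> f u"
    and D: "\<And>u. u \<in> carrier P \<Longrightarrow> D u \<in> carrier P"
    and f_cross: "\<And>u v. u \<in> carrier P \<Longrightarrow> v \<in> carrier P \<Longrightarrow> f (u \<times>\<^sub>P v) =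
      \<ominus> h (D u) v \<oplus> \<ominus> h u (D v)"
    and x: "x \<in> carrier P"
  shows "f x = \<zero>"
proof -
  have tr0: "tr (f x) = \<zero>\<^bsub>R\<^esub>" if x: "x \<in> carrier P" for x
  proof -
    have "x \<in> {x \<in> carrier P. tr (f x) = \<zero>\<^bsub>R\<^esub>}"
    proof (rule cross_products_span[OF _ _ _ _ x])
      show "\<zero>\<^bsub>P\<^esub> \<in> {x \<in> carrier P. tr (f x) = \<zero>\<^bsub>R\<^esub>}"
        using additive_minus(1)[OF S.abelian_group_axioms f(1,2)] by simp
    next
      fix u v assume P: "u \<in> carrier P" "v \<in> carrier P"
      have "\<ominus> f (u \<times>\<^sub>P v) = f (v \<times>\<^sub>P u)"
        using P additive_minus(2)[OF S.abelian_group_axioms f(1,2), of "u \<times>\<^sub>P v"]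
        by (simp add: cross_swap[of u v])
      also have "\<dots> = cnj (f (u \<times>\<^sub>P v))"
        using P D f_cross[OF P] f_cross[OF P(2,1)] by (simp add: cnj_add cnj_minus S.a_comm)
      finally have "cnj (f (u \<times>\<^sub>P v)) = \<ominus> f (u \<times>\<^sub>P v)" by simp
      then show "u \<times>\<^sub>P v \<in> {x \<in> carrier P. tr (f x) = \<zero>\<^bsub>R\<^esub>}"
        using P f(1) T.tr_eq_zero_iff by simp
    qed (use f in \<open>auto simp: T.tr_add\<close>)
    then show ?thesis by simp
  qed
  show ?thesis
  proof (rule T.trace_nondegenerate)
    fix b assume b: "b \<in> carrier S"
    have "f x \<otimes> b = f (b \<odot>\<^bsub>P\<^esub> x)" using b x f by (simp add: S.m_comm)
    then show "tr (f x \<otimes> b) = \<zero>\<^bsub>R\<^esub>" using tr0 b x by simp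
  qed (use f x in simp)
qed

end

section \<open>The cross product of a trivialized determinant\<close>

lemma etale_cross_product_of_trivialization:
  fixes R :: "'r ring" and S :: "('r, 's) module" (structure) and P :: "('s, 'p) module"
  assumes cringR: "cring R"
    and two: "\<one>\<^bsub>R\<^esub> \<oplus>\<^bsub>R\<^esub> \<one>\<^bsub>R\<^esub> \<in> Units R"
    and etale: "quadratic_etale R S"
    and herm: "hermitian_space_rank3 S (canonical_involution R S) P h"
    and det: "determinant_trivialization S (canonical_involution R S) P h \<alpha>"
  shows "etale_cross_product R S P (algebra_trace R S) (canonical_involution R S) h
     (\<lambda>u v w. \<alpha> (wedge3 S P u v w)) (cross_product S P h \<alpha>)"
proof -
  let ?tr = "algebra_trace R S" and ?cnj = "canonical_involution R S"
  let ?vol = "\<lambda>u v w. \<alpha> (wedge3 S P u v w)" and ?cr = "cross_product S P h \<alpha>"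
  interpret R: cring R by fact
  interpret S: cring S using etale algebra.M_cring unfolding quadratic_etale_def by blast
  interpret RS: algebra R S using etale unfolding quadratic_etale_def by blast
  have modP: "module S P" using herm unfolding hermitian_space_rank3_def by blast
  interpret P: module S P by (rule modP)
  note tr = algebra_trace_closed[OF cringR etale] algebra_trace_add[OF cringR etale]
    algebra_trace_smult[OF cringR etale]
  have cnj_closed: "?cnj a \<in> carrier S" if "a \<in> carrier S" for a
    using that by (simp add: canonical_involution_def tr)
  have cnj_add: "?cnj (a \<oplus> b) = ?cnj a \<oplus> ?cnj b" if "a \<in> carrier S" "b \<in> carrier S" for a b
    using that
    by (simp add: canonical_involution_def tr RS.smult_l_distr S.minus_eq S.minus_add S.a_ac)
  have add_cnj: "a \<oplus> ?cnj a = ?tr a \<odot>\<^bsub>S\<^esub> \<one>" if "a \<in> carrier S" for a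
    using that by (simp add: canonical_involution_def tr S.minus_eq S.a_lcomm[of a] S.r_neg)
  have nd: "nondegenerate_hermitian S ?cnj P h" using herm unfolding hermitian_space_rank3_def by blast
  have bij: "bij_betw (\<lambda>w. \<lambda>u\<in>carrier P. h u w) (carrier P) (Hom_module S P (regular_module S))"
    using nd unfolding nondegenerate_hermitian_def by blast
  interpret hermitian_module S P ?cnj h
  proof (intro hermitian_module.intro hermitian_module_axioms.intro)
    show "cring S" "module S P" by (rule S.cring_axioms, rule modP)
    show "\<And>u v. u \<in> carrier P \<Longrightarrow> v \<in> carrier P \<Longrightarrow> h u v \<in> carrier S"
      "\<And>u u' v. u \<in> carrier P \<Longrightarrow> u' \<in> carrier P \<Longrightarrow> v \<in> carrier P \<Longrightarrow>
         h (u \<oplus>\<^bsub>P\<^esub> u') v = h u v \<oplus> h u' v"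
      "\<And>u u' v. u \<in> carrier P \<Longrightarrow> u' \<in> carrier P \<Longrightarrow> v \<in> carrier P \<Longrightarrow>
         h v (u \<oplus>\<^bsub>P\<^esub> u') = h v u \<oplus> h v u'"
      "\<And>a u v. a \<in> carrier S \<Longrightarrow> u \<in> carrier P \<Longrightarrow> v \<in> carrier P \<Longrightarrow>
         h (a \<odot>\<^bsub>P\<^esub> u) v = a \<otimes> h u v"
      "\<And>a u v. a \<in> carrier S \<Longrightarrow> u \<in> carrier P \<Longrightarrow> v \<in> carrier P \<Longrightarrow>
         h u (a \<odot>\<^bsub>P\<^esub> v) = h u v \<otimes> ?cnj a"
      "\<And>u v. u \<in> carrier P \<Longrightarrow> v \<in> carrier P \<Longrightarrow> ?cnj (h u v) = h v u"
      using nd unfolding nondegenerate_hermitian_def by (blast, blast, blast, blast, blast, metis)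
  next
    fix w assume w: "w \<in> carrier P" and 0: "\<And>u. u \<in> carrier P \<Longrightarrow> h u w = \<zero>"
    have "h u \<zero>\<^bsub>P\<^esub> = \<zero>" if u: "u \<in> carrier P" for u
    proof -
      have "h u (\<zero> \<odot>\<^bsub>P\<^esub> \<zero>\<^bsub>P\<^esub>) = h u \<zero>\<^bsub>P\<^esub> \<otimes> ?cnj \<zero>" "h u \<zero>\<^bsub>P\<^esub> \<in> carrier S"
        using nd u S.zero_closed P.M.zero_closed unfolding nondegenerate_hermitian_def by blast+
      moreover have "?cnj \<zero> = \<zero>"
        using cnj_add[of "\<zero>" "\<zero>"] cnj_closed[of "\<zero>"] by (simp add: S.add.l_cancel_one')
      ultimately show ?thesis by simp
    qed
    then have "(\<lambda>u\<in>carrier P. h u w) = (\<lambda>u\<in>carrier P. h u \<zero>\<^bsub>P\<^esub>)" using 0 by auto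
    then show "w = \<zero>\<^bsub>P\<^esub>" using bij w P.M.zero_closed unfolding bij_betw_def inj_on_def by blast
  qed (fact cnj_closed cnj_add)+
  have iso: "linear_map S (exterior_cube S P) (regular_module S) \<alpha>"
    "bij_betw \<alpha> (carrier (exterior_cube S P)) (carrier S)"
    "\<And>X Y. X \<in> carrier (exterior_cube S P) \<Longrightarrow> Y \<in> carrier (exterior_cube S P) \<Longrightarrow>
       \<alpha> X \<otimes> ?cnj (\<alpha> Y) = exterior_cube_form S ?cnj h X Y"
    using det unfolding determinant_trivialization_def hermitian_iso_def
    by (simp_all add: regular_module_def)
  have alt: "alternating_trilinear S P ?vol"
    by (rule exterior_cube_volume_alternating[OF modP iso(1)])
  have volc: "?vol u v w \<in> carrier S" if "u \<in> carrier P" "v \<in> carrier P" "w \<in> carrier P" for u v w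
    using alt that unfolding alternating_trilinear_def by blast
  have cross: "?cr v w \<in> carrier P \<and> (\<forall>u\<in>carrier P. h u (?cr v w) = ?vol u v w)"
    if v: "v \<in> carrier P" and w: "w \<in> carrier P" for v w
  proof -
    \<comment> \<open>The cross product exists since this functional is represented by a vector.\<close>
    let ?g = "\<lambda>u\<in>carrier P. ?vol u v w"
    have "?vol (u \<oplus>\<^bsub>P\<^esub> u') v w = ?vol u v w \<oplus> ?vol u' v w" if "u \<in> carrier P" "u' \<in> carrier P" for u u'
    proof -
      have "?vol (\<one> \<odot>\<^bsub>P\<^esub> u \<oplus>\<^bsub>P\<^esub> \<one> \<odot>\<^bsub>P\<^esub> u') v w = \<one> \<otimes> ?vol u v w \<oplus> \<one> \<otimes> ?vol u' v w"
        using alt that v w S.one_closed unfolding alternating_trilinear_def by blast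
      then show ?thesis using that v w volc by simp
    qed
    moreover have "?vol (a \<odot>\<^bsub>P\<^esub> u) v w = a \<otimes> ?vol u v w" if "a \<in> carrier S" "u \<in> carrier P" for a u
    proof -
      have "?vol (a \<odot>\<^bsub>P\<^esub> u \<oplus>\<^bsub>P\<^esub> \<zero> \<odot>\<^bsub>P\<^esub> u) v w = a \<otimes> ?vol u v w \<oplus> \<zero> \<otimes> ?vol u v w"
        using alt that v w S.zero_closed unfolding alternating_trilinear_def by blast
      then show ?thesis using that v w volc by simp
    qed
    ultimately have "?g \<in> Hom_module S P (regular_module S)"
      using volc v w unfolding Hom_module_def linear_map_def regular_module_def by simp
    then obtain x where x: "x \<in> carrier P" and eq: "(\<lambda>u\<in>carrier P. h u x) = ?g"
      using bij unfolding bij_betw_def by (metis (no_types, lifting) imageE)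
    have hx: "h u x = ?vol u v w" if "u \<in> carrier P" for u
      using fun_cong[OF eq, of u] that by simp
    have "?cr v w = x"
      unfolding cross_product_def
    proof (rule the_equality)
      show "x \<in> carrier P \<and> (\<forall>u\<in>carrier P. h u x = ?vol u v w)" using x hx by blast
    next
      fix y assume "y \<in> carrier P \<and> (\<forall>u\<in>carrier P. h u y = ?vol u v w)"
      then have "(\<lambda>u\<in>carrier P. h u y) = (\<lambda>u\<in>carrier P. h u x)" "y \<in> carrier P" using hx by auto
      then show "y = x" using bij x unfolding bij_betw_def inj_on_def by blast
    qed
    then show ?thesis using x hx by blast
  qed
  interpret V: volume_hermitian S P ?cnj h ?vol ?cr
  proof (intro volume_hermitian.intro volume_hermitian_axioms.intro)
    show "hermitian_module S P ?cnj h" by (rule hermitian_module_axioms)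
    show "alternating_trilinear S P ?vol" by (rule alt)
  next
    fix I assume I: "ideal I S"
      and gen: "\<And>u v w. u \<in> carrier P \<Longrightarrow> v \<in> carrier P \<Longrightarrow> w \<in> carrier P \<Longrightarrow> ?vol u v w \<in> I"
    show "I = carrier S"
      by (rule exterior_cube_generated[OF modP iso(1) _ I gen]) (use iso(2) in \<open>simp add: bij_betw_def\<close>)
  qed (use cross in blast)+
  interpret C: cross_product_space S P ?cnj h ?vol ?cr
  proof (intro cross_product_space.intro cross_product_space_axioms.intro)
    show "volume_hermitian S P ?cnj h ?vol ?cr" by (rule V.volume_hermitian_axioms)
  next
    fix u v w x y z
    assume P: "u \<in> carrier P" "v \<in> carrier P" "w \<in> carrier P" "x \<in> carrier P" "y \<in> carrier P" "z \<in> carrier P"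
    have car: "wedge3 S P u v w \<in> carrier (exterior_cube S P)"
      if "u \<in> carrier P" "v \<in> carrier P" "w \<in> carrier P" for u v w
      by (rule wedge3_closed[OF modP that])
    show "?vol u v w \<otimes> ?cnj (?vol x y z) = V.gram u v w x y z"
      using iso(3)[OF car car] V.exterior_cube_form_wedge P by simp
  qed
  \<comment> \<open>The involution is multiplicative and onto, so it fixes \<open>1\<close>, and \<open>tr 1 = 1 + cnj 1\<close>.\<close>
  have tr1: "?tr \<one> \<odot>\<^bsub>S\<^esub> \<one> = \<one> \<oplus> \<one>"
    using add_cnj[of "\<one>"] V.cnj_mult[of "?cnj \<one>" "\<one>"] by simp
  show ?thesis
  proof (intro etale_cross_product.intro quadratic_trace_algebra.intro quadratic_trace_algebra_axioms.intro)
    show "cross_product_space S P ?cnj h ?vol ?cr" by (rule C.cross_product_space_axioms)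
    show "module R S" by (rule RS.module_axioms)
    fix r assume r: "r \<in> carrier R"
    show "r \<odot>\<^bsub>S\<^esub> \<one> = \<zero> \<Longrightarrow> r = \<zero>\<^bsub>R\<^esub>" by (rule etale_base_faithful[OF cringR etale r])
    show "(\<And>a. a \<in> carrier S \<Longrightarrow> r \<odot>\<^bsub>S\<^esub> (a \<oplus> a) = (r \<otimes>\<^bsub>R\<^esub> ?tr a) \<odot>\<^bsub>S\<^esub> \<one>) \<Longrightarrow> r = \<zero>\<^bsub>R\<^esub>"
      by (rule etale_skew_faithful[OF cringR etale two tr1 r])
  next
    fix a assume a: "a \<in> carrier S"
    show "(\<And>b. b \<in> carrier S \<Longrightarrow> ?tr (a \<otimes> b) = \<zero>\<^bsub>R\<^esub>) \<Longrightarrow> a = \<zero>"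
      by (rule etale_trace_nondegenerate[OF cringR etale a])
  qed (fact cringR two tr cnj_closed cnj_add add_cnj V.cnj_mult V.cnj_cnj S.cring_axioms RS.smult_assoc2)+
qed

section \<open>The colour algebra and the octonion algebra\<close>

lemma derivations_iff:
  "d \<in> derivations R A \<longleftrightarrow> d \<in> extensional (carrier A) \<and> d \<in> carrier A \<rightarrow> carrier A \<and>
    (\<forall>x\<in>carrier A. \<forall>y\<in>carrier A. d (x \<oplus>\<^bsub>A\<^esub> y) = d x \<oplus>\<^bsub>A\<^esub> d y) \<and>
    (\<forall>r\<in>carrier R. \<forall>x\<in>carrier A. d (r \<odot>\<^bsub>A\<^esub> x) = r \<odot>\<^bsub>A\<^esub> d x) \<and>
    (\<forall>x\<in>carrier A. \<forall>y\<in>carrier A. d (x \<otimes>\<^bsub>A\<^esub> y) = (d x \<otimes>\<^bsub>A\<^esub> y) \<oplus>\<^bsub>A\<^esub> (x \<otimes>\<^bsub>A\<^esub> d y))"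
  unfolding derivations_def Hom_module_def linear_map_def by blast

lemma carrier_Der: "carrier (Der R A) = derivations R A"
  by (simp add: Der_def lie_algebra_on_def)

lemma carrier_Der_S:
  "carrier (Der_S R S P A) = {d \<in> derivations R A. \<forall>a\<in>carrier S. d (a, \<zero>\<^bsub>P\<^esub>) = \<zero>\<^bsub>A\<^esub>}"
  by (simp add: Der_S_def lie_algebra_on_def)

lemma extend_by_zero_simp:
  "a \<in> carrier Z \<Longrightarrow> u \<in> carrier P \<Longrightarrow> extend_by_zero Z P D (a, u) = (\<zero>\<^bsub>Z\<^esub>, D u)"
  by (simp add: extend_by_zero_def)

context
  fixes R :: "'r ring" and S :: "('r, 's) module" (structure) and P :: "('s, 'p) module" and h \<alpha>
  assumes ecp: "etale_cross_product R S P (algebra_trace R S) (canonical_involution R S) h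
     (\<lambda>u v w. \<alpha> (wedge3 S P u v w)) (cross_product S P h \<alpha>)"
begin

interpretation etale_cross_product R S P "algebra_trace R S" "canonical_involution R S" h
  "\<lambda>u v w. \<alpha> (wedge3 S P u v w)" "cross_product S P h \<alpha>" by (rule ecp)

abbreviation (input) "tr \<equiv> algebra_trace R S"
abbreviation (input) "cnj \<equiv> canonical_involution R S"
abbreviation (input) cross (infixl \<open>\<times>\<^sub>P\<close> 70) where "u \<times>\<^sub>P v \<equiv> cross_product S P h \<alpha> u v"
abbreviation (input) "W \<equiv> vector_algebra S P h \<alpha>"
abbreviation (input) "C \<equiv> colour_algebra R S P h \<alpha>"
abbreviation (input) "K \<equiv> octonion_algebra R S P h \<alpha>"
abbreviation (input) "half \<equiv> inv\<^bsub>R\<^esub> (\<one>\<^bsub>R\<^esub> \<oplus>\<^bsub>R\<^esub> \<one>\<^bsub>R\<^esub>)"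

lemma half_closed: "half \<in> carrier R"
  using T.two_unit by simp

lemma base_preimage_trace:
  assumes "a \<in> carrier S" shows "base_preimage R S (a \<oplus> cnj a) = tr a"
  unfolding base_preimage_def
  by (rule the_equality) (use assms T.add_cnj T.base_inj in auto)

lemma vector_algebra_simps: "carrier W = carrier P" "add W = add P" "\<zero>\<^bsub>W\<^esub> = \<zero>\<^bsub>P\<^esub>"
  "u \<otimes>\<^bsub>W\<^esub> v = u \<times>\<^sub>P v" "r \<odot>\<^bsub>W\<^esub> u = base r \<odot>\<^bsub>P\<^esub> u"
  by (simp_all add: vector_algebra_def base_smult_def)

lemma colour_algebra_simps: "carrier C = carrier R \<times> carrier P" "\<zero>\<^bsub>C\<^esub> = (\<zero>\<^bsub>R\<^esub>, \<zero>\<^bsub>P\<^esub>)"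
  "(a, u) \<oplus>\<^bsub>C\<^esub> (b, v) = (a \<oplus>\<^bsub>R\<^esub> b, u \<oplus>\<^bsub>P\<^esub> v)"
  "r \<odot>\<^bsub>C\<^esub> (a, u) = (r \<otimes>\<^bsub>R\<^esub> a, base r \<odot>\<^bsub>P\<^esub> u)"
  by (simp_all add: colour_algebra_def Let_def base_smult_def)

lemma colour_algebra_mult: "u \<in> carrier P \<Longrightarrow> v \<in> carrier P \<Longrightarrow> (a, u) \<otimes>\<^bsub>C\<^esub> (b, v) =
    (a \<otimes>\<^bsub>R\<^esub> b \<ominus>\<^bsub>R\<^esub> half \<otimes>\<^bsub>R\<^esub> tr (h u v), base a \<odot>\<^bsub>P\<^esub> v \<oplus>\<^bsub>P\<^esub> base b \<odot>\<^bsub>P\<^esub> u \<oplus>\<^bsub>P\<^esub> u \<times>\<^sub>P v)"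
  using base_preimage_trace[of "h u v"]
  by (simp add: colour_algebra_def Let_def base_smult_def)

lemma octonion_algebra_simps: "carrier K = carrier S \<times> carrier P" "\<zero>\<^bsub>K\<^esub> = (\<zero>, \<zero>\<^bsub>P\<^esub>)"
  "(a, u) \<oplus>\<^bsub>K\<^esub> (b, v) = (a \<oplus> b, u \<oplus>\<^bsub>P\<^esub> v)"
  "r \<odot>\<^bsub>K\<^esub> (a, u) = (r \<odot>\<^bsub>S\<^esub> a, base r \<odot>\<^bsub>P\<^esub> u)"
  by (simp_all add: octonion_algebra_def Let_def base_smult_def)

lemma octonion_algebra_mult: "(a', u) \<otimes>\<^bsub>K\<^esub> (b', v) =
    (a' \<otimes> b' \<ominus> h u v, a' \<odot>\<^bsub>P\<^esub> v \<oplus>\<^bsub>P\<^esub> cnj b' \<odot>\<^bsub>P\<^esub> u \<oplus>\<^bsub>P\<^esub> u \<times>\<^sub>P v)"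
  by (simp add: octonion_algebra_def Let_def)

lemma derivations_vector_algebra_iff: "D \<in> derivations R W \<longleftrightarrow>
    D \<in> extensional (carrier P) \<and> D \<in> carrier P \<rightarrow> carrier P \<and>
    (\<forall>u\<in>carrier P. \<forall>v\<in>carrier P. D (u \<oplus>\<^bsub>P\<^esub> v) = D u \<oplus>\<^bsub>P\<^esub> D v) \<and>
    (\<forall>r\<in>carrier R. \<forall>u\<in>carrier P. D (base r \<odot>\<^bsub>P\<^esub> u) = base r \<odot>\<^bsub>P\<^esub> D u) \<and>
    (\<forall>u\<in>carrier P. \<forall>v\<in>carrier P. D (u \<times>\<^sub>P v) = D u \<times>\<^sub>P v \<oplus>\<^bsub>P\<^esub> u \<times>\<^sub>P D v)"
  unfolding derivations_iff vector_algebra_simps ..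

lemma vector_derivation_properties:
  assumes D: "D \<in> derivations R W"
  shows "\<And>u. u \<in> carrier P \<Longrightarrow> D u \<in> carrier P"
    and "\<And>a u. a \<in> carrier S \<Longrightarrow> u \<in> carrier P \<Longrightarrow> D (a \<odot>\<^bsub>P\<^esub> u) = a \<odot>\<^bsub>P\<^esub> D u"
    and "\<And>u v. u \<in> carrier P \<Longrightarrow> v \<in> carrier P \<Longrightarrow> h (D u) v \<oplus> h u (D v) = \<zero>"
    and "\<And>u v. u \<in> carrier P \<Longrightarrow> v \<in> carrier P \<Longrightarrow> D (u \<oplus>\<^bsub>P\<^esub> v) = D u \<oplus>\<^bsub>P\<^esub> D v"
    and "\<And>u v. u \<in> carrier P \<Longrightarrow> v \<in> carrier P \<Longrightarrow> D (u \<times>\<^sub>P v) = D u \<times>\<^sub>P v \<oplus>\<^bsub>P\<^esub> u \<times>\<^sub>P D v"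
proof -
  show D1: "\<And>u. u \<in> carrier P \<Longrightarrow> D u \<in> carrier P"
    and D2: "\<And>u v. u \<in> carrier P \<Longrightarrow> v \<in> carrier P \<Longrightarrow> D (u \<oplus>\<^bsub>P\<^esub> v) = D u \<oplus>\<^bsub>P\<^esub> D v"
    and D3: "\<And>u v. u \<in> carrier P \<Longrightarrow> v \<in> carrier P \<Longrightarrow> D (u \<times>\<^sub>P v) = D u \<times>\<^sub>P v \<oplus>\<^bsub>P\<^esub> u \<times>\<^sub>P D v"
    using D unfolding derivations_vector_algebra_iff by auto
  have D4: "\<And>r u. r \<in> carrier R \<Longrightarrow> u \<in> carrier P \<Longrightarrow> D (base r \<odot>\<^bsub>P\<^esub> u) = base r \<odot>\<^bsub>P\<^esub> D u"
    using D unfolding derivations_vector_algebra_iff by blast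
  show "\<And>a u. a \<in> carrier S \<Longrightarrow> u \<in> carrier P \<Longrightarrow> D (a \<odot>\<^bsub>P\<^esub> u) = a \<odot>\<^bsub>P\<^esub> D u"
    by (rule D_linear[OF D1 D2 D4 D3])
  show "\<And>u v. u \<in> carrier P \<Longrightarrow> v \<in> carrier P \<Longrightarrow> h (D u) v \<oplus> h u (D v) = \<zero>"
    by (rule D_skew[OF D1 D2 D4 D3])
qed

lemma colour_derivation_of_vector:
  assumes D: "D \<in> derivations R W"
  shows "extend_by_zero R P D \<in> derivations R C"
proof -
  note DP = vector_derivation_properties[OF D]
  have half: "half \<in> carrier R" by (rule half_closed)
  have skew: "\<ominus>\<^bsub>R\<^esub> (half \<otimes>\<^bsub>R\<^esub> tr (h (D u) v)) \<oplus>\<^bsub>R\<^esub> \<ominus>\<^bsub>R\<^esub> (half \<otimes>\<^bsub>R\<^esub> tr (h u (D v))) = \<zero>\<^bsub>R\<^esub>"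
    if "u \<in> carrier P" "v \<in> carrier P" for u v
  proof -
    have "tr (h (D u) v) \<oplus>\<^bsub>R\<^esub> tr (h u (D v)) = \<zero>\<^bsub>R\<^esub>"
      using DP(3)[OF that] that DP(1) T.tr_zero by (simp add: T.tr_add[symmetric])
    then have "half \<otimes>\<^bsub>R\<^esub> tr (h (D u) v) \<oplus>\<^bsub>R\<^esub> half \<otimes>\<^bsub>R\<^esub> tr (h u (D v)) = \<zero>\<^bsub>R\<^esub>"
      using that DP(1) half by (simp add: R.r_distr[symmetric])
    then show ?thesis
      using that DP(1) half by (simp add: R.minus_add[symmetric])
  qed
  have cl: "carrier C = carrier R \<times> carrier P" by (rule colour_algebra_simps(1))
  show ?thesis
    unfolding derivations_iff
  proof (intro conjI ballI)
    show "extend_by_zero R P D \<in> extensional (carrier C)"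
      unfolding cl extend_by_zero_def by simp
    show "extend_by_zero R P D \<in> carrier C \<rightarrow> carrier C"
      unfolding cl by (auto simp: extend_by_zero_def DP(1))
  next
    fix x y assume "x \<in> carrier C" "y \<in> carrier C"
    then obtain a u b v where xy: "x = (a, u)" "y = (b, v)"
      and c: "a \<in> carrier R" "b \<in> carrier R" "u \<in> carrier P" "v \<in> carrier P"
      unfolding cl by blast
    show "extend_by_zero R P D (x \<oplus>\<^bsub>C\<^esub> y) = extend_by_zero R P D x \<oplus>\<^bsub>C\<^esub> extend_by_zero R P D y"
      unfolding xy using c by (simp add: colour_algebra_simps extend_by_zero_simp DP)
    show "extend_by_zero R P D (x \<otimes>\<^bsub>C\<^esub> y)
        = (extend_by_zero R P D x \<otimes>\<^bsub>C\<^esub> y) \<oplus>\<^bsub>C\<^esub> (x \<otimes>\<^bsub>C\<^esub> extend_by_zero R P D y)"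
      unfolding xy using c half skew[of u v]
      by (simp add: colour_algebra_simps colour_algebra_mult extend_by_zero_simp DP R.minus_eq M.a_ac)
  next
    fix r x assume r: "r \<in> carrier R" and "x \<in> carrier C"
    then obtain a u where x: "x = (a, u)" and c: "a \<in> carrier R" "u \<in> carrier P"
      unfolding cl by blast
    show "extend_by_zero R P D (r \<odot>\<^bsub>C\<^esub> x) = r \<odot>\<^bsub>C\<^esub> extend_by_zero R P D x"
      unfolding x using c r by (simp add: colour_algebra_simps extend_by_zero_simp DP)
  qed
qed

text \<open>The unit is killed by \<open>d\<close>, hence so is \<open>R\<close>.  The two components of the product rule for
  \<open>(0, u) (0, v)\<close> are the hypothesis of \<open>real_component_zero\<close> and, once \<open>f = 0\<close>, the product rule in the
  vector algebra.\<close>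

lemma vector_derivation_of_colour:
  assumes d: "d \<in> derivations R C"
  shows "restrict_to_P R P d \<in> derivations R W"
    and "extend_by_zero R P (restrict_to_P R P d) = d"
proof -
  have half: "half \<in> carrier R" by (rule half_closed)
  have cl: "carrier C = carrier R \<times> carrier P" by (rule colour_algebra_simps(1))
  have ext: "d \<in> extensional (carrier R \<times> carrier P)"
    and dc: "\<And>a u. a \<in> carrier R \<Longrightarrow> u \<in> carrier P \<Longrightarrow> d (a, u) \<in> carrier R \<times> carrier P"
    and da: "\<And>a u b v. a \<in> carrier R \<Longrightarrow> u \<in> carrier P \<Longrightarrow> b \<in> carrier R \<Longrightarrow> v \<in> carrier P \<Longrightarrow>
       d (a \<oplus>\<^bsub>R\<^esub> b, u \<oplus>\<^bsub>P\<^esub> v) = d (a, u) \<oplus>\<^bsub>C\<^esub> d (b, v)"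
    and ds: "\<And>r a u. r \<in> carrier R \<Longrightarrow> a \<in> carrier R \<Longrightarrow> u \<in> carrier P \<Longrightarrow>
       d (r \<otimes>\<^bsub>R\<^esub> a, base r \<odot>\<^bsub>P\<^esub> u) = r \<odot>\<^bsub>C\<^esub> d (a, u)"
    and dm: "\<And>a u b v. a \<in> carrier R \<Longrightarrow> u \<in> carrier P \<Longrightarrow> b \<in> carrier R \<Longrightarrow> v \<in> carrier P \<Longrightarrow>
       d ((a, u) \<otimes>\<^bsub>C\<^esub> (b, v)) = (d (a, u) \<otimes>\<^bsub>C\<^esub> (b, v)) \<oplus>\<^bsub>C\<^esub> ((a, u) \<otimes>\<^bsub>C\<^esub> d (b, v))"
    using d unfolding derivations_iff cl by (auto simp: colour_algebra_simps(3,4)[symmetric] Pi_iff)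
  define f where "f u = fst (d (\<zero>\<^bsub>R\<^esub>, u))" for u
  define D where "D = restrict_to_P R P d"
  have Dv: "d (\<zero>\<^bsub>R\<^esub>, u) = (f u, D u)" if "u \<in> carrier P" for u
    using that by (simp add: f_def D_def restrict_to_P_def)
  have fc: "f u \<in> carrier R" and Dc: "D u \<in> carrier P" if "u \<in> carrier P" for u
    using dc[of "\<zero>\<^bsub>R\<^esub>" u] Dv[OF that] that by auto
  obtain p x where d1: "d (\<one>\<^bsub>R\<^esub>, \<zero>\<^bsub>P\<^esub>) = (p, x)" and px: "p \<in> carrier R" "x \<in> carrier P"
    using dc[of "\<one>\<^bsub>R\<^esub>" "\<zero>\<^bsub>P\<^esub>"] by auto
  have "(\<one>\<^bsub>R\<^esub>, \<zero>\<^bsub>P\<^esub>) \<otimes>\<^bsub>C\<^esub> (\<one>\<^bsub>R\<^esub>, \<zero>\<^bsub>P\<^esub>) = (\<one>\<^bsub>R\<^esub>, \<zero>\<^bsub>P\<^esub>)"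
    using half T.tr_zero by (simp add: colour_algebra_mult R.minus_eq)
  with dm[of "\<one>\<^bsub>R\<^esub>" "\<zero>\<^bsub>P\<^esub>" "\<one>\<^bsub>R\<^esub>" "\<zero>\<^bsub>P\<^esub>"] have "(p, x) = (p \<oplus>\<^bsub>R\<^esub> p, x \<oplus>\<^bsub>P\<^esub> x)"
    using px half T.tr_zero by (simp add: d1 colour_algebra_mult colour_algebra_simps R.minus_eq)
  then have px0: "p = \<zero>\<^bsub>R\<^esub>" "x = \<zero>\<^bsub>P\<^esub>"
    using px by (simp_all add: R.add.l_cancel_one' M.add.l_cancel_one')
  have dr: "d (a, \<zero>\<^bsub>P\<^esub>) = (\<zero>\<^bsub>R\<^esub>, \<zero>\<^bsub>P\<^esub>)" if "a \<in> carrier R" for a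
    using ds[of a "\<one>\<^bsub>R\<^esub>" "\<zero>\<^bsub>P\<^esub>"] that by (simp add: d1 px0 colour_algebra_simps)
  have dau: "d (a, u) = (f u, D u)" if "a \<in> carrier R" "u \<in> carrier P" for a u
    using da[of a "\<zero>\<^bsub>P\<^esub>" "\<zero>\<^bsub>R\<^esub>" u] that fc Dc by (simp add: dr Dv colour_algebra_simps)
  have fa: "f (u \<oplus>\<^bsub>P\<^esub> v) = f u \<oplus>\<^bsub>R\<^esub> f v" and Da: "D (u \<oplus>\<^bsub>P\<^esub> v) = D u \<oplus>\<^bsub>P\<^esub> D v"
    if "u \<in> carrier P" "v \<in> carrier P" for u v
    using da[of "\<zero>\<^bsub>R\<^esub>" u "\<zero>\<^bsub>R\<^esub>" v] that by (simp_all add: Dv colour_algebra_simps)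
  have Ds: "D (base r \<odot>\<^bsub>P\<^esub> u) = base r \<odot>\<^bsub>P\<^esub> D u" if "r \<in> carrier R" "u \<in> carrier P" for r u
    using ds[of r "\<zero>\<^bsub>R\<^esub>" u] that by (simp add: Dv colour_algebra_simps)
  have prod: "f (u \<times>\<^sub>P v) = \<ominus>\<^bsub>R\<^esub> (half \<otimes>\<^bsub>R\<^esub> tr (h (D u) v)) \<oplus>\<^bsub>R\<^esub> \<ominus>\<^bsub>R\<^esub> (half \<otimes>\<^bsub>R\<^esub> tr (h u (D v)))"
    "D (u \<times>\<^sub>P v) = (base (f u) \<odot>\<^bsub>P\<^esub> v \<oplus>\<^bsub>P\<^esub> D u \<times>\<^sub>P v) \<oplus>\<^bsub>P\<^esub> (base (f v) \<odot>\<^bsub>P\<^esub> u \<oplus>\<^bsub>P\<^esub> u \<times>\<^sub>P D v)"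
    if "u \<in> carrier P" "v \<in> carrier P" for u v
    using dm[of "\<zero>\<^bsub>R\<^esub>" u "\<zero>\<^bsub>R\<^esub>" v] that fc Dc half
    by (simp_all add: colour_algebra_mult dau colour_algebra_simps R.minus_eq)
  have f0: "f u = \<zero>\<^bsub>R\<^esub>" if "u \<in> carrier P" for u
    by (rule real_component_zero[OF fc fa Dc half prod(1) that])
  have "D (u \<times>\<^sub>P v) = D u \<times>\<^sub>P v \<oplus>\<^bsub>P\<^esub> u \<times>\<^sub>P D v" if "u \<in> carrier P" "v \<in> carrier P" for u v
    using prod(2)[OF that] that Dc by (simp add: f0)
  then show "restrict_to_P R P d \<in> derivations R W"
    unfolding derivations_vector_algebra_iff D_def[symmetric] using Dc Da Ds
    by (auto simp: D_def restrict_to_P_def)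
  show "extend_by_zero R P (restrict_to_P R P d) = d"
  proof (rule extensionalityI[OF _ ext])
    show "extend_by_zero R P (restrict_to_P R P d) \<in> extensional (carrier R \<times> carrier P)"
      by (simp add: extend_by_zero_def)
  next
    fix y assume "y \<in> carrier R \<times> carrier P"
    then show "extend_by_zero R P (restrict_to_P R P d) y = d y"
      by (auto simp: extend_by_zero_simp dau f0 D_def)
  qed
qed

abbreviation (input) "DerS \<equiv> {d \<in> derivations R K. \<forall>a\<in>carrier S. d (a, \<zero>\<^bsub>P\<^esub>) = \<zero>\<^bsub>K\<^esub>}"

lemma octonion_derivation_of_vector:
  assumes D: "D \<in> derivations R W"
  shows "extend_by_zero S P D \<in> DerS"
proof -
  note DP = vector_derivation_properties[OF D]
  have skew: "\<ominus> h (D u) v \<oplus> \<ominus> h u (D v) = \<zero>"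
    if "u \<in> carrier P" "v \<in> carrier P" for u v
    using DP(3)[OF that] that DP(1) by (simp add: S.minus_add[symmetric])
  have D0: "D \<zero>\<^bsub>P\<^esub> = \<zero>\<^bsub>P\<^esub>" using DP(2)[of "\<zero>" "\<zero>\<^bsub>P\<^esub>"] DP(1) by simp
  have cl: "carrier K = carrier S \<times> carrier P" by (rule octonion_algebra_simps(1))
  have "extend_by_zero S P D \<in> derivations R K"
    unfolding derivations_iff
  proof (intro conjI ballI)
    show "extend_by_zero S P D \<in> extensional (carrier K)"
      unfolding cl extend_by_zero_def by simp
    show "extend_by_zero S P D \<in> carrier K \<rightarrow> carrier K"
      unfolding cl by (auto simp: extend_by_zero_def DP(1))
  next
    fix x y assume "x \<in> carrier K" "y \<in> carrier K"
    then obtain a u b v where xy: "x = (a, u)" "y = (b, v)"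
      and c: "a \<in> carrier S" "b \<in> carrier S" "u \<in> carrier P" "v \<in> carrier P"
      unfolding cl by blast
    show "extend_by_zero S P D (x \<oplus>\<^bsub>K\<^esub> y) = extend_by_zero S P D x \<oplus>\<^bsub>K\<^esub> extend_by_zero S P D y"
      unfolding xy using c by (simp add: octonion_algebra_simps extend_by_zero_simp DP)
    show "extend_by_zero S P D (x \<otimes>\<^bsub>K\<^esub> y)
        = (extend_by_zero S P D x \<otimes>\<^bsub>K\<^esub> y) \<oplus>\<^bsub>K\<^esub> (x \<otimes>\<^bsub>K\<^esub> extend_by_zero S P D y)"
      unfolding xy using c skew[of u v]
      by (simp add: octonion_algebra_simps octonion_algebra_mult extend_by_zero_simp DP S.minus_eq M.a_ac)
  next
    fix r x assume r: "r \<in> carrier R" and "x \<in> carrier K"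
    then obtain a u where x: "x = (a, u)" and c: "a \<in> carrier S" "u \<in> carrier P"
      unfolding cl by blast
    show "extend_by_zero S P D (r \<odot>\<^bsub>K\<^esub> x) = r \<odot>\<^bsub>K\<^esub> extend_by_zero S P D x"
      unfolding x using c r by (simp add: octonion_algebra_simps extend_by_zero_simp DP)
  qed
  then show ?thesis by (simp add: extend_by_zero_simp D0 octonion_algebra_simps)
qed

text \<open>Left multiplication by \<open>(a, 0)\<close> commutes with \<open>d\<close>, which makes both components of \<open>d\<close> linear over
  \<open>S\<close>; the product \<open>(0, u) (0, v)\<close> gives the rest as for the colour algebra.\<close>

lemma vector_derivation_of_octonion:
  assumes d: "d \<in> DerS"
  shows "restrict_to_P S P d \<in> derivations R W"
    and "extend_by_zero S P (restrict_to_P S P d) = d"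
proof -
  have cl: "carrier K = carrier S \<times> carrier P" by (rule octonion_algebra_simps(1))
  have ext: "d \<in> extensional (carrier S \<times> carrier P)"
    and dc: "\<And>a u. a \<in> carrier S \<Longrightarrow> u \<in> carrier P \<Longrightarrow> d (a, u) \<in> carrier S \<times> carrier P"
    and da: "\<And>a u b v. a \<in> carrier S \<Longrightarrow> u \<in> carrier P \<Longrightarrow> b \<in> carrier S \<Longrightarrow> v \<in> carrier P \<Longrightarrow>
       d (a \<oplus> b, u \<oplus>\<^bsub>P\<^esub> v) = d (a, u) \<oplus>\<^bsub>K\<^esub> d (b, v)"
    and dm: "\<And>a u b v. a \<in> carrier S \<Longrightarrow> u \<in> carrier P \<Longrightarrow> b \<in> carrier S \<Longrightarrow> v \<in> carrier P \<Longrightarrow>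
       d ((a, u) \<otimes>\<^bsub>K\<^esub> (b, v)) = (d (a, u) \<otimes>\<^bsub>K\<^esub> (b, v)) \<oplus>\<^bsub>K\<^esub> ((a, u) \<otimes>\<^bsub>K\<^esub> d (b, v))"
    and dS: "\<And>a. a \<in> carrier S \<Longrightarrow> d (a, \<zero>\<^bsub>P\<^esub>) = (\<zero>, \<zero>\<^bsub>P\<^esub>)"
    using d unfolding derivations_iff cl by (auto simp: octonion_algebra_simps(2) octonion_algebra_simps(3,4)[symmetric] Pi_iff)
  define f where "f u = fst (d (\<zero>, u))" for u
  define D where "D = restrict_to_P S P d"
  have Dv: "d (\<zero>, u) = (f u, D u)" if "u \<in> carrier P" for u
    using that by (simp add: f_def D_def restrict_to_P_def)
  have fc: "f u \<in> carrier S" and Dc: "D u \<in> carrier P" if "u \<in> carrier P" for u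
    using dc[of "\<zero>" u] Dv[OF that] that by auto
  have dau: "d (a, u) = (f u, D u)" if "a \<in> carrier S" "u \<in> carrier P" for a u
    using da[of a "\<zero>\<^bsub>P\<^esub>" "\<zero>" u] that fc Dc by (simp add: dS Dv octonion_algebra_simps)
  have fa: "f (u \<oplus>\<^bsub>P\<^esub> v) = f u \<oplus> f v" and Da: "D (u \<oplus>\<^bsub>P\<^esub> v) = D u \<oplus>\<^bsub>P\<^esub> D v"
    if "u \<in> carrier P" "v \<in> carrier P" for u v
    using da[of "\<zero>" u "\<zero>" v] that by (simp_all add: Dv octonion_algebra_simps)
  have fs: "f (a \<odot>\<^bsub>P\<^esub> u) = a \<otimes> f u" and Ds: "D (a \<odot>\<^bsub>P\<^esub> u) = a \<odot>\<^bsub>P\<^esub> D u"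
    if "a \<in> carrier S" "u \<in> carrier P" for a u
    using dm[of a "\<zero>\<^bsub>P\<^esub>" "\<zero>" u] that fc Dc Dv[of "\<zero>\<^bsub>P\<^esub>"] dS[of "\<zero>"]
    by (simp_all add: octonion_algebra_mult dau octonion_algebra_simps S.minus_eq)
  have prod: "f (u \<times>\<^sub>P v) = \<ominus> h (D u) v \<oplus> \<ominus> h u (D v)"
    "D (u \<times>\<^sub>P v) = (f u \<odot>\<^bsub>P\<^esub> v \<oplus>\<^bsub>P\<^esub> D u \<times>\<^sub>P v) \<oplus>\<^bsub>P\<^esub> (cnj (f v) \<odot>\<^bsub>P\<^esub> u \<oplus>\<^bsub>P\<^esub> u \<times>\<^sub>P D v)"
    if "u \<in> carrier P" "v \<in> carrier P" for u v
    using dm[of "\<zero>" u "\<zero>" v] that fc Dc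
    by (simp_all add: octonion_algebra_mult dau octonion_algebra_simps S.minus_eq)
  have f0: "f u = \<zero>" if "u \<in> carrier P" for u
    by (rule extension_component_zero[OF fc fa fs Dc prod(1) that])
  have "D (u \<times>\<^sub>P v) = D u \<times>\<^sub>P v \<oplus>\<^bsub>P\<^esub> u \<times>\<^sub>P D v" if "u \<in> carrier P" "v \<in> carrier P" for u v
    using prod(2)[OF that] that Dc by (simp add: f0)
  then show "restrict_to_P S P d \<in> derivations R W"
    unfolding derivations_vector_algebra_iff D_def[symmetric] using Dc Da Ds
    by (auto simp: D_def restrict_to_P_def)
  show "extend_by_zero S P (restrict_to_P S P d) = d"
  proof (rule extensionalityI[OF _ ext])
    show "extend_by_zero S P (restrict_to_P S P d) \<in> extensional (carrier S \<times> carrier P)"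
      by (simp add: extend_by_zero_def)
  next
    fix y assume "y \<in> carrier S \<times> carrier P"
    then show "extend_by_zero S P (restrict_to_P S P d) y = d y"
      by (auto simp: extend_by_zero_simp dau f0 D_def)
  qed
qed

lemma derivation_algebras:
  shows "lie_iso R (Der R C) (Der R W) (restrict_to_P R P)"
    "\<And>D. D \<in> derivations R W \<Longrightarrow> restrict_to_P R P (extend_by_zero R P D) = D"
    "lie_iso R (Der_S R S P K) (Der R W) (restrict_to_P S P)"
    "\<And>D. D \<in> derivations R W \<Longrightarrow> restrict_to_P S P (extend_by_zero S P D) = D"
proof -
  have Y: "derivations R W \<subseteq> extensional (carrier P) \<inter> (carrier P \<rightarrow> carrier P)"
    unfolding derivations_vector_algebra_iff subset_iff by blast
  have sC: "snd (r \<odot>\<^bsub>C\<^esub> (a, u)) = r \<odot>\<^bsub>W\<^esub> u" for r a u by (simp add: colour_algebra_simps vector_algebra_simps)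
  have sK: "snd (r \<odot>\<^bsub>K\<^esub> (a, u)) = r \<odot>\<^bsub>W\<^esub> u" for r a u by (simp add: octonion_algebra_simps vector_algebra_simps)
  note col = lie_iso_restrict_to_P[OF R.abelian_group_axioms M.abelian_group_axioms colour_algebra_simps(1-3) sC
      vector_algebra_simps(1-3) Y vector_derivation_of_colour colour_derivation_of_vector]
  note oct = lie_iso_restrict_to_P[OF S.abelian_group_axioms M.abelian_group_axioms octonion_algebra_simps(1-3) sK
      vector_algebra_simps(1-3) Y vector_derivation_of_octonion octonion_derivation_of_vector]
  show "lie_iso R (Der R C) (Der R W) (restrict_to_P R P)"
    unfolding Der_def by (rule col(1))
  show "\<And>D. D \<in> derivations R W \<Longrightarrow> restrict_to_P R P (extend_by_zero R P D) = D" by (rule col(2))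
  show "lie_iso R (Der_S R S P K) (Der R W) (restrict_to_P S P)"
    unfolding Der_def Der_S_def by (rule oct(1))
  show "\<And>D. D \<in> derivations R W \<Longrightarrow> restrict_to_P S P (extend_by_zero S P D) = D" by (rule oct(2))
qed

end

theorem lemma3p5:
  fixes R :: "'r ring"
    and S :: "('r, 's) module"
    and P :: "('s, 'p) module"
    and h :: "'p \<Rightarrow> 'p \<Rightarrow> 's"
    and \<alpha> :: "('p \<times> 'p \<times> 'p \<Rightarrow> 's) set \<Rightarrow> 's"
  assumes "cring R"
    and "\<one>\<^bsub>R\<^esub> \<oplus>\<^bsub>R\<^esub> \<one>\<^bsub>R\<^esub> \<in> Units R"
    and "quadratic_etale R S"
    and "hermitian_space_rank3 S (canonical_involution R S) P h"
    and "determinant_trivialization S (canonical_involution R S) P h \<alpha>"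
  shows
    "lie_iso R (Der R (colour_algebra R S P h \<alpha>)) (Der R (vector_algebra S P h \<alpha>))
       (restrict_to_P R P) \<and>
     (\<forall>d\<in>carrier (Der R (colour_algebra R S P h \<alpha>)).
        extend_by_zero R P (restrict_to_P R P d) = d) \<and>
     (\<forall>D\<in>carrier (Der R (vector_algebra S P h \<alpha>)).
        extend_by_zero R P D \<in> carrier (Der R (colour_algebra R S P h \<alpha>)) \<and>
        restrict_to_P R P (extend_by_zero R P D) = D) \<and>
     lie_iso R (Der_S R S P (octonion_algebra R S P h \<alpha>)) (Der R (vector_algebra S P h \<alpha>))
       (restrict_to_P S P) \<and>
     (\<forall>d\<in>carrier (Der_S R S P (octonion_algebra R S P h \<alpha>)).
        extend_by_zero S P (restrict_to_P S P d) = d) \<and>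
     (\<forall>D\<in>carrier (Der R (vector_algebra S P h \<alpha>)).
        extend_by_zero S P D \<in> carrier (Der_S R S P (octonion_algebra R S P h \<alpha>)) \<and>
        restrict_to_P S P (extend_by_zero S P D) = D)"
proof -
  note ecp = etale_cross_product_of_trivialization[OF assms]
  note algs = derivation_algebras[OF ecp]
  show ?thesis
    using algs(1,3) vector_derivation_of_colour(2)[OF ecp] vector_derivation_of_octonion(2)[OF ecp]
      colour_derivation_of_vector[OF ecp] octonion_derivation_of_vector[OF ecp] algs(2,4)
    unfolding carrier_Der carrier_Der_S by (intro conjI ballI)
qed

end
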